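(* Let $n,k,t,r$ be integers with $r\geq 3$ and $(t+r-1)(k-t-r+3)<n$, and let $\mathcal{F}\subseteq\binom{[n]}{k}$ be a non-trivial $r$-wise $t$-intersecting family. (i) If $2t+2r-3<k$, then $|\mathcal{F}|\leq\max\{h_1(t+r-2,k,k+1),\,h_2(t+r)\}$, and if equality holds then either $h_1(t+r-2,k,k+1)\geq h_2(t+r)$ and $\mathcal{F}=\mathcal{H}(k,t+r-1,X,M)$ for some $(k+1)$-subset $M$ of $[n]$ and some $(t+r-2)$-subset $X$ of $M$, or $h_2(t+r)\geq h_1(t+r-2,k,k+1)$ and $\mathcal{F}=\mathcal{A}(k,t+r-1,Z)$ for some $(t+r)$-subset $Z$ of $[n]$ (i.e. $\mathcal{F}$ is whichever of these two families has the larger size). (ii) If $2t+2r-3\geq k$, then $|\mathcal{F}|\leq h_2(t+r)$, and equality holds only if $\mathcal{F}=\mathcal{A}(k,t+r-1,Z)$ for some $(t+r)$-subset $Z$ of $[n]$.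
   Context: $[n]=\{1,\dots,n\}$ and $\binom{V}{k}$ denotes the family of $k$-subsets of a set $V$. For an integer $r\geq 2$, a family $\mathcal{F}\subseteq\binom{[n]}{k}$ is $r$-wise $t$-intersecting if $|F_1\cap\cdots\cap F_r|\geq t$ for all $F_1,\dots,F_r\in\mathcal{F}$; it is trivial if all its members contain a common $t$-subset of $[n]$, and non-trivial otherwise. For positive integers $k,d$ with $k>d$, $M\in\binom{[n]}{k+1}$, $X\in\binom{M}{d}$ and $Z\in\binom{[n]}{d+2}$, define $\mathcal{H}(k,d+1,X,M)=\{H\in\binom{[n]}{k}: X\subseteq H,\ |H\cap M|\geq d+1\}\cup\binom{M}{k}$ and $\mathcal{A}(k,d+1,Z)=\{A\in\binom{[n]}{k}: |A\cap Z|\geq d+1\}$. Define $h_1(d,k,c)=\binom{n-d}{k-d}-\binom{n-k}{k-d}+\binom{n-c}{2k-c-d}+d(c-k)$ and $h_2(d+2)=(d+2)\binom{n-d-1}{k-d-1}-(d+1)\binom{n-d-2}{k-d-2}$ (so $h_2(t+r)$ is this with $d=t+r-2$). Binomial coefficients $\binom{a}{b}$ are $0$ when $b<0$ or $b>a$. *)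

theory Defs
  imports Complex_Main "HOL-Library.Ramsey"
begin

text \<open>The family of all \<open>k\<close>-subsets of \<open>V\<close> is \<open>nsets V k\<close>,
  and the ground set is \<open>{1..n}\<close>.\<close>

definition r_wise_t_intersecting :: "nat \<Rightarrow> nat \<Rightarrow> nat set set \<Rightarrow> bool" where
  "r_wise_t_intersecting r t \<F> \<longleftrightarrow>
     (\<forall>F :: nat \<Rightarrow> nat set. (\<forall>i\<in>{1..r}. F i \<in> \<F>) \<longrightarrow> t \<le> card (\<Inter>i\<in>{1..r}. F i))"

definition trivial_family :: "nat \<Rightarrow> nat \<Rightarrow> nat set set \<Rightarrow> bool" where
  "trivial_family n t \<F> \<longleftrightarrow> (\<exists>T \<in> nsets {1..n} t. \<forall>F\<in>\<F>. T \<subseteq> F)"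

text \<open>The second numerical argument of the next two families is \<open>d + 1\<close>, where
  \<open>card X = d\<close> and \<open>card Z = d + 2\<close>.\<close>

definition family_H :: "nat \<Rightarrow> nat \<Rightarrow> nat \<Rightarrow> nat set \<Rightarrow> nat set \<Rightarrow> nat set set" where
  "family_H n k e X M = {H \<in> nsets {1..n} k. X \<subseteq> H \<and> e \<le> card (H \<inter> M)} \<union> nsets M k"

definition family_A :: "nat \<Rightarrow> nat \<Rightarrow> nat \<Rightarrow> nat set \<Rightarrow> nat set set" where
  "family_A n k e Z = {A \<in> nsets {1..n} k. e \<le> card (A \<inter> Z)}"

text \<open>Integer arguments avoid truncated subtraction; unlike \<open>gchoose\<close>, this is \<open>0\<close>
  whenever the upper argument is negative.\<close>

definition binom :: "int \<Rightarrow> int \<Rightarrow> int" where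
  "binom a b = (if b < 0 \<or> b > a then 0 else int (nat a choose nat b))"

definition h1 :: "int \<Rightarrow> int \<Rightarrow> int \<Rightarrow> int \<Rightarrow> int" where
  "h1 n d k c =
     binom (n - d) (k - d) - binom (n - k) (k - d) + binom (n - c) (2 * k - c - d) + d * (c - k)"

text \<open>The argument \<open>m\<close> stands for \<open>d + 2\<close>.\<close>

definition h2 :: "int \<Rightarrow> int \<Rightarrow> int \<Rightarrow> int" where
  "h2 n k m = (let d = m - 2 in
     (d + 2) * binom (n - d - 1) (k - d - 1) - (d + 1) * binom (n - d - 2) (k - d - 2))"

end

theory Submission
  imports Defs "HOL.Binomial_Plus"
begin

text \<open>Put \<open>d = t + r - 2\<close> and \<open>\<kappa> = k - d\<close>. By nontriviality any two members of the family meet in at least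
  \<open>d\<close> points and any three in at least \<open>d - 1\<close>. If two members always share \<open>d + 1\<close> points, shifting and
  Pascal's recurrence bound the family by \<open>(n - 1) choose (\<kappa> - 1)\<close>, which is too small. Otherwise
  some two members meet in a set \<open>D\<close> of exactly \<open>d\<close> points, and every member contains all but at most
  one point of \<open>D\<close>. Shifts towards \<open>D\<close> that keep at least two points of \<open>D\<close> missed by some member preserve
  this structure, so one may take the family to be maximal and stable under them. Let \<open>j\<close> be the least
  size of the intersection outside \<open>D\<close> of two members missing distinct points of \<open>D\<close>; it is attained on
  an initial segment \<open>C\<close>. Then \<open>j = 2\<close> forces a subfamily of \<open>\<A>\<close>, and \<open>j = \<kappa> + 1\<close> a subfamily of \<open>\<H>\<close>.
  For intermediate \<open>j\<close>, Frankl's sharpening of the Hilton-Milner theorem bounds the members that contain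
  a fixed \<open>d - 1\<close> points of \<open>D\<close>, and a bound for \<open>j\<close>-intersecting families the others; the total
  is smaller than \<open>\<H>\<close>. For the uniqueness, a shift turns the family into an extremal one
  only if it was already extremal: the sets that the shift might have moved are linked by pairs
  meeting in exactly \<open>d\<close> points, so all or none of them moved.\<close>

section \<open>Shifting\<close>

text \<open>Nontriviality may be destroyed by a shift. It is therefore weakened to the demand that
  two points of \<open>D\<close> be missed, and a shift that would violate this demand is not
  performed. The obstacle is that shifts from outside \<open>D\<close> into \<open>D\<close> may be
  forbidden for this reason. Maximality removes it: let \<open>I0\<close> be the initial segment of
  \<open>\<kappa> + 1\<close> points outside \<open>D\<close>. If any two members missing distinct
  points of \<open>D\<close> share at least two points of \<open>I0\<close>, then all sets
  \<open>D \<union> (I0 - {c})\<close> with \<open>c \<in> I0\<close> belong to the family, and they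
  hold the members \<open>(D - {x}) \<union> I0\<close> in place, so every shift into
  \<open>D\<close> is allowed. Otherwise some point of \<open>I0\<close> lies in every member and
  only two points of \<open>D\<close> are ever missed; this degenerate case is a Hilton-Milner
  problem and is settled without \<open>j\<close>. The threshold
  \<open>2 * t + 2 * r - 3 = 2 * d + 1\<close> comes from comparing \<open>\<H>\<close> with
  \<open>\<A>\<close>: with \<open>N = n - d\<close>, only \<open>\<kappa> - 1\<close> Pascal terms
  separate \<open>(N - 2) choose \<kappa>\<close> from
  \<open>(N - \<kappa> - 1) choose \<kappa>\<close>, and for \<open>\<kappa> \<le> d + 1\<close> the
  \<open>d\<close> sets of terms counted in \<open>\<A>\<close> outweigh them.\<close>

definition swap_elem :: "nat \<Rightarrow> nat \<Rightarrow> nat set \<Rightarrow> nat set" where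
  "swap_elem i j A = insert i (A - {j})"

definition shift :: "nat \<Rightarrow> nat \<Rightarrow> nat set set \<Rightarrow> nat set set" where
  "shift i j \<F> = (\<lambda>A. if j \<in> A \<and> i \<notin> A \<and> swap_elem i j A \<notin> \<F> then swap_elem i j A else A) ` \<F>"

definition stable :: "nat \<Rightarrow> nat \<Rightarrow> nat set set \<Rightarrow> bool" where
  "stable i j \<F> \<longleftrightarrow> (\<forall>A\<in>\<F>. j \<in> A \<and> i \<notin> A \<longrightarrow> swap_elem i j A \<in> \<F>)"

definition shifted :: "nat set \<Rightarrow> nat set set \<Rightarrow> bool" where
  "shifted W \<F> \<longleftrightarrow> (\<forall>i\<in>W. \<forall>j\<in>W. i < j \<longrightarrow> stable i j \<F>)"

definition inter2 :: "nat \<Rightarrow> nat set set \<Rightarrow> bool" where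
  "inter2 s \<F> \<longleftrightarrow> (\<forall>A\<in>\<F>. \<forall>B\<in>\<F>. s \<le> card (A \<inter> B))"

definition inter3 :: "nat \<Rightarrow> nat set set \<Rightarrow> bool" where
  "inter3 s \<F> \<longleftrightarrow> (\<forall>A\<in>\<F>. \<forall>B\<in>\<F>. \<forall>C\<in>\<F>. s \<le> card (A \<inter> B \<inter> C))"

lemma inter2D: "inter2 s \<F> \<Longrightarrow> A \<in> \<F> \<Longrightarrow> B \<in> \<F> \<Longrightarrow> s \<le> card (A \<inter> B)"
  by (auto simp: inter2_def)

lemma inter3D: "inter3 s \<F> \<Longrightarrow> A \<in> \<F> \<Longrightarrow> B \<in> \<F> \<Longrightarrow> C \<in> \<F> \<Longrightarrow> s \<le> card (A \<inter> B \<inter> C)"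
  by (auto simp: inter3_def)

lemma stableD: "stable i j \<F> \<Longrightarrow> A \<in> \<F> \<Longrightarrow> j \<in> A \<Longrightarrow> i \<notin> A \<Longrightarrow> swap_elem i j A \<in> \<F>"
  by (auto simp: stable_def)

lemma shiftedD:
  "shifted W \<F> \<Longrightarrow> A \<in> \<F> \<Longrightarrow> i \<in> W \<Longrightarrow> j \<in> W \<Longrightarrow> i < j \<Longrightarrow> j \<in> A \<Longrightarrow> i \<notin> A
    \<Longrightarrow> swap_elem i j A \<in> \<F>"
  by (auto simp: shifted_def stable_def)

lemma card_swap_elem: "finite A \<Longrightarrow> j \<in> A \<Longrightarrow> i \<notin> A \<Longrightarrow> card (swap_elem i j A) = card A"
  unfolding swap_elem_def using card_gt_0_iff[of A] by auto

lemma swap_elem_swap_elem: "j \<in> A \<Longrightarrow> i \<notin> A \<Longrightarrow> swap_elem j i (swap_elem i j A) = A"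
  unfolding swap_elem_def by auto

lemma nsets_finite_mem: "A \<in> nsets W k \<Longrightarrow> finite A"
  by (simp add: nsets_def)

lemma finite_nsets: "finite W \<Longrightarrow> finite (nsets W k)"
  by (simp add: finite_imp_finite_nsets)

lemma swap_elem_nsets: "A \<in> nsets W k \<Longrightarrow> i \<in> W \<Longrightarrow> j \<in> A \<Longrightarrow> i \<notin> A \<Longrightarrow> swap_elem i j A \<in> nsets W k"
  by (auto simp: nsets_def card_swap_elem) (auto simp: swap_elem_def)

text \<open>The second alternative is a moved set, which is then new. The alternatives exclude each
  other, so the history of a set of the image is decided by its membership in the original
  family.\<close>

lemma mem_shift_iff:
  assumes "i \<noteq> j"
  shows "B \<in> shift i j \<F> \<longleftrightarrow>
    (B \<in> \<F> \<and> (j \<in> B \<and> i \<notin> B \<longrightarrow> swap_elem i j B \<in> \<F>)) \<or>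
    (B \<notin> \<F> \<and> i \<in> B \<and> j \<notin> B \<and> swap_elem j i B \<in> \<F>)"
proof
  assume "B \<in> shift i j \<F>"
  then obtain A where A: "A \<in> \<F>"
    "B = (if j \<in> A \<and> i \<notin> A \<and> swap_elem i j A \<notin> \<F> then swap_elem i j A else A)"
    by (auto simp: shift_def)
  show "(B \<in> \<F> \<and> (j \<in> B \<and> i \<notin> B \<longrightarrow> swap_elem i j B \<in> \<F>)) \<or>
    (B \<notin> \<F> \<and> i \<in> B \<and> j \<notin> B \<and> swap_elem j i B \<in> \<F>)"
  proof (cases "j \<in> A \<and> i \<notin> A \<and> swap_elem i j A \<notin> \<F>")
    case True
    then have "B = swap_elem i j A" using A by simp
    then show ?thesis using True A assms swap_elem_swap_elem[of j A i]
      by (auto simp: swap_elem_def)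
  next
    case False
    then show ?thesis using A by auto
  qed
next
  assume "(B \<in> \<F> \<and> (j \<in> B \<and> i \<notin> B \<longrightarrow> swap_elem i j B \<in> \<F>)) \<or>
    (B \<notin> \<F> \<and> i \<in> B \<and> j \<notin> B \<and> swap_elem j i B \<in> \<F>)"
  then show "B \<in> shift i j \<F>"
  proof
    assume "B \<in> \<F> \<and> (j \<in> B \<and> i \<notin> B \<longrightarrow> swap_elem i j B \<in> \<F>)"
    then show ?thesis unfolding shift_def by (intro image_eqI[of _ _ B]) auto
  next
    assume *: "B \<notin> \<F> \<and> i \<in> B \<and> j \<notin> B \<and> swap_elem j i B \<in> \<F>"
    then have "swap_elem i j (swap_elem j i B) = B" using swap_elem_swap_elem by simp
    moreover have "j \<in> swap_elem j i B" "i \<notin> swap_elem j i B"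
      using assms by (auto simp: swap_elem_def)
    ultimately show ?thesis using * unfolding shift_def by (intro image_eqI[of _ _ "swap_elem j i B"]) auto
  qed
qed

lemma inj_on_shift:
  "inj_on (\<lambda>A. if j \<in> A \<and> i \<notin> A \<and> swap_elem i j A \<notin> \<F> then swap_elem i j A else A) \<F>"
proof (rule inj_onI)
  fix A B
  assume AB: "A \<in> \<F>" "B \<in> \<F>"
    and eq: "(if j \<in> A \<and> i \<notin> A \<and> swap_elem i j A \<notin> \<F> then swap_elem i j A else A) =
      (if j \<in> B \<and> i \<notin> B \<and> swap_elem i j B \<notin> \<F> then swap_elem i j B else B)"
  from eq AB consider "swap_elem i j A = swap_elem i j B" "j \<in> A" "i \<notin> A" "j \<in> B" "i \<notin> B" | "A = B"
    by (simp split: if_split_asm)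
  then show "A = B"
    by cases (metis swap_elem_swap_elem)
qed

lemma card_shift: "card (shift i j \<F>) = card \<F>"
  unfolding shift_def by (rule card_image[OF inj_on_shift])

lemma shift_subset_nsets: "\<F> \<subseteq> nsets W k \<Longrightarrow> i \<in> W \<Longrightarrow> shift i j \<F> \<subseteq> nsets W k"
  unfolding shift_def by (auto intro: swap_elem_nsets)

text \<open>Termination measure: a shift from \<open>j\<close> to a smaller \<open>i\<close> that
  moves any set lowers it strictly.\<close>

definition weight :: "nat set set \<Rightarrow> nat" where
  "weight \<F> = (\<Sum>A\<in>\<F>. \<Sum>A)"

lemma sum_swap_elem_less:
  assumes "finite A" "i < j" "j \<in> A" "i \<notin> A"
  shows "\<Sum>(swap_elem i j A) < \<Sum>A"
proof -
  have "\<Sum>(swap_elem i j A) = i + \<Sum>(A - {j})"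
    using assms by (simp add: swap_elem_def)
  moreover have "\<Sum>A = j + \<Sum>(A - {j})" using assms by (simp add: sum.remove)
  ultimately show ?thesis using assms by simp
qed

lemma weight_shift_less:
  assumes "finite \<F>" "\<And>A. A \<in> \<F> \<Longrightarrow> finite A" "i < j" "\<not> stable i j \<F>"
  shows "weight (shift i j \<F>) < weight \<F>"
proof -
  let ?g = "\<lambda>A. if j \<in> A \<and> i \<notin> A \<and> swap_elem i j A \<notin> \<F> then swap_elem i j A else A"
  have "weight (shift i j \<F>) = (\<Sum>A\<in>\<F>. \<Sum>(?g A))"
    unfolding weight_def shift_def by (subst sum.reindex[OF inj_on_shift]) simp
  also have "\<dots> < weight \<F>" unfolding weight_def
  proof (rule sum_strict_mono_ex1)
    show "\<forall>A\<in>\<F>. \<Sum>(?g A) \<le> \<Sum>A"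
      using assms sum_swap_elem_less by (auto intro: less_imp_le)
    show "\<exists>A\<in>\<F>. \<Sum>(?g A) < \<Sum>A"
    proof -
      obtain A where "A \<in> \<F>" "j \<in> A" "i \<notin> A" "swap_elem i j A \<notin> \<F>"
        using assms(4) unfolding stable_def by blast
      then show ?thesis using assms(2,3) sum_swap_elem_less[of A i j] by (intro bexI[of _ A]) simp_all
    qed
  qed fact
  finally show ?thesis .
qed

text \<open>Treating a whole subfamily of the image at once serves pairs and triples alike. Undoing
  the moves by \<open>p\<close> can enlarge the intersection only by the point \<open>j\<close>.
  Either the loss of \<open>i\<close> pays for this, or some member \<open>B0\<close> stayed
  although it contains \<open>j\<close> and lacks \<open>i\<close>. Then \<open>j\<close> lies in
  all preimages, every unmoved member lacking \<open>i\<close> has its swap in the family, and using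
  these swaps in \<open>g\<close> removes \<open>j\<close> again.\<close>

lemma shift_Inter:
  assumes ij: "i \<noteq> j" and fin: "\<And>A. A \<in> \<F> \<Longrightarrow> finite A"
    and H: "\<H> \<subseteq> shift i j \<F>" "\<H> \<noteq> {}"
  shows "\<exists>g. g ` \<H> \<subseteq> \<F> \<and> card (\<Inter> (g ` \<H>)) \<le> card (\<Inter> \<H>)"
proof (cases "\<H> \<subseteq> \<F>")
  case True
  then show ?thesis by (intro exI[of _ id]) auto
next
  case False
  then obtain A where A: "A \<in> \<H>" "A \<notin> \<F>" by auto
  define p where "p B = (if B \<in> \<F> then B else swap_elem j i B)" for B
  have new: "i \<in> B \<and> j \<notin> B \<and> swap_elem j i B \<in> \<F>" if "B \<in> \<H>" "B \<notin> \<F>" for B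
    using that H mem_shift_iff[OF ij] by blast
  have old: "j \<in> B \<Longrightarrow> i \<notin> B \<Longrightarrow> swap_elem i j B \<in> \<F>" if "B \<in> \<H>" "B \<in> \<F>" for B
    using that H mem_shift_iff[OF ij] by blast
  have pF: "p B \<in> \<F>" if "B \<in> \<H>" for B using new that by (auto simp: p_def)
  have finH: "finite B" if "B \<in> \<H>" for B
  proof (cases "B \<in> \<F>")
    case False
    then have "finite (swap_elem j i B)" using new that fin by blast
    then show ?thesis by (simp add: swap_elem_def)
  qed (use fin in auto)
  have finI: "finite (\<Inter> \<H>)" using finH A by (meson Inter_lower finite_subset)
  \<comment> \<open>\<open>A\<close> is a moved set, so its preimage lacks \<open>i\<close>; hence
    \<open>i\<close> is in none of the intersections of preimages below.\<close>
  have iA: "i \<notin> swap_elem j i A" using ij by (auto simp: swap_elem_def)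
  show ?thesis
  proof (cases "j \<in> \<Inter> (p ` \<H>)")
    case False
    have "\<Inter> (p ` \<H>) \<subseteq> \<Inter> \<H>"
    proof (intro subsetI InterI)
      fix x B assume x: "x \<in> \<Inter> (p ` \<H>)" and B: "B \<in> \<H>"
      have "x \<in> p A" "x \<in> p B" using x A B by auto
      moreover have "x \<noteq> j" using x False by auto
      moreover have "x \<noteq> i" using \<open>x \<in> p A\<close> iA A by (auto simp: p_def)
      ultimately show "x \<in> B" by (auto simp: p_def swap_elem_def split: if_splits)
    qed
    then show ?thesis using pF finI by (intro exI[of _ p]) (auto intro: card_mono)
  next
    case jp: True
    show ?thesis
    proof (cases "i \<in> \<Inter> \<H>")
      case True
      have "\<Inter> (p ` \<H>) \<subseteq> insert j (\<Inter> \<H> - {i})"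
      proof (intro subsetI)
        fix x assume x: "x \<in> \<Inter> (p ` \<H>)"
        have xi: "x \<noteq> i" using x A iA by (auto simp: p_def)
        show "x \<in> insert j (\<Inter> \<H> - {i})"
        proof (cases "x = j")
          case False
          have "x \<in> B" if B: "B \<in> \<H>" for B
          proof -
            have "x \<in> p B" using x B by auto
            then show ?thesis using False xi by (auto simp: p_def swap_elem_def split: if_splits)
          qed
          then show ?thesis using xi by auto
        qed simp
      qed
      then have "card (\<Inter> (p ` \<H>)) \<le> card (insert j (\<Inter> \<H> - {i}))"
        using finI by (intro card_mono) auto
      also have "\<dots> \<le> Suc (card (\<Inter> \<H> - {i}))" using finI by (simp add: card_insert_if)
      also have "\<dots> = card (\<Inter> \<H>)" using card_Suc_Diff1[OF finI True] .
      finally show ?thesis using pF by (intro exI[of _ p]) auto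
    next
      case False
      then obtain B0 where B0: "B0 \<in> \<H>" "i \<notin> B0" by auto
      then have B0F: "B0 \<in> \<F>" using new by blast
      then have jB0: "j \<in> B0" using jp B0 by (auto simp: p_def)
      define g where "g B = (if B \<in> \<F> \<and> i \<notin> B then swap_elem i j B else p B)" for B
      have jB: "j \<in> B" if "B \<in> \<H>" "B \<in> \<F>" for B using jp that by (auto simp: p_def)
      have gF: "g B \<in> \<F>" if "B \<in> \<H>" for B
        using that pF old jB by (auto simp: g_def)
      have "\<Inter> (g ` \<H>) \<subseteq> \<Inter> \<H>"
      proof (intro subsetI InterI)
        fix x B assume x: "x \<in> \<Inter> (g ` \<H>)" and B: "B \<in> \<H>"
        have "x \<in> g A" "x \<in> g B" "x \<in> g B0" using x A B B0 by auto
        moreover have "x \<noteq> i" using \<open>x \<in> g A\<close> iA A by (auto simp: g_def p_def)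
        moreover have "x \<noteq> j" using \<open>x \<in> g B0\<close> B0F B0 ij by (auto simp: g_def swap_elem_def)
        ultimately show "x \<in> B" by (auto simp: g_def p_def swap_elem_def split: if_splits)
      qed
      then show ?thesis using gF finI by (intro exI[of _ g]) (auto intro: card_mono)
    qed
  qed
qed

lemma inter2_shift:
  assumes "i \<noteq> j" "\<And>A. A \<in> \<F> \<Longrightarrow> finite A" "inter2 s \<F>"
  shows "inter2 s (shift i j \<F>)"
  unfolding inter2_def
proof (intro ballI)
  fix A B assume "A \<in> shift i j \<F>" "B \<in> shift i j \<F>"
  then obtain g where g: "g ` {A, B} \<subseteq> \<F>" "card (\<Inter> (g ` {A, B})) \<le> card (\<Inter> {A, B})"
    using shift_Inter[OF assms(1,2), of \<F> "{A, B}"] by auto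
  then have "s \<le> card (g A \<inter> g B)" using assms(3) by (auto simp: inter2_def)
  then show "s \<le> card (A \<inter> B)" using g by simp
qed

lemma inter3_shift:
  assumes "i \<noteq> j" "\<And>A. A \<in> \<F> \<Longrightarrow> finite A" "inter3 s \<F>"
  shows "inter3 s (shift i j \<F>)"
  unfolding inter3_def
proof (intro ballI)
  fix A B C assume "A \<in> shift i j \<F>" "B \<in> shift i j \<F>" "C \<in> shift i j \<F>"
  then obtain g where g: "g ` {A, B, C} \<subseteq> \<F>" "card (\<Inter> (g ` {A, B, C})) \<le> card (\<Inter> {A, B, C})"
    using shift_Inter[OF assms(1,2), of \<F> "{A, B, C}"] by auto
  then have "s \<le> card (g A \<inter> g B \<inter> g C)" using assms(3) by (auto simp: inter3_def)
  then show "s \<le> card (A \<inter> B \<inter> C)" using g by (simp add: Int_assoc)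
qed

lemma exists_shifted:
  assumes "finite W" "\<F> \<subseteq> nsets W k" "inter2 s \<F>"
  shows "\<exists>\<G>. \<G> \<subseteq> nsets W k \<and> inter2 s \<G> \<and> card \<G> = card \<F> \<and> shifted W \<G>"
  using assms(2,3)
proof (induction "weight \<F>" arbitrary: \<F> rule: less_induct)
  case less
  show ?case
  proof (cases "shifted W \<F>")
    case False
    then obtain i j where ij: "i \<in> W" "j \<in> W" "i < j" "\<not> stable i j \<F>"
      unfolding shifted_def by auto
    have fin: "finite \<F>" "\<And>A. A \<in> \<F> \<Longrightarrow> finite A"
      using less.prems finite_subset[OF less.prems(1) finite_nsets[OF assms(1)]] nsets_finite_mem by auto
    have "weight (shift i j \<F>) < weight \<F>" using weight_shift_less fin ij by blast
    moreover have "shift i j \<F> \<subseteq> nsets W k" using shift_subset_nsets less.prems ij by blast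
    moreover have "inter2 s (shift i j \<F>)" using inter2_shift fin ij less.prems by (metis less_irrefl)
    ultimately obtain \<G> where "\<G> \<subseteq> nsets W k" "inter2 s \<G>" "card \<G> = card (shift i j \<F>)" "shifted W \<G>"
      using less.hyps by blast
    then show ?thesis using card_shift by metis
  qed (use less.prems in blast)
qed

section \<open>Intersecting families of a shifted set system\<close>

definition initial :: "nat set \<Rightarrow> nat set \<Rightarrow> bool" where
  "initial C W \<longleftrightarrow> C \<subseteq> W \<and> (\<forall>c\<in>C. \<forall>w\<in>W. w < c \<longrightarrow> w \<in> C)"

text \<open>A set and its complement cannot both be members, so at most half of all
  \<open>k\<close>-sets are.\<close>

lemma card_intersecting_half:
  assumes W: "finite W" "card W = 2 * k" and F: "\<F> \<subseteq> nsets W k" and i: "inter2 1 \<F>" and k: "0 < k"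
  shows "card \<F> \<le> (2 * k - 1) choose (k - 1)"
proof -
  let ?c = "\<lambda>A. W - A"
  have fin: "finite \<F>" using F finite_nsets[OF W(1)] finite_subset by blast
  have sub: "A \<subseteq> W" if "A \<in> \<F>" for A using that F by (auto simp: nsets_def)
  have "inj_on ?c \<F>" using sub by (intro inj_onI) blast
  then have "card (?c ` \<F>) = card \<F>" by (rule card_image)
  moreover have "\<F> \<inter> ?c ` \<F> = {}"
  proof (rule ccontr)
    assume "\<F> \<inter> ?c ` \<F> \<noteq> {}"
    then obtain A where "A \<in> \<F>" "W - A \<in> \<F>" by auto
    then have "1 \<le> card (A \<inter> (W - A))" using i inter2D by blast
    then show False by simp
  qed
  moreover have "?c ` \<F> \<subseteq> nsets W k"
  proof (intro image_subsetI)
    fix A assume "A \<in> \<F>"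
    then have A: "A \<subseteq> W" "card A = k" using F by (auto simp: nsets_def)
    then have "card (W - A) = k" using W by (simp add: card_Diff_subset finite_subset)
    then show "W - A \<in> nsets W k" using W by (simp add: nsets_def)
  qed
  ultimately have "card \<F> + card \<F> \<le> card (nsets W k)"
    using F fin finite_nsets[OF W(1), of k]
    by (metis Un_least card_Un_disjoint card_mono finite_imageI)
  also have "\<dots> = (2 * k) choose k" using W by (simp add: card_nsets)
  also have "\<dots> = 2 * ((2 * k - 1) choose (k - 1))"
  proof -
    have "(2 * k) choose k = ((2 * k - 1) choose (k - 1)) + ((2 * k - 1) choose k)"
      using k by (simp add: choose_reduce_nat)
    moreover have "(2 * k - 1) choose k = (2 * k - 1) choose (k - 1)"
      using binomial_symmetric[of k "2 * k - 1"] k by (simp add: mult_2)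
    ultimately show ?thesis by simp
  qed
  finally show ?thesis by simp
qed

text \<open>The induction step for both bounds below. The delicate part is the intersection property
  of the links: two members meeting in at least \<open>v\<close> points cover at most
  \<open>2 * k - v\<close> points, so they leave out some \<open>x\<close> below \<open>p\<close>;
  replacing \<open>p\<close> by \<open>x\<close> in one of them exhibits \<open>v\<close> common
  points other than \<open>p\<close>.\<close>

lemma split_last:
  assumes W: "finite W" "p \<in> W" "\<forall>w\<in>W. w \<le> p" and F: "\<F> \<subseteq> nsets W k" and sh: "shifted W \<F>"
  defines "\<F>0 \<equiv> {A \<in> \<F>. p \<notin> A}" and "\<F>1 \<equiv> (\<lambda>A. A - {p}) ` {A \<in> \<F>. p \<in> A}"
  shows "card \<F> = card \<F>0 + card \<F>1"
    and "\<F>0 \<subseteq> nsets (W - {p}) k" and "\<F>1 \<subseteq> nsets (W - {p}) (k - 1)"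
    and "shifted (W - {p}) \<F>0" and "shifted (W - {p}) \<F>1"
    and "inter2 v \<F> \<Longrightarrow> inter2 v \<F>0"
    and "inter2 v \<F> \<Longrightarrow> 2 * k < card W + v \<Longrightarrow> inter2 v \<F>1"
proof -
  have fin: "finite \<F>" using F finite_nsets[OF W(1)] finite_subset by blast
  have mem: "A \<subseteq> W \<and> finite A \<and> card A = k" if "A \<in> \<F>" for A using that F by (auto simp: nsets_def)
  have inj: "inj_on (\<lambda>A. A - {p}) {A \<in> \<F>. p \<in> A}" by (intro inj_onI) blast
  have un: "\<F> = \<F>0 \<union> {A \<in> \<F>. p \<in> A}" "\<F>0 \<inter> {A \<in> \<F>. p \<in> A} = {}" by (auto simp: \<F>0_def)
  have "card \<F> = card \<F>0 + card {A \<in> \<F>. p \<in> A}"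
    using un fin by (metis card_Un_disjoint finite_Un)
  then show "card \<F> = card \<F>0 + card \<F>1" unfolding \<F>1_def by (simp add: card_image[OF inj])
  show "\<F>0 \<subseteq> nsets (W - {p}) k" using mem by (auto simp: \<F>0_def nsets_def)
  show "\<F>1 \<subseteq> nsets (W - {p}) (k - 1)" using mem by (auto simp: \<F>1_def nsets_def)
  show "shifted (W - {p}) \<F>0"
    unfolding shifted_def stable_def
  proof (intro ballI impI)
    fix i j A assume h: "i \<in> W - {p}" "j \<in> W - {p}" "i < j" "A \<in> \<F>0" "j \<in> A \<and> i \<notin> A"
    then have "swap_elem i j A \<in> \<F>" using shiftedD[OF sh] by (auto simp: \<F>0_def)
    then show "swap_elem i j A \<in> \<F>0" using h by (auto simp: \<F>0_def swap_elem_def)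
  qed
  show "shifted (W - {p}) \<F>1"
    unfolding shifted_def stable_def
  proof (intro ballI impI)
    fix i j A assume h: "i \<in> W - {p}" "j \<in> W - {p}" "i < j" "A \<in> \<F>1" "j \<in> A \<and> i \<notin> A"
    then obtain B where B: "B \<in> \<F>" "p \<in> B" "A = B - {p}" by (auto simp: \<F>1_def)
    then have "swap_elem i j B \<in> \<F>" using shiftedD[OF sh] h by auto
    moreover have "p \<in> swap_elem i j B" using B h by (auto simp: swap_elem_def)
    moreover have "swap_elem i j A = swap_elem i j B - {p}" using B h by (auto simp: swap_elem_def)
    ultimately show "swap_elem i j A \<in> \<F>1" by (auto simp: \<F>1_def)
  qed
  show "inter2 v \<F>0" if "inter2 v \<F>" using that by (auto simp: \<F>0_def inter2_def)
  show "inter2 v \<F>1" if i: "inter2 v \<F>" and n: "2 * k < card W + v"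
    unfolding inter2_def
  proof (intro ballI)
    fix A' B' assume "A' \<in> \<F>1" "B' \<in> \<F>1"
    then obtain A B where AB: "A \<in> \<F>" "p \<in> A" "A' = A - {p}" "B \<in> \<F>" "p \<in> B" "B' = B - {p}"
      by (auto simp: \<F>1_def)
    have AB2: "A' \<inter> B' = (A \<inter> B) - {p}" using AB by auto
    have "v \<le> card (A \<inter> B)" using i AB by (auto simp: inter2_def)
    moreover have "card A + card B = card (A \<union> B) + card (A \<inter> B)"
      using mem AB by (intro card_Un_Int) auto
    ultimately have "card (A \<union> B) < card W" using n mem[OF AB(1)] mem[OF AB(4)] by auto
    then have "A \<union> B \<noteq> W" by auto
    moreover have "A \<union> B \<subseteq> W" using mem[OF AB(1)] mem[OF AB(4)] by auto
    ultimately obtain x where x: "x \<in> W" "x \<notin> A" "x \<notin> B" by blast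
    then have "x < p" using W AB by (metis nat_less_le)
    then have "swap_elem x p A \<in> \<F>" using shiftedD[OF sh AB(1) x(1) W(2)] AB x by auto
    then have "v \<le> card (swap_elem x p A \<inter> B)" using i AB by (auto simp: inter2_def)
    also have "swap_elem x p A \<inter> B = A' \<inter> B'" using AB x by (auto simp: swap_elem_def)
    finally show "v \<le> card (A' \<inter> B')" .
  qed
qed

lemma obtain_last:
  assumes "finite (W :: nat set)" "W \<noteq> {}"
  obtains p where "p \<in> W" "\<forall>w\<in>W. w \<le> p"
  using assms Max_in Max_ge by blast

text \<open>The bound satisfies Pascal's recurrence, so removing the last point reduces the claim to
  the extreme case \<open>card W = 2 * k - v + 1\<close>.\<close>

lemma card_shifted_inter2_aux:
  assumes base: "\<And>W k \<F>. finite W \<Longrightarrow> card W + v = 2 * k + 1 \<Longrightarrow> v \<le> k \<Longrightarrow> \<F> \<subseteq> nsets W k \<Longrightarrow>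
      shifted W \<F> \<Longrightarrow> inter2 v \<F> \<Longrightarrow> card \<F> \<le> (card W - 1) choose (k - v)"
    and v: "0 < v"
  shows "finite W \<Longrightarrow> 2 * k + 1 \<le> card W + v \<Longrightarrow> v \<le> k \<Longrightarrow> \<F> \<subseteq> nsets W k \<Longrightarrow>
      shifted W \<F> \<Longrightarrow> inter2 v \<F> \<Longrightarrow> card \<F> \<le> (card W - 1) choose (k - v)"
proof (induction "card W" arbitrary: W k \<F>)
  case 0
  then show ?case using base[of W k \<F>] v by auto
next
  case (Suc n)
  show ?case
  proof (cases "card W + v = 2 * k + 1")
    case True
    then show ?thesis using base Suc.prems by blast
  next
    case False
    then have big: "2 * k + 2 \<le> card W + v" using Suc.prems by simp
    have "W \<noteq> {}" using Suc.hyps(2) by auto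
    then obtain p where p: "p \<in> W" "\<forall>w\<in>W. w \<le> p" using obtain_last Suc.prems(1) by blast
    define F0 where "F0 = {A \<in> \<F>. p \<notin> A}"
    define F1 where "F1 = (\<lambda>A. A - {p}) ` {A \<in> \<F>. p \<in> A}"
    note sp = split_last[OF Suc.prems(1) p Suc.prems(4,5), folded F0_def F1_def]
    have fW: "finite (W - {p})" and cW: "card (W - {p}) = n" "card W = Suc n"
      using Suc.prems p Suc.hyps(2) by auto
    have "card F0 \<le> (n - 1) choose (k - v)"
      using Suc.hyps(1)[of "W - {p}" k F0] fW cW sp(2,4) sp(6)[OF Suc.prems(6)] big Suc.prems by simp
    moreover have "card F1 + ((n - 1) choose (k - v)) \<le> n choose (k - v)"
    \<comment> \<open>Separate because the induction hypothesis for the links needs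
      \<open>v \<le> k - 1\<close>; for \<open>v = k\<close> there are no links, as a
      \<open>(k - 1)\<close>-set does not meet itself in \<open>v\<close> points.\<close>
    proof (cases "v = k")
      case True
      have "F1 = {}"
      proof (rule ccontr)
        assume "F1 \<noteq> {}"
        then obtain A where A: "A \<in> F1" by auto
        then have "v \<le> card (A \<inter> A)"
          using sp(7)[OF Suc.prems(6)] big inter2D by force
        moreover have "card A = k - 1" using A sp(3) by (auto simp: nsets_def)
        ultimately show False using True v by auto
      qed
      then show ?thesis using True by simp
    next
      case False
      then have vk: "v \<le> k - 1" "v < k" using Suc.prems by auto
      have "card F1 \<le> (n - 1) choose (k - 1 - v)"
        using Suc.hyps(1)[of "W - {p}" "k - 1" F1] fW cW sp(3,5) sp(7)[OF Suc.prems(6)] big vk by simp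
      moreover have "n choose (k - v) = ((n - 1) choose (k - 1 - v)) + ((n - 1) choose (k - v))"
        using vk big cW by (subst choose_reduce_nat) (auto simp: diff_commute)
      ultimately show ?thesis by simp
    qed
    ultimately show ?thesis using sp(1) cW by simp
  qed
qed

theorem Erdos_Ko_Rado:
  assumes W: "finite W" "2 * k \<le> card W" and F: "\<F> \<subseteq> nsets W k" and i: "inter2 1 \<F>" and k: "0 < k"
  shows "card \<F> \<le> (card W - 1) choose (k - 1)"
proof -
  obtain G where G: "G \<subseteq> nsets W k" "inter2 1 G" "card G = card \<F>" "shifted W G"
    using exists_shifted[OF W(1) F i] by blast
  have "card G \<le> (card W - 1) choose (k - 1)"
  proof (rule card_shifted_inter2_aux[of 1])
    fix W :: "nat set" and k \<F>
    assume "finite W" "card W + 1 = 2 * k + 1" "1 \<le> k" "\<F> \<subseteq> nsets W k" "inter2 1 \<F>"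
    then show "card \<F> \<le> (card W - 1) choose (k - 1)"
      using card_intersecting_half[of W k \<F>] by simp
  qed (use W G k in auto)
  then show ?thesis using G by simp
qed

text \<open>The base case is \<open>card W = 2 * k + 1 - v\<close>. Two members then cover at most
  \<open>card W - 1\<close> points, so the complements, of size \<open>k - v + 1\<close>, intersect
  pairwise and the case \<open>v = 1\<close> applies to them.\<close>

theorem card_inter2_le:
  assumes W: "finite W" "2 * k + 1 \<le> card W + v" and F: "\<F> \<subseteq> nsets W k" and i: "inter2 v \<F>"
    and v: "0 < v" "v \<le> k"
  shows "card \<F> \<le> (card W - 1) choose (k - v)"
proof -
  obtain G where G: "G \<subseteq> nsets W k" "inter2 v G" "card G = card \<F>" "shifted W G"
    using exists_shifted[OF W(1) F i] by blast
  have "card G \<le> (card W - 1) choose (k - v)"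
  proof (rule card_shifted_inter2_aux[of v])
    fix W :: "nat set" and k \<F>
    assume h: "finite W" "card W + v = 2 * k + 1" "v \<le> k" "\<F> \<subseteq> nsets W k" "inter2 v \<F>"
    let ?c = "\<lambda>A. W - A"
    have mem: "A \<subseteq> W \<and> finite A \<and> card A = k" if "A \<in> \<F>" for A using that h by (auto simp: nsets_def)
    have ck: "card W - k = k - v + 1" using h by auto
    have inj: "inj_on ?c \<F>" using mem by (intro inj_onI) blast
    have "?c ` \<F> \<subseteq> nsets W (k - v + 1)"
      using mem h(1) ck by (auto simp: nsets_def card_Diff_subset)
    moreover have "inter2 1 (?c ` \<F>)"
      unfolding inter2_def
    proof (intro ballI)
      fix A' B' assume "A' \<in> ?c ` \<F>" "B' \<in> ?c ` \<F>"
      then obtain A B where AB: "A \<in> \<F>" "A' = W - A" "B \<in> \<F>" "B' = W - B" by auto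
      have "v \<le> card (A \<inter> B)" using h AB by (auto simp: inter2_def)
      moreover have "card A + card B = card (A \<union> B) + card (A \<inter> B)"
        using mem AB by (intro card_Un_Int) auto
      ultimately have "card (A \<union> B) < card W" using h mem[OF AB(1)] mem[OF AB(3)] by auto
      then have "A \<union> B \<noteq> W" by auto
      moreover have "A \<union> B \<subseteq> W" using mem[OF AB(1)] mem[OF AB(3)] by auto
      ultimately have "A' \<inter> B' \<noteq> {}" using AB by blast
      then show "1 \<le> card (A' \<inter> B')" using h(1) AB by (simp add: Suc_le_eq card_gt_0_iff)
    qed
    ultimately have "card (?c ` \<F>) \<le> (card W - 1) choose (k - v + 1 - 1)"
      using h v by (intro Erdos_Ko_Rado) auto
    then show "card \<F> \<le> (card W - 1) choose (k - v)" by (simp add: card_image[OF inj])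
  qed (use W G v in auto)
  then show ?thesis using G by simp
qed

text \<open>The right-hand side satisfies Pascal's recurrence, and for \<open>card W = 2 * k\<close> the two
  terms depending on \<open>card C\<close> coincide, so that the claim becomes the Erdos-Ko-Rado bound.\<close>

lemma card_shifted_two_in_segment:
  assumes "finite W" "2 * k \<le> card W" "\<F> \<subseteq> nsets W k" "shifted W \<F>" "inter2 1 \<F>"
    and "initial C W" "card C = c" "\<And>A. A \<in> \<F> \<Longrightarrow> 2 \<le> card (A \<inter> C)"
  shows "card \<F> + ((card W - c) choose (k - 1)) \<le>
    ((card W - 1) choose (k - 1)) + (if c \<le> k + 1 then (card W - c) choose (k + 1 - c) else 0)"
  using assms
proof (induction "card W" arbitrary: W k \<F> C)
  case 0
  then have "\<F> = {}" using initial_def by (metis Int_empty_right card.empty card_0_eq ex_in_conv not_numeral_le_zero subset_empty)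
  then show ?case using 0 by (simp add: binomial_eq_0_iff)
next
  case (Suc n)
  have CW: "C \<subseteq> W" using Suc.prems by (auto simp: initial_def)
  then have fC: "finite C" using Suc.prems finite_subset by blast
  have cn: "c \<le> card W" using CW Suc.prems card_mono by blast
  consider "k \<le> 1" | "2 \<le> k" "c = card W" | "2 \<le> k" "card W = 2 * k" "c < card W"
    | "2 \<le> k" "2 * k < card W" "c < card W"
    using cn Suc.prems(2) by linarith
  then show ?case
  proof cases
    case 1
    have "\<F> = {}"
    proof (rule ccontr)
      assume "\<F> \<noteq> {}"
      then obtain A where A: "A \<in> \<F>" by auto
      then have "2 \<le> card (A \<inter> C)" "card A = k" "finite A" using Suc.prems by (auto simp: nsets_def)
      moreover have "card (A \<inter> C) \<le> card A" using \<open>finite A\<close> by (intro card_mono) auto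
      ultimately show False using 1 by simp
    qed
    then show ?thesis using 1 by simp
  next
    case 2
    have "card \<F> \<le> (card W - 1) choose (k - 1)"
      using Erdos_Ko_Rado Suc.prems 2 by simp
    moreover have "(card W - c) choose (k - 1) = 0" using 2 by (cases "k - 1") auto
    ultimately show ?thesis by linarith
  next
    case 3
    have F: "card \<F> \<le> (card W - 1) choose (k - 1)"
      using Suc.prems 3 by (intro Erdos_Ko_Rado) auto
    show ?thesis
    proof (cases "c \<le> k + 1")
      case True
      show ?thesis
      proof (cases "c = 0")
        case True
        then have "C = {}" using Suc.prems fC by simp
        then have "\<F> = {}" using Suc.prems(8) by (metis Int_empty_right card.empty ex_in_conv not_numeral_le_zero)
        moreover have "(2 * k) choose (k - 1) = (2 * k) choose (k + 1)"
          using binomial_symmetric[of "k - 1" "2 * k"] 3 by (simp add: mult_2)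
        ultimately show ?thesis using True 3 by simp
      next
        case c0: False
        have "(2 * k - c) choose (k - 1) = (2 * k - c) choose (k + 1 - c)"
        proof -
          have "k - 1 \<le> 2 * k - c" "2 * k - c - (k - 1) = k + 1 - c" using True 3 by auto
          then show ?thesis using binomial_symmetric[of "k - 1" "2 * k - c"] by simp
        qed
        then show ?thesis using F True 3 by simp
      qed
    next
      \<comment> \<open>Here both terms depending on \<open>c\<close> are zero. For the last one
        this is due to the conditional in the statement: with truncated subtraction it would be
        \<open>1\<close>.\<close>
      case False
      then have "card W - c < k - 1" using 3 by simp
      then have "(card W - c) choose (k - 1) = 0" by (rule binomial_eq_0)
      then show ?thesis using F by linarith
    qed
  next
    case 4
    have "W \<noteq> {}" using Suc.hyps(2) by auto
    then obtain p where p: "p \<in> W" "\<forall>w\<in>W. w \<le> p" using obtain_last Suc.prems(1) by blast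
    \<comment> \<open>An initial segment containing the last point is all of \<open>W\<close>. Since
      \<open>p\<close> is outside \<open>C\<close>, both parts of the split meet \<open>C\<close> as
      before, and the same \<open>C\<close> serves in both induction hypotheses.\<close>
    have pC: "p \<notin> C"
    proof
      assume "p \<in> C"
      then have "W \<subseteq> C" using p Suc.prems(6) unfolding initial_def by (metis nat_less_le subsetI)
      then show False using 4 CW Suc.prems(7) by auto
    qed
    define F0 where "F0 = {A \<in> \<F>. p \<notin> A}"
    define F1 where "F1 = (\<lambda>A. A - {p}) ` {A \<in> \<F>. p \<in> A}"
    note sp = split_last[OF Suc.prems(1) p Suc.prems(3,4), folded F0_def F1_def]
    have fW: "finite (W - {p})" and cW: "card (W - {p}) = n" "card W = Suc n"
      using Suc.prems p Suc.hyps(2) by auto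
    have iC: "initial C (W - {p})" using Suc.prems(6) pC by (auto simp: initial_def)
    have m0: "2 \<le> card (A \<inter> C)" if "A \<in> F0" for A using that Suc.prems(8) by (auto simp: F0_def)
    have m1: "2 \<le> card (A \<inter> C)" if AF: "A \<in> F1" for A
    proof -
      obtain B where "B \<in> \<F>" "A = B - {p}" using AF by (auto simp: F1_def)
      moreover then have "A \<inter> C = B \<inter> C" using pC by auto
      ultimately show ?thesis using Suc.prems(8) by simp
    qed
    have i1: "inter2 1 F1" using sp(7)[OF Suc.prems(5)] 4 by simp
    have "card F0 + ((card (W - {p}) - c) choose (k - 1)) \<le> ((card (W - {p}) - 1) choose (k - 1))
        + (if c \<le> k + 1 then (card (W - {p}) - c) choose (k + 1 - c) else 0)"
      by (rule Suc.hyps(1)[of _ _ _ C]) (use fW cW sp(2,4) sp(6)[OF Suc.prems(5)] iC m0 4 Suc.prems(7) in auto)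
    then have 0: "card F0 + ((n - c) choose (k - 1)) \<le>
      ((n - 1) choose (k - 1)) + (if c \<le> k + 1 then (n - c) choose (k + 1 - c) else 0)"
      unfolding cW .
    have k1: "k - 1 - 1 = k - 2" and k2: "k - 1 + 1 = k" using 4 by auto
    have "card F1 + ((card (W - {p}) - c) choose (k - 1 - 1)) \<le> ((card (W - {p}) - 1) choose (k - 1 - 1))
        + (if c \<le> k - 1 + 1 then (card (W - {p}) - c) choose (k - 1 + 1 - c) else 0)"
      by (rule Suc.hyps(1)[of _ _ _ C]) (use fW cW sp(3,5) i1 iC m1 4 Suc.prems(7) in auto)
    then have 1: "card F1 + ((n - c) choose (k - 2)) \<le>
      ((n - 1) choose (k - 2)) + (if c \<le> k then (n - c) choose (k - c) else 0)"
      unfolding cW k1 k2 .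
    have "n choose (k - 1) = ((n - 1) choose (k - 2)) + ((n - 1) choose (k - 1))"
      using 4 cW by (subst choose_reduce_nat) (auto simp: numeral_2_eq_2)
    moreover have "(Suc n - c) choose (k - 1) = ((n - c) choose (k - 2)) + ((n - c) choose (k - 1))"
      using 4 cW by (subst choose_reduce_nat) (auto simp: numeral_2_eq_2)
    moreover have "(Suc n - c) choose (k + 1 - c) = ((n - c) choose (k - c)) + ((n - c) choose (k + 1 - c))"
      if "c \<le> k"
      using 4 cW that by (subst choose_reduce_nat) auto
    ultimately show ?thesis using 0 1 cW sp(1) by (auto split: if_splits)
  qed
qed

section \<open>Binomial inequalities\<close>

text \<open>Factor by factor, \<open>(m - i) / (\<kappa> - i)\<close> is at least
  \<open>m / \<kappa>\<close>; denominators are cleared.\<close>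

lemma choose_ratio_ge:
  fixes \<kappa> m a :: nat
  assumes "\<kappa> \<le> m"
  shows "m ^ a * (\<kappa> choose a) \<le> \<kappa> ^ a * (m choose a)"
proof (induction a)
  case (Suc a)
  show ?case
  proof (cases "a < \<kappa>")
    case True
    have C: "(x choose Suc a) * Suc a = (x choose a) * (x - a)" for x :: nat
      using binomial_absorption[of a x] binomial_absorb_comp[of x a] by (simp add: mult.commute)
    have "m * (\<kappa> - a) \<le> \<kappa> * (m - a)"
      unfolding diff_mult_distrib2 using assms by (simp add: mult.commute diff_le_mono2)
    then have "(m ^ a * (\<kappa> choose a)) * (m * (\<kappa> - a)) \<le> (\<kappa> ^ a * (m choose a)) * (\<kappa> * (m - a))"
      using Suc.IH by (rule mult_le_mono[rotated])
    then have "(m ^ Suc a * (\<kappa> choose Suc a)) * Suc a \<le> (\<kappa> ^ Suc a * (m choose Suc a)) * Suc a"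
    proof -
      have "x ^ Suc a * (y choose Suc a) * Suc a = (x ^ a * (y choose a)) * (x * (y - a))" for x y :: nat
        by (simp only: mult.assoc C power_Suc) (simp only: ac_simps)
      then show ?thesis
        using \<open>(m ^ a * (\<kappa> choose a)) * (m * (\<kappa> - a)) \<le> (\<kappa> ^ a * (m choose a)) * (\<kappa> * (m - a))\<close>
        by presburger
    qed
    then show ?thesis by (simp only: mult_le_cancel2)
  qed (simp add: binomial_eq_0)
qed simp

text \<open>Raising \<open>a\<close> by one multiplies the left-hand side by
  \<open>1 + w / (m + a + 1)\<close>.\<close>

lemma choose_mult_le:
  fixes m w a \<kappa> :: nat
  assumes "0 < m" "w \<le> \<kappa>"
  shows "real ((m + w + a) choose w) \<le> real ((m + w) choose w) * (1 + \<kappa> / m) ^ a"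
proof (induction a)
  case (Suc a)
  have "((m + w + a) choose w) * (m + w + a + 1) = ((m + w + Suc a) choose w) * (m + a + 1)"
    using binomial_absorb_comp[of "m + w + Suc a" w] by (simp add: algebra_simps)
  then have "real ((m + w + Suc a) choose w) * (m + a + 1) = real ((m + w + a) choose w) * (m + w + a + 1)"
    by (metis of_nat_mult)
  then have "real ((m + w + Suc a) choose w) = real ((m + w + a) choose w) * ((m + w + a + 1) / (m + a + 1))"
    by (simp add: field_simps)
  also have "\<dots> \<le> real ((m + w + a) choose w) * (1 + \<kappa> / m)"
  proof (rule mult_left_mono)
    have "real w / (m + a + 1) \<le> \<kappa> / m" using assms by (intro frac_le) auto
    then show "real (m + w + a + 1) / real (m + a + 1) \<le> 1 + real \<kappa> / real m"
      by (simp add: field_simps)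
  qed simp
  also have "\<dots> \<le> real ((m + w) choose w) * (1 + \<kappa> / m) ^ a * (1 + \<kappa> / m)"
    using Suc by (intro mult_right_mono) auto
  finally show ?case by (simp add: algebra_simps)
qed simp

text \<open>Lowering the upper index from \<open>m + w + 1\<close> to \<open>m + w\<close> costs the
  factor \<open>(m + w + 1 - \<kappa>) / (m + w + 1)\<close>, which is at most
  \<open>m / (m + \<kappa>)\<close> as long as \<open>w + 1 \<le> \<kappa>\<close>.\<close>

lemma choose_decay:
  fixes m w \<kappa> :: nat
  assumes "0 < m" "w \<le> \<kappa>"
  shows "real (m choose \<kappa>) \<le> real ((m + w) choose \<kappa>) * (m / (m + \<kappa>)) ^ w"
  using assms(2)
proof (induction w)
  case (Suc w)
  have k0: "0 < \<kappa>" using Suc.prems by simp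
  have "((m + w) choose \<kappa>) * (m + w + 1) = ((m + Suc w) choose \<kappa>) * (m + Suc w - \<kappa>)"
    using binomial_absorb_comp[of "m + Suc w" \<kappa>] by (simp add: algebra_simps)
  then have eq: "real ((m + w) choose \<kappa>) * (m + w + 1) = real ((m + Suc w) choose \<kappa>) * real (m + Suc w - \<kappa>)"
    by (metis of_nat_mult)
  have "real (m + Suc w - \<kappa>) / (m + w + 1) \<le> m / (m + \<kappa>)"
  proof (cases "\<kappa> \<le> m + Suc w")
    case True
    have "real \<kappa> * (m + Suc w) \<le> real \<kappa> * (m + \<kappa>)"
      using Suc.prems by (intro mult_left_mono) auto
    then show ?thesis using True assms(1) by (simp add: of_nat_diff field_simps)
  qed simp
  then have "real ((m + w) choose \<kappa>) \<le> real ((m + Suc w) choose \<kappa>) * (m / (m + \<kappa>))"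
  proof -
    have "real ((m + w) choose \<kappa>) = real ((m + Suc w) choose \<kappa>) * (real (m + Suc w - \<kappa>) / (m + w + 1))"
      using eq by (simp add: field_simps)
    then show ?thesis using \<open>real (m + Suc w - \<kappa>) / (m + w + 1) \<le> m / (m + \<kappa>)\<close>
      by (metis mult_left_mono of_nat_0_le_iff)
  qed
  then have "real ((m + w) choose \<kappa>) * (m / (m + \<kappa>)) ^ w \<le>
      real ((m + Suc w) choose \<kappa>) * (m / (m + \<kappa>)) * (m / (m + \<kappa>)) ^ w"
    by (intro mult_right_mono) auto
  then show ?case using Suc by (simp add: algebra_simps)
qed simp

text \<open>With \<open>x = \<mu> / (1 + \<mu>)\<close> the left-hand side is \<open>\<mu> ^ a * (1 - x ^ w)\<close>, since
  \<open>\<mu> * (1 - x) = x\<close>.\<close>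

lemma gap_from_extreme:
  fixes d a w :: nat and \<mu> :: real
  assumes d: "2 \<le> d" and \<mu>: "d \<le> \<mu>" and a: "2 \<le> a" "a0 \<le> a" "0 < a0" and w: "w0 \<le> w"
    and base: "1 + (real d - 1) * (1 + 1 / d) ^ a0 \<le> real d ^ (a0 - 1) * (\<Sum>i=1..w0. (d / (d + 1)) ^ i)"
  shows "1 + (real d - 1) * (1 + 1 / \<mu>) ^ a \<le> \<mu> ^ a * (1 - (\<mu> / (1 + \<mu>)) ^ w)"
proof -
  have m0: "0 < \<mu>" "0 < real d" using d \<mu> by auto
  \<comment> \<open>Raising the exponent by one multiplies the left-hand side by at most
    \<open>1 + 1 / d\<close> and the right-hand side by \<open>d\<close>.\<close>
  have "1 + (real d - 1) * (1 + 1 / d) ^ a \<le> real d ^ (a - 1) * (\<Sum>i=1..w0. (d / (d + 1)) ^ i)"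
    using \<open>a0 \<le> a\<close>
  proof (induction a rule: dec_induct)
    case (step k)
    have "1 + (real d - 1) * (1 + 1 / d) ^ Suc k \<le> (1 + 1 / d) * (1 + (real d - 1) * (1 + 1 / d) ^ k)"
    proof -
      define q where "q = 1 + 1 / real d"
      have "1 \<le> q" by (simp add: q_def)
      then have "1 + (real d - 1) * q ^ Suc k \<le> q * (1 + (real d - 1) * q ^ k)"
        by (simp add: algebra_simps)
      then show ?thesis by (simp only: q_def)
    qed
    also have "\<dots> \<le> real d * (1 + (real d - 1) * (1 + 1 / d) ^ k)"
    proof (rule mult_right_mono)
      have "1 / real d \<le> 1" using d by simp
      then show "1 + 1 / real d \<le> real d" using d by linarith
    qed (use d in simp)
    also have "\<dots> \<le> real d * (real d ^ (k - 1) * (\<Sum>i=1..w0. (d / (d + 1)) ^ i))"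
      using step by (intro mult_left_mono) auto
    also have "\<dots> = real d ^ (Suc k - 1) * (\<Sum>i=1..w0. (d / (d + 1)) ^ i)"
      using step a by (cases k) auto
    finally show ?case .
  qed (use base in simp)
  moreover have "(1 + 1 / \<mu>) ^ a \<le> (1 + 1 / d) ^ a"
    using m0 \<mu> by (intro power_mono add_left_mono divide_left_mono) auto
  then have "1 + (real d - 1) * (1 + 1 / \<mu>) ^ a \<le> 1 + (real d - 1) * (1 + 1 / d) ^ a"
    using d by (intro add_left_mono mult_left_mono) auto
  moreover have "real d ^ (a - 1) * (\<Sum>i=1..w0. (d / (d + 1)) ^ i) \<le> \<mu> ^ (a - 1) * (\<Sum>i=1..w. (\<mu> / (1 + \<mu>)) ^ i)"
  proof (rule mult_mono)
    have "real d / (d + 1) \<le> \<mu> / (1 + \<mu>)" using m0 \<mu> by (simp add: field_simps)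
    then have "(\<Sum>i=1..w0. (d / (d + 1)) ^ i) \<le> (\<Sum>i=1..w0. (\<mu> / (1 + \<mu>)) ^ i)"
      by (intro sum_mono power_mono) auto
    also have "\<dots> \<le> (\<Sum>i=1..w. (\<mu> / (1 + \<mu>)) ^ i)"
      using w m0 by (intro sum_mono2) auto
    finally show "(\<Sum>i=1..w0. (d / (d + 1)) ^ i) \<le> (\<Sum>i=1..w. (\<mu> / (1 + \<mu>)) ^ i)" .
  qed (use m0 \<mu> in \<open>auto intro!: power_mono sum_nonneg\<close>)
  moreover have "\<mu> ^ (a - 1) * (\<Sum>i=1..w. (\<mu> / (1 + \<mu>)) ^ i) = \<mu> ^ a * (1 - (\<mu> / (1 + \<mu>)) ^ w)"
  proof -
    have x: "\<mu> * (1 - \<mu> / (1 + \<mu>)) = \<mu> / (1 + \<mu>)" using m0 by (simp add: field_simps)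
    have "(\<Sum>i=1..w. (\<mu> / (1 + \<mu>)) ^ i) = \<mu> * (1 - (\<mu> / (1 + \<mu>)) ^ w)"
    proof (induction w)
      case (Suc w)
      have "(\<Sum>i=1..Suc w. (\<mu> / (1 + \<mu>)) ^ i) = \<mu> * (1 - (\<mu> / (1 + \<mu>)) ^ w) + (\<mu> / (1 + \<mu>)) ^ w * (\<mu> / (1 + \<mu>))"
        using Suc by (simp add: mult.commute)
      also have "\<dots> = \<mu> * (1 - (\<mu> / (1 + \<mu>)) ^ w) + (\<mu> / (1 + \<mu>)) ^ w * (\<mu> * (1 - \<mu> / (1 + \<mu>)))"
        by (simp only: x)
      also have "\<dots> = \<mu> * (1 - (\<mu> / (1 + \<mu>)) ^ Suc w)" by (simp add: algebra_simps)
      finally show ?case .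
    qed simp
    moreover have "\<mu> ^ a = \<mu> ^ (a - 1) * \<mu>" using a by (cases a) auto
    ultimately show ?thesis by (simp only: mult.assoc)
  qed
  ultimately show ?thesis by linarith
qed

text \<open>In the application \<open>m = n - d - \<kappa> - 1\<close> and \<open>w = \<kappa> + 1 - j\<close>, where \<open>j\<close> is the least size of
  the intersection of two members outside \<open>D\<close>.\<close>

definition gap :: "nat \<Rightarrow> nat \<Rightarrow> nat \<Rightarrow> nat \<Rightarrow> bool" where
  "gap d m w \<kappa> \<longleftrightarrow>
    (m choose \<kappa>) + ((m + w) choose w) + (d - 1) * ((m + \<kappa>) choose w) < ((m + w) choose \<kappa>) + d"

text \<open>All terms are measured in units of \<open>Q\<close>. With
  \<open>\<mu> = m / \<kappa>\<close> and \<open>a = \<kappa> - w\<close>, the term on the right of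
  \<open>gap\<close> is at least \<open>Q * \<mu> ^ a\<close>, each of the \<open>d - 1\<close>
  equal terms is at most \<open>Q * (1 + 1 / \<mu>) ^ a\<close>, and
  \<open>m choose \<kappa>\<close> is at most the right-hand term times
  \<open>(\<mu> / (1 + \<mu>)) ^ w\<close>. Strictness is free, since the right-hand side of
  \<open>gap\<close> has the extra summand \<open>d\<close>.\<close>

lemma gap_of_real:
  assumes d: "2 \<le> d" and m: "d * \<kappa> \<le> m" and w: "w + 2 \<le> \<kappa>"
    and real: "1 + (real d - 1) * (1 + 1 / (m / \<kappa>)) ^ (\<kappa> - w) \<le>
      (m / \<kappa>) ^ (\<kappa> - w) * (1 - ((m / \<kappa>) / (1 + m / \<kappa>)) ^ w)"
  shows "gap d m w \<kappa>"
proof -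
  define a where "a = \<kappa> - w"
  define Q where "Q = real ((m + w) choose w)"
  have k0: "0 < \<kappa>" "a \<le> \<kappa>" "\<kappa> - a = w" using w by (auto simp: a_def)
  have m0: "0 < m" using m d k0 by (cases m) auto
  have km: "\<kappa> \<le> m" using m mult_le_mono1[of 1 d \<kappa>] d by linarith
  have "((m + w) choose \<kappa>) * (\<kappa> choose w) = ((m + w) choose w) * (m choose a)"
    using choose_mult[of w \<kappa> "m + w"] w km by (simp add: a_def)
  then have P: "real ((m + w) choose \<kappa>) * real (\<kappa> choose a) = Q * real (m choose a)"
    unfolding Q_def using binomial_symmetric[of w \<kappa>] w by (metis a_def add_leD1 of_nat_mult)
  have ca: "0 < real (\<kappa> choose a)" using k0 by simp
  have "real m ^ a * real (\<kappa> choose a) \<le> real \<kappa> ^ a * real (m choose a)"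
    using choose_ratio_ge[OF km, of a] by (metis of_nat_le_iff of_nat_mult of_nat_power)
  then have "(m / \<kappa>) ^ a * real (\<kappa> choose a) \<le> real (m choose a)"
    using k0 by (simp add: power_divide field_simps)
  then have "Q * (m / \<kappa>) ^ a * real (\<kappa> choose a) \<le> real ((m + w) choose \<kappa>) * real (\<kappa> choose a)"
    unfolding P mult.assoc by (intro mult_left_mono) (auto simp: Q_def)
  then have 1: "Q * (m / \<kappa>) ^ a \<le> real ((m + w) choose \<kappa>)" using ca by simp
  have mk: "m + w + a = m + \<kappa>" using w by (simp add: a_def)
  have "real ((m + \<kappa>) choose w) \<le> Q * (1 + \<kappa> / m) ^ a"
    using choose_mult_le[OF m0, of w \<kappa> a] w unfolding mk Q_def by simp
  then have 2: "real ((m + \<kappa>) choose w) \<le> Q * (1 + 1 / (m / \<kappa>)) ^ a" by simp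
  define y where "y = ((m / \<kappa>) / (1 + m / \<kappa>)) ^ w"
  have eq: "(m / \<kappa>) / (1 + m / \<kappa>) = m / (m + \<kappa>)" using k0 by (simp add: field_simps)
  have 3: "real (m choose \<kappa>) \<le> real ((m + w) choose \<kappa>) * y"
    using choose_decay[OF m0, of w \<kappa>] w unfolding y_def eq by simp
  have "y \<le> 1" unfolding y_def eq by (intro power_le_one) (use m0 in auto)
  have "real (m choose \<kappa>) + Q + (real d - 1) * real ((m + \<kappa>) choose w) \<le>
      real (m choose \<kappa>) + Q * (1 + (real d - 1) * (1 + 1 / (m / \<kappa>)) ^ a)"
    using mult_left_mono[OF 2, of "real d - 1"] d by (simp add: algebra_simps)
  also have "\<dots> \<le> real (m choose \<kappa>) + Q * ((m / \<kappa>) ^ a * (1 - y))"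
    using real unfolding a_def[symmetric] y_def[symmetric]
    by (intro add_left_mono mult_left_mono) (auto simp: Q_def)
  also have "\<dots> = real (m choose \<kappa>) + Q * (m / \<kappa>) ^ a * (1 - y)" by simp
  also have "\<dots> \<le> real (m choose \<kappa>) + real ((m + w) choose \<kappa>) * (1 - y)"
    using 1 \<open>y \<le> 1\<close> by (intro add_left_mono mult_right_mono) auto
  also have "\<dots> \<le> real ((m + w) choose \<kappa>)" using 3 by (simp add: algebra_simps)
  finally have "real ((m choose \<kappa>) + ((m + w) choose w) + (d - 1) * ((m + \<kappa>) choose w)) \<le> real ((m + w) choose \<kappa>)"
    using d by (simp add: Q_def of_nat_diff)
  then have "(m choose \<kappa>) + ((m + w) choose w) + (d - 1) * ((m + \<kappa>) choose w) \<le> ((m + w) choose \<kappa>)"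
    by (simp only: of_nat_le_iff)
  then show ?thesis using d unfolding gap_def by linarith
qed

text \<open>After Pascal's rule the left-hand side is linear in \<open>m\<close>, while
  \<open>m choose (\<kappa> - 1)\<close> is at least the quadratic
  \<open>m choose 2\<close>.\<close>

lemma gap_w1:
  assumes d: "2 \<le> d" and m: "d * \<kappa> + 1 \<le> m" and k: "3 \<le> \<kappa>"
  shows "gap d m 1 \<kappa>"
proof -
  have m3: "2 * d + 3 \<le> m" "d * \<kappa> + 1 \<le> m"
  proof -
    have "d * 3 \<le> d * \<kappa>" using k by simp
    then show "2 * d + 3 \<le> m" using m d by linarith
  qed fact
  have k2m: "2 * \<kappa> + 1 \<le> m"
    using m mult_le_mono1[OF d, of \<kappa>] by linarith
  have "m choose 2 \<le> m choose (\<kappa> - 1)"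
    by (rule binomial_mono) (use k k2m in auto)
  moreover have "2 * (m choose 2) = m * (m - 1)"
  proof -
    have "even (m * (m - 1))" by (cases m) auto
    then show ?thesis by (simp only: choose_two dvd_mult_div_cancel)
  qed
  moreover have "m * (2 * d + 2) \<le> m * (m - 1)" using m3 by (intro mult_le_mono) auto
  moreover have "(d - 1) * (\<kappa> - 1) < m"
  proof -
    have "(d - 1) * (\<kappa> - 1) \<le> d * \<kappa>" by (intro mult_le_mono) auto
    then show ?thesis using m by linarith
  qed
  ultimately have b: "m * d + (d - 1) * (\<kappa> - 1) < m choose (\<kappa> - 1)" by (simp add: algebra_simps)
  have "(m + 1) + (d - 1) * (m + \<kappa>) = m * d + (d - 1) * (\<kappa> - 1) + d"
  proof -
    obtain e where "d = Suc e" using d by (cases d) auto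
    moreover obtain q where "\<kappa> = Suc q" using k by (cases \<kappa>) auto
    ultimately show ?thesis by (simp add: algebra_simps)
  qed
  moreover have "(m + 1) choose \<kappa> = (m choose (\<kappa> - 1)) + (m choose \<kappa>)"
    using k by (subst choose_reduce_nat) auto
  ultimately show ?thesis using b unfolding gap_def by (simp add: algebra_simps)
qed

text \<open>Pascal's rule adds the two given inequalities, but the summand \<open>d\<close> would
  then occur twice on the right. The surplus \<open>m choose (\<kappa> - 2)\<close>, which is at
  least \<open>m\<close> and so at least \<open>d\<close>, absorbs one of them.\<close>

lemma gap_Suc:
  assumes d: "2 \<le> d" "d \<le> m" and m: "\<kappa> \<le> m" and k: "3 \<le> \<kappa>" and w: "1 \<le> w"
    and g: "gap d m w \<kappa>" "gap d (Suc m) (w - 1) (\<kappa> - 1)"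
  shows "gap d (Suc m) w \<kappa>"
proof -
  have r: "Suc x choose y = (x choose (y - 1)) + (x choose y)" if "1 \<le> y" for x y :: nat
    using that by (cases y) auto
  have "d \<le> m choose (\<kappa> - 2)"
  proof -
    have "m \<le> m choose (\<kappa> - 2)"
      using k m by (intro upper_le_binomial) auto
    then show ?thesis using d by simp
  qed
  moreover have "(Suc m choose (\<kappa> - 1)) = (m choose (\<kappa> - 2)) + (m choose (\<kappa> - 1))"
    using r[of "\<kappa> - 1" m] k by (simp add: numeral_2_eq_2)
  moreover have "Suc m + (w - 1) = m + w" "Suc m + (\<kappa> - 1) = m + \<kappa>" using w k by auto
  ultimately have "(m choose (\<kappa> - 1)) + ((m + w) choose (w - 1)) + (d - 1) * ((m + \<kappa>) choose (w - 1))
      \<le> ((m + w) choose (\<kappa> - 1))"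
    using g(2) unfolding gap_def by simp
  then show ?thesis using g(1) w k unfolding gap_def by (simp add: r distrib_left)
qed

lemma gap_induct:
  assumes d: "2 \<le> d" and k: "3 \<le> \<kappa>" and w: "1 \<le> w" and m0: "d \<le> m0" "\<kappa> \<le> m0"
    and base: "gap d m0 w \<kappa>" and step: "\<And>m. m0 < m \<Longrightarrow> gap d m (w - 1) (\<kappa> - 1)"
    and m: "m0 \<le> m"
  shows "gap d m w \<kappa>"
  using m
proof (induction m rule: dec_induct)
  case (step m)
  then show ?case using gap_Suc[of d m \<kappa> w] assms by simp
qed (rule base)

text \<open>The real criterion is monotone, so it is tested only at the extreme pairs
  \<open>(a0, w0)\<close>. At \<open>\<mu> = d\<close> it fails when \<open>a = 2\<close> and
  \<open>(d, w)\<close> is one of \<open>(3, 2)\<close>, \<open>(2, 2)\<close>,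
  \<open>(2, 3)\<close>, \<open>(2, 4)\<close>; these four cases are done by induction on
  \<open>m\<close> with Pascal's rule.\<close>

lemma gap_intermediate:
  assumes d: "2 \<le> d" and m: "d * \<kappa> + 1 \<le> m" and w: "1 \<le> w" "w + 2 \<le> \<kappa>"
  shows "gap d m w \<kappa>"
proof -
  define a where "a = \<kappa> - w"
  have a: "2 \<le> a" "\<kappa> = w + a" using w by (auto simp: a_def)
  have \<mu>: "real d \<le> m / \<kappa>"
  proof -
    have "real (d * \<kappa>) \<le> real m" using m by (subst of_nat_le_iff) simp
    then show ?thesis using w by (simp add: pos_le_divide_eq)
  qed
  have main: "gap d m w \<kappa>"
    if "1 + (real d - 1) * (1 + 1 / d) ^ a0 \<le> real d ^ (a0 - 1) * (\<Sum>i=1..w0. (d / (d + 1)) ^ i)"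
      "0 < a0" "a0 \<le> a" "w0 \<le> w" for a0 w0
    using gap_from_extreme[OF d \<mu> a(1) that(3,2,4,1)] m w(2)
    by (intro gap_of_real[OF d]) (auto simp: a_def)
  have gap2: "9 \<le> m \<Longrightarrow> gap 2 m 2 4" "11 \<le> m \<Longrightarrow> gap 2 m 3 5" "13 \<le> m \<Longrightarrow> gap 2 m 4 6" for m
  proof -
    \<comment> \<open>The values \<open>9\<close>, \<open>11\<close>, \<open>13\<close> of
      \<open>m\<close> are \<open>2 * \<kappa> + 1\<close>, the least ones required. Each of the
      three inequalities provides the instance for \<open>w - 1\<close> and
      \<open>\<kappa> - 1\<close> that the induction for the next one consumes.\<close>
    have base: "gap 2 9 2 4" "gap 2 11 3 5" "gap 2 13 4 6"
      unfolding gap_def by (simp_all add: binomial_fact' fact_numeral)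
    have 2: "gap 2 m 2 4" if "9 \<le> m" for m
      using gap_induct[of 2 4 2 9 m] gap_w1[of 2 3] base that by simp
    have 3: "gap 2 m 3 5" if "11 \<le> m" for m
      using gap_induct[of 2 5 3 11 m] 2 base that by simp
    have 4: "gap 2 m 4 6" if "13 \<le> m" for m
      using gap_induct[of 2 6 4 13 m] 3 base that by simp
    show "9 \<le> m \<Longrightarrow> gap 2 m 2 4" "11 \<le> m \<Longrightarrow> gap 2 m 3 5" "13 \<le> m \<Longrightarrow> gap 2 m 4 6"
      using 2 3 4 by auto
  qed
  consider "w = 1" | "4 \<le> d" "2 \<le> w" | "d = 3" "2 \<le> w" "3 \<le> a" | "d = 3" "3 \<le> w"
    | "d = 2" "2 \<le> w" "3 \<le> a" | "d = 2" "5 \<le> w" | "d = 3" "w = 2" "\<kappa> = 4"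
    | "d = 2" "w = 2" "\<kappa> = 4" | "d = 2" "w = 3" "\<kappa> = 5" | "d = 2" "w = 4" "\<kappa> = 6"
  proof -
    have "d = 2 \<or> d = 3 \<or> 4 \<le> d" "a = 2 \<or> 3 \<le> a" "w = 1 \<or> w = 2 \<or> w = 3 \<or> w = 4 \<or> 5 \<le> w"
      using a d w by linarith+
    then show ?thesis using that a(2) by (elim disjE) simp_all
  qed
  then show ?thesis
  proof cases
    case 1
    then show ?thesis using gap_w1[OF d m] w by simp
  next
    case 2
    show ?thesis
    proof (rule main[of 2 2])
      define x where "x = real d"
      have x: "4 \<le> x" using 2 by (simp add: x_def)
      have "0 \<le> (x ^ 2 * (2 * x + 1)) * x ^ 2 - x\<^sup>2 * (x + 1)\<^sup>2 - (x - 1) * (x + 1) ^ 4"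
      proof -
        \<comment> \<open>Expanded around \<open>x = 4\<close> all coefficients are nonnegative. At
          \<open>x = 3\<close> the polynomial is negative, which is why \<open>d = 3\<close> is
          treated apart.\<close>
        define y where "y = x - 4"
        have "(x ^ 2 * (2 * x + 1)) * x ^ 2 - x\<^sup>2 * (x + 1)\<^sup>2 - (x - 1) * (x + 1) ^ 4
          = y ^ 5 + 17 * y ^ 4 + 108 * y ^ 3 + 305 * y\<^sup>2 + 331 * y + 29"
        proof -
          have "x = y + 4" by (simp add: y_def)
          then show ?thesis by (simp only:) (simp add: algebra_simps eval_nat_numeral)
        qed
        moreover have "0 \<le> y" using x by (simp add: y_def)
        ultimately show ?thesis by simp
      qed
      then have "x\<^sup>2 * (x + 1)\<^sup>2 + (x - 1) * (x + 1) ^ 4 \<le> (x ^ 2 * (2 * x + 1)) * x ^ 2" by simp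
      then have "1 + (x - 1) * (1 + 1 / x) ^ 2 \<le> x * (x / (x + 1) + (x / (x + 1)) ^ 2)"
      proof -
        define D where "D = x ^ 2 * (x + 1) ^ 2"
        have D: "0 < D" using x by (simp add: D_def)
        have "(1 + (x - 1) * (1 + 1 / x) ^ 2) * D = x\<^sup>2 * (x + 1)\<^sup>2 + (x - 1) * (x + 1) ^ 4"
        proof -
          have "(1 + 1 / x) ^ 2 * x ^ 2 = (x + 1) ^ 2"
            using x by (simp add: power_mult_distrib[symmetric] distrib_right)
          then have "(x - 1) * (1 + 1 / x) ^ 2 * D = (x - 1) * ((x + 1) ^ 2 * (x + 1) ^ 2)"
            unfolding D_def by (metis (no_types) mult.assoc)
          moreover have "(x + 1) ^ 2 * (x + 1) ^ 2 = (x + 1) ^ 4" by (simp flip: power_add)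
          ultimately show ?thesis by (simp only: distrib_right mult_1 D_def)
        qed
        moreover have "x * (x / (x + 1) + (x / (x + 1)) ^ 2) * D = (x ^ 2 * (2 * x + 1)) * x ^ 2"
        proof -
          have "x / (x + 1) * (x + 1) ^ 2 = x * (x + 1)" using x by (simp add: power2_eq_square)
          moreover have "(x / (x + 1)) ^ 2 * (x + 1) ^ 2 = x ^ 2" using x by (simp add: power_divide)
          ultimately have "(x / (x + 1) + (x / (x + 1)) ^ 2) * (x + 1) ^ 2 = x * (x + 1) + x ^ 2"
            by (simp only: distrib_right)
          then have "x * (x / (x + 1) + (x / (x + 1)) ^ 2) * D = x * x ^ 2 * (x * (x + 1) + x ^ 2)"
            unfolding D_def by (metis (no_types) mult.assoc mult.commute)
          then show ?thesis by (simp add: algebra_simps power2_eq_square)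
        qed
        ultimately have "(1 + (x - 1) * (1 + 1 / x) ^ 2) * D \<le> x * (x / (x + 1) + (x / (x + 1)) ^ 2) * D"
          using \<open>x\<^sup>2 * (x + 1)\<^sup>2 + (x - 1) * (x + 1) ^ 4 \<le> (x ^ 2 * (2 * x + 1)) * x ^ 2\<close> by (simp only:)
        then show ?thesis using D by (simp only: mult_le_cancel_right_pos)
      qed
      then show "1 + (real d - 1) * (1 + 1 / d) ^ 2 \<le> real d ^ (2 - 1) * (\<Sum>i=1..2. (d / (d + 1)) ^ i)"
        by (simp add: x_def numeral_2_eq_2 add.commute)
    qed (use 2 a in auto)
  next
    case 3
    show ?thesis by (rule main[of 3 2]) (use 3 in \<open>auto simp: eval_nat_numeral\<close>)
  next
    case 4
    show ?thesis by (rule main[of 2 3]) (use 4 a in \<open>auto simp: eval_nat_numeral\<close>)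
  next
    case 5
    show ?thesis by (rule main[of 3 2]) (use 5 in \<open>auto simp: eval_nat_numeral\<close>)
  next
    case 6
    show ?thesis by (rule main[of 2 5]) (use 6 a in \<open>auto simp: eval_nat_numeral\<close>)
  next
    case 7
    have "gap 3 13 2 4" unfolding gap_def by (simp add: binomial_fact' fact_numeral)
    then have "gap 3 m 2 4" if "13 \<le> m" for m
      using gap_induct[of 3 4 2 13 m] gap_w1[of 3 3] that by simp
    then show ?thesis using 7 m by simp
  qed (use m gap2 in simp_all)
qed

section \<open>Comparisons with the sizes of the extremal families\<close>

lemma choose_add_le: "(m + w) choose Suc \<kappa> \<le> (m choose Suc \<kappa>) + w * ((m + w - 1) choose \<kappa>)"
proof (induction w)
  case (Suc w)
  have "(m + w - 1) choose \<kappa> \<le> (m + w) choose \<kappa>" by (rule binomial_right_mono) simp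
  then have "w * ((m + w - 1) choose \<kappa>) \<le> w * ((m + w) choose \<kappa>)" by (rule mult_le_mono2)
  then show ?case using Suc.IH
    by (simp only: add_Suc_right binomial_Suc_Suc mult_Suc diff_Suc_1)
qed simp

text \<open>This says that \<open>\<H>\<close> is strictly smaller than \<open>\<A>\<close>, for
  \<open>N = n - d\<close>. The passage from \<open>N - \<kappa> - 1\<close> to \<open>N - 2\<close>
  takes \<open>\<kappa> - 1 \<le> d\<close> Pascal steps, each adding at most
  \<open>(N - 3) choose (\<kappa> - 1)\<close>. Replacing \<open>N - 3\<close> by
  \<open>N - 2\<close> in the last term gains \<open>d * ((N - 3) choose (\<kappa> - 2))\<close>,
  which covers the summand \<open>d\<close>.\<close>

lemma choose_small_uniformity:
  assumes d: "2 \<le> d" and \<kappa>: "2 \<le> \<kappa>" "\<kappa> \<le> d + 1" and N: "(d + 1) * \<kappa> + 2 \<le> N"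
  shows "((N - 2) choose \<kappa>) + d < ((N - \<kappa> - 1) choose \<kappa>) + d * ((N - 2) choose (\<kappa> - 1))"
proof -
  have N2: "2 * \<kappa> + 2 \<le> N" using N mult_le_mono1[of 2 "d + 1" \<kappa>] d by linarith
  have e: "N - 2 = N - \<kappa> - 1 + (\<kappa> - 1)" "N - 2 = Suc (N - 3)" "Suc (\<kappa> - 1) = \<kappa>" "N - 2 - 1 = N - 3"
    using \<kappa> N2 by auto
  have 1: "(N - 2) choose \<kappa> \<le> ((N - \<kappa> - 1) choose \<kappa>) + (\<kappa> - 1) * ((N - 3) choose (\<kappa> - 1))"
    using choose_add_le[of "N - \<kappa> - 1" "\<kappa> - 1" "\<kappa> - 1"] unfolding e(1)[symmetric] e(3,4) .
  have 2: "(N - 2) choose (\<kappa> - 1) = ((N - 3) choose (\<kappa> - 2)) + ((N - 3) choose (\<kappa> - 1))"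
    using \<kappa> N2 by (subst choose_reduce_nat) (auto simp: numeral_2_eq_2 numeral_3_eq_3)
  have big: "N - 3 \<le> (N - 3) choose (\<kappa> - 1)"
    by (rule upper_le_binomial) (use \<kappa> N2 in auto)
  show ?thesis
  \<comment> \<open>For \<open>\<kappa> = 2\<close> the gain is only \<open>d * 1\<close>, not
    strictly more than \<open>d\<close>; but then \<open>\<kappa> - 1 = 1\<close> is smaller than
    \<open>d\<close>.\<close>
  proof (cases "\<kappa> = 2")
    case True
    have "(N - 2) choose 2 \<le> ((N - 3) choose 2) + (N - 3)" using 1 True by simp
    moreover have "d * (N - 2) = d * (N - 3) + d" using N2 e(2) by simp
    moreover have "2 * (N - 3) \<le> d * (N - 3)" using d by (intro mult_le_mono1)
    moreover have "0 < N - 3" using N2 True by simp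
    moreover have e3: "(N - 2) choose (2 - 1) = N - 2" "N - 2 - 1 = N - 3" by simp_all
    ultimately show ?thesis unfolding True e3 by linarith
  next
    case False
    have "N - 3 \<le> (N - 3) choose (\<kappa> - 2)"
      by (rule upper_le_binomial) (use \<kappa> N2 False in auto)
    then have "1 < (N - 3) choose (\<kappa> - 2)" using N2 \<kappa> by linarith
    then have "d < d * ((N - 3) choose (\<kappa> - 2))" using d by simp
    moreover have "(\<kappa> - 1) * ((N - 3) choose (\<kappa> - 1)) \<le> d * ((N - 3) choose (\<kappa> - 1))"
      using \<kappa> by (intro mult_le_mono1) simp
    ultimately show ?thesis using 1 unfolding 2 distrib_left by linarith
  qed
qed

text \<open>From \<open>(1 + 1 / d) ^ d \<le> exp 1 \<le> 3\<close>. For \<open>d = 2\<close> this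
  would only give \<open>4.5\<close>, hence the direct evaluation.\<close>

lemma Suc_power_less:
  assumes "2 \<le> d"
  shows "(1 + 1 / real d) ^ (d + 1) < d + 2"
proof (cases "d = 2")
  case False
  then have d: "3 \<le> d" using assms by simp
  have "(1 + 1 / real d) ^ d \<le> exp (1 / real d) ^ d"
    by (intro power_mono exp_ge_add_one_self) auto
  also have "\<dots> = exp 1" using d by (simp add: exp_of_nat_mult[symmetric])
  also have "\<dots> \<le> 3" by (rule exp_le)
  finally have "(1 + 1 / real d) ^ d * (1 + 1 / real d) \<le> 3 * (1 + 1 / real d)"
    by (intro mult_right_mono) auto
  also have "\<dots> \<le> 3 * (1 + 1 / 3)" using d by (intro mult_left_mono add_left_mono divide_left_mono) auto
  also have "\<dots> < d + 2" using d by simp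
  finally show ?thesis by (simp add: mult.commute)
qed (simp add: eval_nat_numeral)

text \<open>The left-hand side bounds a \<open>(d + 1)\<close>-intersecting family, the right-hand
  side is the main part of the size of \<open>\<A>\<close>. The hypothesis on \<open>n\<close> is
  that of the theorem; it makes each of the \<open>d + 1\<close> unit steps from
  \<open>n - d - 2\<close> to \<open>n - 1\<close> cost a factor of at most
  \<open>1 + 1 / d\<close>.\<close>

lemma choose_next_level_less:
  assumes d: "2 \<le> d" and k: "1 \<le> \<kappa>" and n: "(d + 1) * (\<kappa> + 1) < n"
  shows "(n - 1) choose (\<kappa> - 1) < (d + 2) * ((n - d - 2) choose (\<kappa> - 1))"
proof -
  define w where "w = \<kappa> - 1"
  define M where "M = n - d - 2"
  have nd: "(d + 1) * w + 2 * (d + 1) < n" using n k by (cases \<kappa>) (auto simp: w_def algebra_simps)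
  have M: "(d + 1) * w \<le> M + 1" "n - 1 = M + (d + 1)" "w \<le> M"
  proof -
    have n: "n = M + d + 2" using nd by (simp add: M_def)
    then show "(d + 1) * w \<le> M + 1" "n - 1 = M + (d + 1)" using nd by auto
    have "2 * w \<le> (d + 1) * w" using d by (intro mult_le_mono1) simp
    then show "w \<le> M" using \<open>(d + 1) * w \<le> M + 1\<close> by linarith
  qed
  have "real ((M + s) choose w) \<le> real (M choose w) * (1 + 1 / d) ^ s" for s
  proof (induction s)
    case (Suc s)
    have "((M + s) choose w) * (M + s + 1) = ((M + Suc s) choose w) * (M + s + 1 - w)"
      using binomial_absorb_comp[of "M + Suc s" w] by (simp add: algebra_simps)
    then have "real ((M + Suc s) choose w) * real (M + s + 1 - w) = real ((M + s) choose w) * (M + s + 1)"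
      by (metis of_nat_mult)
    then have "real ((M + Suc s) choose w) = real ((M + s) choose w) * ((M + s + 1) / (M + s + 1 - w))"
      using M(3) by (simp add: field_simps)
    also have "\<dots> \<le> real ((M + s) choose w) * (1 + 1 / d)"
    proof (rule mult_left_mono)
      have "real ((d + 1) * w) \<le> real (M + s + 1)" using M(1) by (subst of_nat_le_iff) simp
      then have "real (M + s + 1) * d \<le> real (M + s + 1 - w) * (d + 1)"
        using M(3) by (simp add: of_nat_diff algebra_simps)
      then show "real (M + s + 1) / real (M + s + 1 - w) \<le> 1 + 1 / real d"
        using d M(3) by (simp add: field_simps)
    qed simp
    also have "\<dots> \<le> real (M choose w) * (1 + 1 / d) ^ s * (1 + 1 / d)"
      using Suc by (intro mult_right_mono) auto
    finally show ?case by (simp add: algebra_simps)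
  qed simp
  then have "real ((M + (d + 1)) choose w) \<le> real (M choose w) * (1 + 1 / d) ^ (d + 1)" .
  also have "\<dots> < real (M choose w) * (d + 2)"
    using Suc_power_less[OF d] M(3) by (intro mult_strict_left_mono) auto
  finally have "real ((n - 1) choose w) < real ((d + 2) * (M choose w))"
    unfolding M(2) by (simp add: algebra_simps)
  then show ?thesis unfolding of_nat_less_iff w_def M_def .
qed

section \<open>Families shifted to an extremal family\<close>

text \<open>The ground set is arbitrary because the relabelling that brings \<open>D\<close> to the
  front leaves \<open>{1..n}\<close>.\<close>

definition fam_H :: "nat set \<Rightarrow> nat \<Rightarrow> nat \<Rightarrow> nat set \<Rightarrow> nat set \<Rightarrow> nat set set" where
  "fam_H V k d X M = {A \<in> nsets V k. X \<subseteq> A \<and> d + 1 \<le> card (A \<inter> M)} \<union> nsets M k"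

definition fam_A :: "nat set \<Rightarrow> nat \<Rightarrow> nat \<Rightarrow> nat set \<Rightarrow> nat set set" where
  "fam_A V k d Z = {A \<in> nsets V k. d + 1 \<le> card (A \<inter> Z)}"

lemma card_image_Int:
  assumes "inj_on \<pi> V" "A \<subseteq> V" "B \<subseteq> V"
  shows "card (\<pi> ` A \<inter> \<pi> ` B) = card (A \<inter> B)"
proof -
  have "\<pi> ` A \<inter> \<pi> ` B = \<pi> ` (A \<inter> B)" using inj_on_image_Int[OF assms] by simp
  moreover have "inj_on \<pi> (A \<inter> B)" using assms by (meson le_infI1 inj_on_subset)
  ultimately show ?thesis by (simp add: card_image)
qed

text \<open>Serves the transposition that undoes a shift and the relabelling of the ground set;
  likewise \<open>image_fam_H\<close>.\<close>

lemma image_fam_A: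
  assumes "inj_on \<pi> V" "Z \<subseteq> V"
  shows "(`) \<pi> ` fam_A V k d Z = fam_A (\<pi> ` V) k d (\<pi> ` Z)"
proof -
  note c = card_image_Int[OF assms(1) _ assms(2)]
  have n: "\<pi> ` A \<in> nsets (\<pi> ` V) k \<longleftrightarrow> A \<in> nsets V k" if "A \<subseteq> V" for A
    using that inj_on_subset[OF assms(1) that] by (auto simp: nsets_def card_image finite_image_iff)
  show ?thesis
  proof (intro equalityI subsetI)
    fix B assume "B \<in> (`) \<pi> ` fam_A V k d Z"
    then obtain A where "B = \<pi> ` A" "A \<in> fam_A V k d Z" by auto
    then show "B \<in> fam_A (\<pi> ` V) k d (\<pi> ` Z)"
      using c[of A] n[of A] unfolding fam_A_def by (auto simp: nsets_def)
  next
    fix B assume B: "B \<in> fam_A (\<pi> ` V) k d (\<pi> ` Z)"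
    then obtain A where A: "B = \<pi> ` A" "A \<subseteq> V" unfolding fam_A_def nsets_def by (auto simp: subset_image_iff)
    then have "A \<in> fam_A V k d Z" using B c[of A] n[of A] unfolding fam_A_def by simp
    then show "B \<in> (`) \<pi> ` fam_A V k d Z" using A by auto
  qed
qed

lemma image_fam_H:
  assumes "inj_on \<pi> V" "X \<subseteq> M" "M \<subseteq> V"
  shows "(`) \<pi> ` fam_H V k d X M = fam_H (\<pi> ` V) k d (\<pi> ` X) (\<pi> ` M)"
proof -
  note c = card_image_Int[OF assms(1) _ assms(3)]
  have sub: "\<pi> ` B \<subseteq> \<pi> ` A \<longleftrightarrow> B \<subseteq> A" if "A \<subseteq> V" "B \<subseteq> V" for A B
    unfolding image_subset_iff using inj_on_image_mem_iff[OF assms(1) _ that(1)] that by blast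
  have s: "\<pi> ` X \<subseteq> \<pi> ` A \<longleftrightarrow> X \<subseteq> A" if "A \<subseteq> V" for A
    using sub that assms by auto
  have n: "\<pi> ` A \<in> nsets (\<pi> ` U) k \<longleftrightarrow> A \<in> nsets U k" if "A \<subseteq> V" "U \<subseteq> V" for A U
    using inj_on_subset[OF assms(1) that(1)] sub[OF that(2,1)]
    by (auto simp: nsets_def card_image finite_image_iff)
  have mem: "\<pi> ` A \<in> fam_H (\<pi> ` V) k d (\<pi> ` X) (\<pi> ` M) \<longleftrightarrow> A \<in> fam_H V k d X M" if "A \<subseteq> V" for A
    using c[OF that] s[OF that] n[OF that] assms(3) unfolding fam_H_def by simp
  show ?thesis
  proof (intro equalityI subsetI)
    fix B assume "B \<in> (`) \<pi> ` fam_H V k d X M"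
    then obtain A where A: "B = \<pi> ` A" "A \<in> fam_H V k d X M" by auto
    then have "A \<subseteq> V" using assms(3) unfolding fam_H_def nsets_def by auto
    then show "B \<in> fam_H (\<pi> ` V) k d (\<pi> ` X) (\<pi> ` M)" using A mem by simp
  next
    fix B assume B: "B \<in> fam_H (\<pi> ` V) k d (\<pi> ` X) (\<pi> ` M)"
    then have "B \<subseteq> \<pi> ` V" using image_mono[OF assms(3), of \<pi>] unfolding fam_H_def nsets_def by blast
    then obtain A where A: "B = \<pi> ` A" "A \<subseteq> V" by (auto simp: subset_image_iff)
    then show "B \<in> (`) \<pi> ` fam_H V k d X M" using B mem by auto
  qed
qed

lemma fam_H_subset: "M \<subseteq> V \<Longrightarrow> fam_H V k d X M \<subseteq> nsets V k"
  unfolding fam_H_def nsets_def by auto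

lemma fam_A_subset: "fam_A V k d Z \<subseteq> nsets V k"
  unfolding fam_A_def by auto

text \<open>The sets for which the image \<open>E\<close> of a shift does not reveal whether
  \<open>G\<close> or \<open>swap_elem j i G\<close> was the original member.\<close>

definition ambiguous :: "nat \<Rightarrow> nat \<Rightarrow> nat set set \<Rightarrow> nat set set" where
  "ambiguous i j E = {G \<in> E. i \<in> G \<and> j \<notin> G \<and> swap_elem j i G \<notin> E}"

lemma ambiguous_iff:
  assumes ij: "i \<noteq> j" and G: "G \<in> ambiguous i j (shift i j \<F>)"
  shows "swap_elem j i G \<in> \<F> \<longleftrightarrow> G \<notin> \<F>"
proof -
  have g: "G \<in> shift i j \<F>" "i \<in> G" "j \<notin> G" "swap_elem j i G \<notin> shift i j \<F>"
    using G by (auto simp: ambiguous_def)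
  have s: "swap_elem i j (swap_elem j i G) = G" using swap_elem_swap_elem[of i G j] g by simp
  have "G \<in> \<F> \<or> swap_elem j i G \<in> \<F>" using g mem_shift_iff[OF ij] by blast
  moreover have "swap_elem j i G \<notin> \<F> \<or> G \<notin> \<F>" using g(4) mem_shift_iff[OF ij] s by metis
  ultimately show ?thesis by blast
qed

text \<open>If one of the sets stayed and the other was moved, the original members are
  \<open>G\<close> and \<open>swap_elem j i G'\<close>, say. They share the points of
  \<open>G \<inter> G'\<close> except \<open>i\<close>, one fewer than \<open>d\<close>.\<close>

lemma ambiguous_link:
  assumes ij: "i \<noteq> j" and F: "inter2 d \<F>" and fin: "\<And>A. A \<in> shift i j \<F> \<Longrightarrow> finite A"
    and G: "G \<in> ambiguous i j (shift i j \<F>)" "G' \<in> ambiguous i j (shift i j \<F>)" "card (G \<inter> G') = d"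
  shows "G \<in> \<F> \<longleftrightarrow> G' \<in> \<F>"
proof -
  have half: "B \<in> \<F>" if AB: "A \<in> ambiguous i j (shift i j \<F>)" "B \<in> ambiguous i j (shift i j \<F>)"
    "card (A \<inter> B) = d" "A \<in> \<F>" for A B
  proof (rule ccontr)
    assume "B \<notin> \<F>"
    then have "swap_elem j i B \<in> \<F>" using ambiguous_iff[OF ij AB(2)] by blast
    then have "d \<le> card (A \<inter> swap_elem j i B)" using inter2D[OF F AB(4)] by blast
    moreover have "A \<inter> swap_elem j i B = (A \<inter> B) - {i}" "i \<in> A \<inter> B" "finite A"
      using AB fin by (auto simp: ambiguous_def swap_elem_def)
    ultimately show False using AB(3) card_Diff1_less[of "A \<inter> B" i] by simp
  qed
  show ?thesis using half[OF G(1,2)] half[OF G(2,1)] G(3) by (metis Int_commute)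
qed

text \<open>Each set of \<open>E\<close> that is not ambiguous lies in \<open>\<F>\<close> together
  with its image under the transposition. If the ambiguous sets all behave alike,
  \<open>\<F>\<close> contains \<open>E\<close> or the transposed copy of \<open>E\<close>, and
  cardinalities agree.\<close>

lemma shift_dichotomy:
  assumes ij: "i \<noteq> j" and V: "finite V" and F: "\<F> \<subseteq> nsets V k" and i: "i \<in> V" and E: "E = shift i j \<F>"
    and const: "\<And>G G'. G \<in> ambiguous i j E \<Longrightarrow> G' \<in> ambiguous i j E \<Longrightarrow> G \<in> \<F> \<longleftrightarrow> G' \<in> \<F>"
  shows "\<F> = E \<or> \<F> = (`) (id(i := j, j := i)) ` E"
proof -
  let ?\<tau> = "id(i := j, j := i)"
  have \<tau>inj: "inj ?\<tau>" using ij by (auto simp: inj_def)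
  have \<tau>id: "?\<tau> ` G = G" if "(i \<in> G \<longleftrightarrow> j \<in> G)" for G using that ij by (auto simp: image_iff)
  have \<tau>1: "?\<tau> ` G = swap_elem j i G" if "i \<in> G" "j \<notin> G" for G
    using that ij by (auto simp: swap_elem_def image_iff)
  have \<tau>2: "?\<tau> ` G = swap_elem i j G" if "j \<in> G" "i \<notin> G" for G
    using that ij by (auto simp: swap_elem_def image_iff)
  have finF: "finite \<F>" using F finite_nsets[OF V] finite_subset by blast
  have cE: "card E = card \<F>" using card_shift E by simp
  have na: "G \<in> \<F> \<and> ?\<tau> ` G \<in> \<F>" if G: "G \<in> E" "G \<notin> ambiguous i j E" for G
  proof -
    consider "i \<in> G \<longleftrightarrow> j \<in> G" | "j \<in> G" "i \<notin> G" | "i \<in> G" "j \<notin> G" by blast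
    then show ?thesis
    proof cases
      case 1
      then show ?thesis using G(1) \<tau>id[OF 1] mem_shift_iff[OF ij] unfolding E by auto
    next
      case 2
      then show ?thesis using G(1) \<tau>2[OF 2] mem_shift_iff[OF ij] unfolding E by auto
    next
      case 3
      then have s: "swap_elem j i G \<in> E" using G by (auto simp: ambiguous_def)
      have "j \<in> swap_elem j i G" "i \<notin> swap_elem j i G" using ij by (auto simp: swap_elem_def)
      then have "swap_elem j i G \<in> \<F>" "swap_elem i j (swap_elem j i G) \<in> \<F>"
        using s mem_shift_iff[OF ij] unfolding E by blast+
      then show ?thesis using \<tau>1[OF 3] swap_elem_swap_elem[of i G j] 3 by simp
    qed
  qed
  show ?thesis
  proof (cases "\<exists>G\<in>ambiguous i j E. G \<in> \<F>")
    case True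
    then have "E \<subseteq> \<F>" using const na by blast
    then show ?thesis using card_subset_eq[OF finF] cE by blast
  next
    case False
    have "(`) ?\<tau> ` E \<subseteq> \<F>"
    proof (intro image_subsetI)
      fix G assume G: "G \<in> E"
      show "?\<tau> ` G \<in> \<F>"
      proof (cases "G \<in> ambiguous i j E")
        case True
        then have "swap_elem j i G \<in> \<F>" using False ambiguous_iff[OF ij] E by blast
        then show ?thesis using True \<tau>1[of G] by (simp add: ambiguous_def)
      qed (use na G in blast)
    qed
    moreover have "card ((`) ?\<tau> ` E) = card E"
      by (rule card_image, rule inj_onI) (use inj_image_eq_iff[OF \<tau>inj] in blast)
    ultimately show ?thesis using card_subset_eq[OF finF] cE by metis
  qed
qed

section \<open>Shifts whose image is an extremal family\<close>

lemma obtain_avoiding: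
  assumes "finite U" "card B + s \<le> card U" "B \<subseteq> U"
  obtains W where "W \<subseteq> U" "W \<inter> B = {}" "card W = s" "finite W"
proof -
  have "s \<le> card (U - B)" using assms by (simp add: card_Diff_subset finite_subset)
  then obtain W where "W \<subseteq> U - B" "card W = s" by (meson obtain_subset_with_card_n)
  then show ?thesis using that[of W] assms(1) finite_subset[of W U] by auto
qed

text \<open>An ambiguous set contains all of \<open>Z\<close> except one point \<open>p\<close>. Two
  of them, missing \<open>p\<close> and \<open>p'\<close>, are both linked to a third one that
  misses another point \<open>q\<close> and is disjoint from them outside \<open>Z\<close>. The
  choice of \<open>q\<close> apart from \<open>i\<close>, \<open>p\<close>, \<open>p'\<close> is
  possible because \<open>card Z = d + 2\<close> is at least \<open>4\<close>.\<close>

lemma shift_eq_fam_A: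
  assumes V: "finite V" and F: "\<F> \<subseteq> nsets V k" and i2: "inter2 d \<F>" and ij: "i \<noteq> j" "i \<in> V" "j \<in> V"
    and k: "k = d + \<kappa>" "1 \<le> \<kappa>" and d: "2 \<le> d" and n: "d + 3 * \<kappa> + 2 \<le> card V"
    and Z: "Z \<subseteq> V" "card Z = d + 2" and E: "shift i j \<F> = fam_A V k d Z"
  shows "\<exists>Z' \<subseteq> V. card Z' = d + 2 \<and> \<F> = fam_A V k d Z'"
proof -
  let ?E = "fam_A V k d Z"
  have fZ: "finite Z" using Z V finite_subset by blast
  have finE: "finite A" if "A \<in> shift i j \<F>" for A using that unfolding E fam_A_def nsets_def by simp
  have link: "G \<in> \<F> \<longleftrightarrow> G' \<in> \<F>" if "G \<in> ambiguous i j ?E" "G' \<in> ambiguous i j ?E" "card (G \<inter> G') = d" for G G'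
    using ambiguous_link[OF ij(1) i2 finE] that unfolding E by blast
  have amb: "i \<in> Z \<and> j \<notin> Z \<and> (\<exists>p\<in>Z - {i}. G \<inter> Z = Z - {p})" if G: "G \<in> ambiguous i j ?E" for G
  proof -
    have g: "G \<subseteq> V" "finite G" "card G = k" "d + 1 \<le> card (G \<inter> Z)" "i \<in> G" "j \<notin> G" "swap_elem j i G \<notin> ?E"
      using G by (auto simp: ambiguous_def fam_A_def nsets_def)
    have "swap_elem j i G \<in> nsets V k"
      using swap_elem_nsets[of G V k j i] g ij by (simp add: nsets_def)
    then have less: "card (swap_elem j i G \<inter> Z) < d + 1" using g(7) by (simp add: fam_A_def)
    have iz: "i \<in> Z \<and> j \<notin> Z"
    proof (rule ccontr)
      assume c: "\<not> (i \<in> Z \<and> j \<notin> Z)"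
      have "card (G \<inter> Z) \<le> card (swap_elem j i G \<inter> Z)"
      proof (cases "i \<in> Z")
        case True
        then have "swap_elem j i G \<inter> Z = swap_elem j i (G \<inter> Z)" using c by (auto simp: swap_elem_def)
        then show ?thesis using card_swap_elem[of "G \<inter> Z" i j] True g by simp
      next
        case False
        then show ?thesis using g fZ by (intro card_mono) (auto simp: swap_elem_def)
      qed
      then show False using less g by simp
    qed
    have "swap_elem j i G \<inter> Z = (G \<inter> Z) - {i}" using iz by (auto simp: swap_elem_def)
    then have "card (G \<inter> Z) = d + 1" using less g iz fZ by simp
    then have "card (Z - G) = 1" using Z fZ by (simp add: card_Diff_subset_Int Int_commute)
    then obtain p where "Z - G = {p}" by (auto simp: card_1_singleton_iff)
    then have "p \<in> Z - {i}" "G \<inter> Z = Z - {p}" using g by auto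
    then show ?thesis using iz by blast
  qed
  have const: "G \<in> \<F> \<longleftrightarrow> G' \<in> \<F>" if G: "G \<in> ambiguous i j ?E" "G' \<in> ambiguous i j ?E" for G G'
  proof -
    obtain p where p: "i \<in> Z" "j \<notin> Z" "p \<in> Z - {i}" "G \<inter> Z = Z - {p}" using amb[OF G(1)] by blast
    obtain p' where p': "p' \<in> Z - {i}" "G' \<inter> Z = Z - {p'}" using amb[OF G(2)] by blast
    have "card {i, p, p'} < card Z" using Z d by (simp add: card_insert_if)
    then have "\<not> Z \<subseteq> {i, p, p'}" using card_mono[of "{i, p, p'}" Z] by auto
    then obtain q where q: "q \<in> Z" "q \<noteq> i" "q \<noteq> p" "q \<noteq> p'" by blast
    have gG: "G \<subseteq> V" "finite G" "card G = k" "i \<in> G" "j \<notin> G"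
      and gG': "G' \<subseteq> V" "finite G'" "card G' = k" "i \<in> G'" "j \<notin> G'"
      using G by (auto simp: ambiguous_def fam_A_def nsets_def)
    have c1: "card (A - Z) \<le> \<kappa> - 1" if "finite A" "card A = k" "A \<inter> Z = Z - {r}" "r \<in> Z" for A r
    proof -
      have "card (A \<inter> Z) = d + 1" using that Z fZ by simp
      then show ?thesis using that fZ k by (simp add: card_Diff_subset_Int)
    qed
    \<comment> \<open>Everything that the filling \<open>W\<close> of the linking set has to avoid,
      so that its intersections with \<open>G\<close> and \<open>G'\<close> lie inside
      \<open>Z\<close>.\<close>
    define B where "B = insert j (Z \<union> (G - Z) \<union> (G' - Z))"
    have "card B \<le> Suc (card (Z \<union> (G - Z) \<union> (G' - Z)))"
      unfolding B_def using fZ gG gG' by (simp only: card_insert_if finite_Un finite_Diff) simp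
    also have "\<dots> \<le> Suc (card Z + card (G - Z) + card (G' - Z))"
      using card_Un_le[of "Z \<union> (G - Z)" "G' - Z"] card_Un_le[of Z "G - Z"] by linarith
    also have "\<dots> \<le> Suc (d + 2 + (\<kappa> - 1) + (\<kappa> - 1))"
      using c1[of G p] c1[of G' p'] gG gG' p p' Z by simp
    finally have "card B + (\<kappa> - 1) \<le> card V" using n k by simp
    moreover have "B \<subseteq> V" using gG gG' Z ij by (auto simp: B_def)
    ultimately obtain W where W: "W \<subseteq> V" "W \<inter> B = {}" "card W = \<kappa> - 1" "finite W"
      using obtain_avoiding[OF V] by metis
    define H where "H = (Z - {q}) \<union> W"
    have WZ: "W \<inter> Z = {}" "j \<notin> W" "W \<inter> G = {}" "W \<inter> G' = {}" using W p p' by (auto simp: B_def)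
    have HZ: "H \<inter> Z = Z - {q}" using WZ by (auto simp: H_def)
    have "card H = k" using W Z q fZ WZ k unfolding H_def by (subst card_Un_disjoint) auto
    then have "H \<in> nsets V k" using W Z fZ by (auto simp: H_def nsets_def)
    moreover have "card (H \<inter> Z) = d + 1" using HZ Z q fZ by simp
    ultimately have "H \<in> ?E" by (simp add: fam_A_def)
    moreover have "i \<in> H" "j \<notin> H" using p q WZ by (auto simp: H_def)
    moreover have "swap_elem j i H \<notin> ?E"
    proof -
      have "swap_elem j i H \<inter> Z = (H \<inter> Z) - {i}" using p by (auto simp: swap_elem_def)
      then have "card (swap_elem j i H \<inter> Z) = d"
        using \<open>card (H \<inter> Z) = d + 1\<close> \<open>i \<in> H\<close> p fZ by simp
      then show ?thesis by (simp add: fam_A_def)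
    qed
    ultimately have Ha: "H \<in> ambiguous i j ?E" by (simp add: ambiguous_def)
    have cc: "card (A \<inter> H) = d" if "A \<inter> Z = Z - {r}" "r \<in> Z" "r \<noteq> q" "W \<inter> A = {}" for A r
    proof -
      have "A \<inter> H = Z - {r, q}" using that by (auto simp: H_def)
      then show ?thesis using that q fZ Z by (simp add: card_Diff_subset)
    qed
    have "G \<in> \<F> \<longleftrightarrow> H \<in> \<F>" using link[OF G(1) Ha] cc[of G p] p q WZ by auto
    moreover have "G' \<in> \<F> \<longleftrightarrow> H \<in> \<F>" using link[OF G(2) Ha] cc[of G' p'] p' q WZ by auto
    ultimately show ?thesis by simp
  qed
  have "\<F> = ?E \<or> \<F> = (`) (id(i := j, j := i)) ` ?E"
    using shift_dichotomy[OF ij(1) V F ij(2) E[symmetric] const] by blast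
  then show ?thesis
  proof
    assume *: "\<F> = (`) (id(i := j, j := i)) ` ?E"
    let ?\<tau> = "id(i := j, j := i)"
    have inj: "inj_on ?\<tau> V" using ij by (auto simp: inj_on_def)
    have V': "?\<tau> ` V = V" using ij by (auto simp: image_iff)
    have "\<F> = fam_A V k d (?\<tau> ` Z)" using * image_fam_A[OF inj Z(1)] V' by simp
    moreover have "?\<tau> ` Z \<subseteq> V" using Z V' by blast
    moreover have "card (?\<tau> ` Z) = d + 2" using Z inj by (metis card_image inj_on_subset)
    ultimately show ?thesis by blast
  qed (use Z in blast)
qed

text \<open>Connectivity of a graph of Kneser type. From \<open>R\<close> to \<open>R'\<close> there
  is a path of four disjoint pairs with middle vertex \<open>S\<close>, which meets \<open>T\<close>
  but avoids a point \<open>y\<close> of \<open>T\<close> missed by \<open>R\<close> and a point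
  \<open>y'\<close> of \<open>T\<close> missed by \<open>R'\<close>. The two intermediate sets are
  \<open>y\<close> and \<open>y'\<close> with fresh fillings; the bound on \<open>card U\<close>
  provides the room.\<close>

lemma disjoint_chain_constant:
  fixes P :: "nat set \<Rightarrow> bool"
  assumes U: "finite U" "3 * \<kappa> + 1 \<le> card U" and T: "T \<subseteq> U" "3 \<le> card T" and \<kappa>: "2 \<le> \<kappa>"
    and link: "\<And>R R'. R \<in> \<R> \<Longrightarrow> R' \<in> \<R> \<Longrightarrow> R \<inter> R' = {} \<Longrightarrow> P R \<longleftrightarrow> P R'"
    and \<R>: "\<R> = {R. R \<subseteq> U \<and> card R = \<kappa> \<and> R \<inter> T \<noteq> {} \<and> \<not> T \<subseteq> R}"
    and R: "R \<in> \<R>" "R' \<in> \<R>"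
  shows "P R \<longleftrightarrow> P R'"
proof -
  obtain y where y: "y \<in> T" "y \<notin> R" using R \<R> by auto
  obtain y' where y': "y' \<in> T" "y' \<notin> R'" using R \<R> by auto
  have "card {y, y'} < card T" using T by (simp add: card_insert_if)
  then have "\<not> T \<subseteq> {y, y'}" using card_mono[of "{y, y'}" T] by auto
  then obtain z where z: "z \<in> T" "z \<noteq> y" "z \<noteq> y'" by blast
  have c3: "card {y, y', z} \<le> 3" by (simp add: card_insert_if)
  have "card {y, y', z} + (\<kappa> - 1) \<le> card U" "{y, y', z} \<subseteq> U" using U(2) c3 y y' z T \<kappa> by auto
  then obtain W where W: "W \<subseteq> U" "W \<inter> {y, y', z} = {}" "card W = \<kappa> - 1" "finite W"
    using obtain_avoiding[OF U(1)] by metis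
  define S where "S = insert z W"
  have S: "S \<in> \<R>" "y \<notin> S" "y' \<notin> S" "z \<in> S" "card S = \<kappa>" "S \<subseteq> U" "finite S"
    using W z y y' T \<kappa> unfolding \<R> S_def by auto
  have half: "P Q \<longleftrightarrow> P S" if Q: "Q \<in> \<R>" "x \<in> T" "x \<notin> Q" "x \<notin> S" for Q x
  proof -
    have q: "Q \<subseteq> U" "card Q = \<kappa>" "finite Q" using Q \<R> U finite_subset by auto
    have "card (insert x (Q \<union> S)) \<le> Suc (card (Q \<union> S))" using q S by (simp add: card_insert_if)
    also have "\<dots> \<le> Suc (card Q + card S)" using card_Un_le[of Q S] by simp
    finally have "card (insert x (Q \<union> S)) \<le> Suc (card Q + card S)" .
    then have "card (insert x (Q \<union> S)) + (\<kappa> - 1) \<le> card U" using q S U \<kappa> by simp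
    moreover have "insert x (Q \<union> S) \<subseteq> U" using q S Q T by auto
    ultimately obtain W' where W': "W' \<subseteq> U" "W' \<inter> insert x (Q \<union> S) = {}" "card W' = \<kappa> - 1" "finite W'"
      using obtain_avoiding[OF U(1)] by metis
    have "insert x W' \<in> \<R>" using W' Q T S z \<kappa> unfolding \<R> by auto
    moreover have "Q \<inter> insert x W' = {}" "insert x W' \<inter> S = {}" using W' Q by auto
    ultimately show ?thesis using link[OF Q(1)] link[OF _ S(1)] by blast
  qed
  show ?thesis using half[OF R(1) y S(2)] half[OF R(2) y' S(3)] by blast
qed

lemma mem_fam_H:
  assumes "finite M" "X \<subseteq> M" "card X = d"
  shows "A \<in> fam_H V k d X M \<longleftrightarrow>
    (A \<in> nsets V k \<and> X \<subseteq> A \<and> A \<inter> (M - X) \<noteq> {}) \<or> A \<in> nsets M k"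
proof -
  have "d + 1 \<le> card (A \<inter> M) \<longleftrightarrow> A \<inter> (M - X) \<noteq> {}" if "X \<subseteq> A"
  proof -
    have "A \<inter> M = X \<union> (A \<inter> (M - X))" using that assms by auto
    then have "card (A \<inter> M) = d + card (A \<inter> (M - X))"
      using assms card_Un_disjoint[of X "A \<inter> (M - X)"] by (metis Int_Diff Diff_disjoint finite_Diff finite_Int finite_subset inf_left_commute Int_empty_right)
    then show ?thesis using assms by (simp add: Suc_le_eq card_gt_0_iff)
  qed
  then show ?thesis unfolding fam_H_def by auto
qed

text \<open>The position of \<open>i\<close> and \<open>j\<close> relative to \<open>X\<close> and
  \<open>Y = M - X\<close> decides which sets are ambiguous. Sets \<open>X \<union> R\<close> and
  \<open>X \<union> R'\<close> with disjoint \<open>R\<close>, \<open>R'\<close> are linked, since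
  they meet exactly in \<open>X\<close>. The exceptional sets \<open>M - {x}\<close> with
  \<open>x \<in> X\<close> are linked to sets that contain \<open>X\<close> and a single point of
  \<open>Y\<close>.\<close>

lemma shift_eq_fam_H:
  assumes V: "finite V" and F: "\<F> \<subseteq> nsets V k" and i2: "inter2 d \<F>" and ij: "i \<noteq> j" "i \<in> V" "j \<in> V"
    and k: "k = d + \<kappa>" "3 \<le> \<kappa>" and d: "2 \<le> d" and n: "d + 3 * \<kappa> + 2 \<le> card V"
    and M: "M \<subseteq> V" "card M = k + 1" and X: "X \<subseteq> M" "card X = d" and E: "shift i j \<F> = fam_H V k d X M"
  shows "\<exists>M' X'. M' \<subseteq> V \<and> card M' = k + 1 \<and> X' \<subseteq> M' \<and> card X' = d \<and> \<F> = fam_H V k d X' M'"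
proof -
  let ?E = "fam_H V k d X M"
  define Y where "Y = M - X"
  have fin: "finite M" "finite X" "finite Y"
    using finite_subset[OF M(1) V] finite_subset[OF X(1)] by (simp_all add: Y_def)
  have cY: "card Y = \<kappa> + 1" using M X fin k by (simp add: Y_def card_Diff_subset)
  have memE: "A \<in> ?E \<longleftrightarrow> (A \<in> nsets V k \<and> X \<subseteq> A \<and> A \<inter> Y \<noteq> {}) \<or> A \<in> nsets M k" for A
    using mem_fam_H[OF fin(1) X] unfolding Y_def .
  have finE: "finite A" if "A \<in> shift i j \<F>" for A
    using that fam_H_subset[OF M(1), of k d X] unfolding E nsets_def by auto
  have link: "G \<in> \<F> \<longleftrightarrow> G' \<in> \<F>" if "G \<in> ambiguous i j ?E" "G' \<in> ambiguous i j ?E" "card (G \<inter> G') = d" for G G'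
    using ambiguous_link[OF ij(1) i2 finE] that unfolding E by blast
  have ambD: "G \<in> ?E" "i \<in> G" "j \<notin> G" "swap_elem j i G \<notin> ?E" "swap_elem j i G \<in> nsets V k" "G \<subseteq> V" "card G = k" "finite G"
    if G: "G \<in> ambiguous i j ?E" for G
  proof -
    show g: "G \<in> ?E" "i \<in> G" "j \<notin> G" "swap_elem j i G \<notin> ?E" using G by (auto simp: ambiguous_def)
    have "G \<in> nsets V k" using g fam_H_subset[OF M(1)] by blast
    then show "swap_elem j i G \<in> nsets V k" "G \<subseteq> V" "card G = k" "finite G"
      using swap_elem_nsets[of G V k j i] g ij by (auto simp: nsets_def)
  qed
  have ambI: "G \<in> ambiguous i j ?E" if "G \<in> ?E" "i \<in> G" "j \<notin> G" "swap_elem j i G \<notin> ?E" for G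
    using that by (simp add: ambiguous_def)
  have sub_nsets: "G = M - {x}" if "G \<in> nsets M k" "x \<in> M" "x \<notin> G" for G x
  proof -
    have "G \<subseteq> M - {x}" using that by (auto simp: nsets_def)
    moreover have "card (M - {x}) = card G" using that M fin by (simp add: nsets_def)
    ultimately show "G = M - {x}" using card_subset_eq[of "M - {x}" G] fin by simp
  qed
  have Mx: "M - {x} \<in> nsets M k" if "x \<in> M" for x using that M fin by (simp add: nsets_def)
  consider "i \<in> X" "j \<in> Y" | "i \<in> X" "j \<notin> M" | "i \<in> Y" "j \<notin> M"
    | "(i \<in> X \<and> j \<in> X) \<or> (i \<in> Y \<and> j \<in> M) \<or> i \<notin> M"
    unfolding Y_def using X by blast
  then have const: "\<forall>G\<in>ambiguous i j ?E. \<forall>G'\<in>ambiguous i j ?E. G \<in> \<F> \<longleftrightarrow> G' \<in> \<F>"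
  proof cases
    case 1
    define U where "U = V - X - {j}"
    \<comment> \<open>The \<open>\<kappa>\<close>-set \<open>T\<close> itself is no admissible
      \<open>R\<close>: it belongs to \<open>M - {j}\<close>, whose swap \<open>M - {i}\<close> is
      again in the family, so that \<open>M - {j}\<close> is not ambiguous.\<close>
    define T where "T = Y - {j}"
    define \<R> where "\<R> = {R. R \<subseteq> U \<and> card R = \<kappa> \<and> R \<inter> T \<noteq> {} \<and> \<not> T \<subseteq> R}"
    have jX: "j \<notin> X" "i \<in> M" "j \<in> M" using 1 X by (auto simp: Y_def)
    have "card U = card V - d - 1" unfolding U_def using V X M jX ij fin by (simp add: card_Diff_subset)
    then have U: "finite U" "3 * \<kappa> + 1 \<le> card U" using V n by (auto simp: U_def)
    have T: "T \<subseteq> U" "3 \<le> card T" "card T = \<kappa>" using 1 M cY k fin by (auto simp: T_def U_def Y_def)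
    have amb1: "G - X \<in> \<R> \<and> G = X \<union> (G - X)" if G: "G \<in> ambiguous i j ?E" for G
    proof -
      note g = ambD[OF G]
      have XG: "X \<subseteq> G" "G \<inter> Y \<noteq> {}" "G \<noteq> M - {j}"
      proof -
        have ne: "G \<noteq> M - {j}"
        proof
          assume "G = M - {j}"
          then have "swap_elem j i G = M - {i}" using 1 ij jX by (auto simp: swap_elem_def)
          then show False using g(4) memE Mx[OF jX(2)] by simp
        qed
        then have "G \<notin> nsets M k" using sub_nsets g(3) jX by blast
        then show "X \<subseteq> G" "G \<inter> Y \<noteq> {}" "G \<noteq> M - {j}" using g(1) memE ne by blast+
      qed
      have "card (G - X) = \<kappa>" using XG g X fin k by (simp add: card_Diff_subset)
      moreover have "\<not> T \<subseteq> G - X"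
      proof
        assume "T \<subseteq> G - X"
        then have "T = G - X" using card_subset_eq[of "G - X" T] g T \<open>card (G - X) = \<kappa>\<close> by simp
        then have "G = M - {j}" using XG X jX unfolding T_def Y_def by blast
        then show False using XG by simp
      qed
      moreover have "(G - X) \<inter> T \<noteq> {}" using XG g by (auto simp: T_def Y_def)
      ultimately show ?thesis unfolding \<R>_def using g XG by (auto simp: U_def)
    qed
    have ambR: "X \<union> R \<in> ambiguous i j ?E" if R: "R \<in> \<R>" for R
    proof (rule ambI)
      have r: "R \<subseteq> V - X - {j}" "card R = \<kappa>" "R \<inter> Y \<noteq> {}" "\<not> T \<subseteq> R" "finite R"
        using R U finite_subset unfolding \<R>_def U_def T_def by auto
      have "card (X \<union> R) = k" using r fin X k by (subst card_Un_disjoint) auto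
      then show "X \<union> R \<in> ?E" unfolding memE using r fin X M by (auto simp: nsets_def)
      show "i \<in> X \<union> R" "j \<notin> X \<union> R" using 1 r jX by auto
      show "swap_elem j i (X \<union> R) \<notin> ?E"
      proof
        assume "swap_elem j i (X \<union> R) \<in> ?E"
        moreover have "\<not> X \<subseteq> swap_elem j i (X \<union> R)" using 1 ij by (auto simp: swap_elem_def)
        ultimately have sM: "swap_elem j i (X \<union> R) \<in> nsets M k" using memE by blast
        have "i \<notin> swap_elem j i (X \<union> R)" using ij by (auto simp: swap_elem_def)
        then have "swap_elem j i (X \<union> R) = M - {i}" using sub_nsets[OF sM jX(2)] by simp
        then have "T \<subseteq> R" using 1 unfolding T_def Y_def swap_elem_def by blast
        then show False using r by simp
      qed
    qed
    have lk: "X \<union> R \<in> \<F> \<longleftrightarrow> X \<union> R' \<in> \<F>" if "R \<in> \<R>" "R' \<in> \<R>" "R \<inter> R' = {}" for R R'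
    proof -
      have "(X \<union> R) \<inter> (X \<union> R') = X" using that by auto
      then show ?thesis using link ambR that X by simp
    qed
    have "X \<union> R \<in> \<F> \<longleftrightarrow> X \<union> R' \<in> \<F>" if "R \<in> \<R>" "R' \<in> \<R>" for R R'
      using disjoint_chain_constant[OF U T(1,2) _ lk \<R>_def that] k by simp
    then show ?thesis using amb1 by metis
  next
    case 2
    define U where "U = V - X - {j}"
    define \<R> where "\<R> = {R. R \<subseteq> U \<and> card R = \<kappa> \<and> R \<inter> Y \<noteq> {} \<and> \<not> Y \<subseteq> R}"
    have jX: "j \<notin> X" "i \<in> M" using 2 X by auto
    have "card U = card V - d - 1" unfolding U_def using V X M jX ij fin by (simp add: card_Diff_subset)
    then have U: "finite U" "3 * \<kappa> + 1 \<le> card U" using V n by (auto simp: U_def)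
    have T: "Y \<subseteq> U" "3 \<le> card Y" using 2 M cY k fin by (auto simp: U_def Y_def)
    have amb1: "(G - X \<in> \<R> \<and> G = X \<union> (G - X)) \<or> (\<exists>x\<in>X - {i}. G = M - {x})"
      if G: "G \<in> ambiguous i j ?E" for G
    proof -
      note g = ambD[OF G]
      show ?thesis
      proof (cases "X \<subseteq> G")
        case True
        have cr: "card (G - X) = \<kappa>" using True g X fin k by (simp add: card_Diff_subset)
        have "G \<inter> Y \<noteq> {}"
        proof
          assume "G \<inter> Y = {}"
          then have "G \<in> nsets M k" using g(1) memE by blast
          then have "G \<subseteq> M" by (simp add: nsets_def)
          then have "G - X = {}" using \<open>G \<inter> Y = {}\<close> unfolding Y_def by blast
          then show False using cr k by (metis card.empty not_numeral_le_zero)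
        qed
        moreover have "\<not> Y \<subseteq> G - X"
          using card_mono[of "G - X" Y] g cr cY by auto
        ultimately show ?thesis unfolding \<R>_def using g True cr by (auto simp: U_def Y_def)
      next
        case False
        then have "G \<in> nsets M k" using g memE by blast
        moreover obtain x where "x \<in> X" "x \<notin> G" using False by blast
        ultimately show ?thesis using sub_nsets[of G x] X g by blast
      qed
    qed
    have swn: "swap_elem j i A \<notin> ?E" if "i \<in> X" for A
      unfolding memE using that 2 ij by (auto simp: swap_elem_def nsets_def)
    have ambR: "X \<union> R \<in> ambiguous i j ?E" if R: "R \<in> \<R>" for R
    proof (rule ambI)
      have r: "R \<subseteq> V - X - {j}" "card R = \<kappa>" "R \<inter> Y \<noteq> {}" "finite R"
        using R U finite_subset unfolding \<R>_def U_def by auto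
      have "card (X \<union> R) = k" using r fin X k by (subst card_Un_disjoint) auto
      then show "X \<union> R \<in> ?E" unfolding memE using r fin X M by (auto simp: nsets_def)
      show "i \<in> X \<union> R" "j \<notin> X \<union> R" using 2 r jX by auto
    qed (use swn 2 in blast)
    have ambM: "M - {x} \<in> ambiguous i j ?E" if "x \<in> X - {i}" for x
      by (rule ambI) (use that 2 jX X Mx memE swn in auto)
    have lk: "X \<union> R \<in> \<F> \<longleftrightarrow> X \<union> R' \<in> \<F>" if "R \<in> \<R>" "R' \<in> \<R>" "R \<inter> R' = {}" for R R'
    proof -
      have "(X \<union> R) \<inter> (X \<union> R') = X" using that by auto
      then show ?thesis using link ambR that X by simp
    qed
    have RR: "X \<union> R \<in> \<F> \<longleftrightarrow> X \<union> R' \<in> \<F>" if "R \<in> \<R>" "R' \<in> \<R>" for R R'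
      using disjoint_chain_constant[OF U T _ lk \<R>_def that] k by simp
    have "Y \<noteq> {}" using cY by auto
    then obtain y where y: "y \<in> Y" by blast
    have "card (insert j M) + (\<kappa> - 1) \<le> card V" "insert j M \<subseteq> V" using M 2 fin k n ij by auto
    then obtain W where W: "W \<subseteq> V" "W \<inter> insert j M = {}" "card W = \<kappa> - 1" "finite W"
      using obtain_avoiding[OF V] by metis
    \<comment> \<open>With just one point \<open>y\<close> in \<open>Y\<close>, the set
      \<open>X \<union> R0\<close> meets \<open>M - {x}\<close> in \<open>X - {x}\<close> and
      \<open>y\<close>, which are \<open>d\<close> points.\<close>
    define R0 where "R0 = insert y W"
    have WY: "W \<inter> Y = {}" "y \<notin> W" "W \<inter> X = {}" using W y X by (auto simp: Y_def)
    have R0Y: "R0 \<inter> Y = {y}" using WY y by (auto simp: R0_def)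
    have "\<not> Y \<subseteq> R0"
    proof
      assume "Y \<subseteq> R0"
      then have "Y = {y}" using R0Y by blast
      then show False using T(2) by simp
    qed
    then have R0: "R0 \<in> \<R>" using W y T WY 2 k R0Y unfolding \<R>_def R0_def U_def by auto
    have M0: "M - {x} \<in> \<F> \<longleftrightarrow> X \<union> R0 \<in> \<F>" if x: "x \<in> X - {i}" for x
    proof (rule link[OF ambM[OF x] ambR[OF R0]])
      have "(M - {x}) \<inter> (X \<union> R0) = insert y (X - {x})"
        using X y W x unfolding R0_def Y_def by auto
      moreover have "y \<notin> X" using y by (simp add: Y_def)
      ultimately show "card ((M - {x}) \<inter> (X \<union> R0)) = d" using fin X x d by simp
    qed
    have "G \<in> \<F> \<longleftrightarrow> X \<union> R0 \<in> \<F>" if "G \<in> ambiguous i j ?E" for G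
      using amb1[OF that] RR[OF _ R0] M0 by metis
    then show ?thesis by blast
  next
    case 3
    have iM: "i \<in> M" "i \<notin> X" using 3 by (auto simp: Y_def)
    have amb1: "(X \<subseteq> G \<and> G \<inter> Y = {i}) \<or> (\<exists>x\<in>X. G = M - {x})" if G: "G \<in> ambiguous i j ?E" for G
    proof -
      note g = ambD[OF G]
      show ?thesis
      proof (cases "X \<subseteq> G")
        case True
        then have "X \<subseteq> swap_elem j i G" using iM by (auto simp: swap_elem_def)
        then have "swap_elem j i G \<inter> Y = {}" using g memE by blast
        then have "G \<inter> Y = {i}" using 3 g by (auto simp: swap_elem_def)
        then show ?thesis using True by simp
      next
        case False
        then have "G \<in> nsets M k" using g memE by blast
        moreover obtain x where "x \<in> X" "x \<notin> G" using False by blast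
        ultimately show ?thesis using sub_nsets[of G x] X g by blast
      qed
    qed
    have ambM: "M - {x} \<in> ambiguous i j ?E" if x: "x \<in> X" for x
    proof (rule ambI)
      show "M - {x} \<in> ?E" using memE Mx x X by blast
      show "i \<in> M - {x}" "j \<notin> M - {x}" using 3 iM x by auto
      have "\<not> X \<subseteq> swap_elem j i (M - {x})" using x X 3 by (auto simp: swap_elem_def)
      moreover have "swap_elem j i (M - {x}) \<notin> nsets M k" using 3 by (auto simp: swap_elem_def nsets_def)
      ultimately show "swap_elem j i (M - {x}) \<notin> ?E" using memE by blast
    qed
    have lk: "A \<in> \<F> \<longleftrightarrow> M - {x} \<in> \<F>" if A: "A \<in> ambiguous i j ?E" "X \<subseteq> A" "A \<inter> Y = {i}" "x \<in> X" for A x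
    proof (rule link[OF A(1) ambM[OF A(4)]])
      have "A \<inter> (M - {x}) = insert i (X - {x})" using A X unfolding Y_def by blast
      then show "card (A \<inter> (M - {x})) = d" using fin X A(4) iM d by simp
    qed
    have "card (insert j M) + (\<kappa> - 1) \<le> card V" "insert j M \<subseteq> V" using M 3 fin k n ij by auto
    then obtain W where W: "W \<subseteq> V" "W \<inter> insert j M = {}" "card W = \<kappa> - 1" "finite W"
      using obtain_avoiding[OF V] by metis
    define G0 where "G0 = X \<union> insert i W"
    have G0Y: "G0 \<inter> Y = {i}" "X \<subseteq> G0" using W 3 X unfolding G0_def Y_def by auto
    have G0a: "G0 \<in> ambiguous i j ?E"
    proof (rule ambI)
      have "i \<notin> W" "X \<inter> insert i W = {}" using W iM X by auto
      then have "card G0 = k" unfolding G0_def using fin W X k by (subst card_Un_disjoint) auto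
      then show "G0 \<in> ?E" unfolding memE using G0Y W X M iM fin by (auto simp: nsets_def G0_def)
      show "i \<in> G0" "j \<notin> G0" using 3 X W ij unfolding G0_def by auto
      have "swap_elem j i G0 \<inter> Y = {}" using G0Y 3 by (auto simp: swap_elem_def Y_def)
      moreover have "swap_elem j i G0 \<notin> nsets M k" using 3 by (auto simp: swap_elem_def nsets_def)
      ultimately show "swap_elem j i G0 \<notin> ?E" using memE by blast
    qed
    have "X \<noteq> {}" using X d by auto
    then obtain x0 where x0: "x0 \<in> X" by blast
    have "G \<in> \<F> \<longleftrightarrow> G0 \<in> \<F>" if G: "G \<in> ambiguous i j ?E" for G
      using amb1[OF G] lk[OF G] lk[OF G0a G0Y(2,1)] x0 by metis
    then show ?thesis by blast
  next
    case 4
    \<comment> \<open>In these positions the swap of a member of \<open>\<H>\<close> is again a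
      member of \<open>\<H>\<close>.\<close>
    have "G \<notin> ambiguous i j ?E" for G
    proof
      assume G: "G \<in> ambiguous i j ?E"
      note g = ambD[OF G]
      show False
      proof (cases "G \<in> nsets M k")
        case True
        then have "i \<in> M" using g(2) by (auto simp: nsets_def)
        then have "swap_elem j i G \<in> nsets M k" using swap_elem_nsets[OF True] 4 X g by (auto simp: Y_def)
        then show False using g memE by blast
      next
        case False
        then have "X \<subseteq> G" "G \<inter> Y \<noteq> {}" using g memE by blast+
        then have "X \<subseteq> swap_elem j i G" "swap_elem j i G \<inter> Y \<noteq> {}" using 4 g X by (auto simp: swap_elem_def Y_def)
        then show False using g memE by blast
      qed
    qed
    then show ?thesis by blast
  qed
  have "\<F> = ?E \<or> \<F> = (`) (id(i := j, j := i)) ` ?E"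
    using shift_dichotomy[OF ij(1) V F ij(2) E[symmetric]] const by blast
  then show ?thesis
  proof
    assume *: "\<F> = (`) (id(i := j, j := i)) ` ?E"
    let ?\<tau> = "id(i := j, j := i)"
    have inj: "inj_on ?\<tau> V" using ij by (auto simp: inj_on_def)
    have V': "?\<tau> ` V = V" using ij by (auto simp: image_iff)
    have "\<F> = fam_H V k d (?\<tau> ` X) (?\<tau> ` M)" using * image_fam_H[OF inj X(1) M(1)] V' by simp
    moreover have "?\<tau> ` M \<subseteq> V" "?\<tau> ` X \<subseteq> ?\<tau> ` M" using M X V' by blast+
    moreover have "card (?\<tau> ` M) = k + 1" "card (?\<tau> ` X) = d"
      using M X inj by (metis card_image inj_on_subset subset_trans)+
    ultimately show ?thesis by blast
  qed (use M X in blast)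
qed

section \<open>Sizes of the extremal families\<close>

lemma card_nsets_trace:
  assumes V: "finite V" and Z: "Z \<subseteq> V" and S: "S \<subseteq> Z" "card S \<le> k"
  shows "card {A \<in> nsets V k. A \<inter> Z = S} = (card V - card Z) choose (k - card S)"
proof -
  have fin: "finite Z" "finite S" using finite_subset[OF Z V] finite_subset[OF S(1)] by auto
  have "bij_betw (\<lambda>B. S \<union> B) (nsets (V - Z) (k - card S)) {A \<in> nsets V k. A \<inter> Z = S}"
  proof (rule bij_betw_byWitness[where f' = "\<lambda>A. A - Z"])
    show "\<forall>B\<in>nsets (V - Z) (k - card S). S \<union> B - Z = B" using S by (auto simp: nsets_def)
    show "\<forall>A\<in>{A \<in> nsets V k. A \<inter> Z = S}. S \<union> (A - Z) = A" by auto
    show "(\<lambda>B. S \<union> B) ` nsets (V - Z) (k - card S) \<subseteq> {A \<in> nsets V k. A \<inter> Z = S}"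
    proof (intro image_subsetI)
      fix B assume "B \<in> nsets (V - Z) (k - card S)"
      then have B: "B \<subseteq> V - Z" "finite B" "card B = k - card S" by (auto simp: nsets_def)
      have "card (S \<union> B) = k" using B fin S by (subst card_Un_disjoint) auto
      then show "S \<union> B \<in> {A \<in> nsets V k. A \<inter> Z = S}" using B fin S Z by (auto simp: nsets_def)
    qed
    show "(\<lambda>A. A - Z) ` {A \<in> nsets V k. A \<inter> Z = S} \<subseteq> nsets (V - Z) (k - card S)"
      using fin by (auto simp: nsets_def card_Diff_subset_Int)
  qed
  then have "card {A \<in> nsets V k. A \<inter> Z = S} = card (nsets (V - Z) (k - card S))"
    by (rule bij_betw_same_card[symmetric])
  also have "\<dots> = (card V - card Z) choose (k - card S)"
    using V Z fin by (simp add: card_nsets card_Diff_subset)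
  finally show ?thesis .
qed

text \<open>\<open>N\<close> is the number of points outside a \<open>d\<close>-set. The summand
  \<open>d\<close> counts the sets \<open>M - {x}\<close> with \<open>x \<in> X\<close>; the rest
  counts the sets that contain \<open>X\<close> and meet \<open>M - X\<close>.\<close>

definition size_H :: "nat \<Rightarrow> nat \<Rightarrow> nat \<Rightarrow> nat" where
  "size_H d \<kappa> N = (N choose \<kappa>) - ((N - \<kappa> - 1) choose \<kappa>) + d"

text \<open>Counted relative to \<open>d\<close> of the points of \<open>Z\<close>: sets containing
  these and one of the other two points, and sets missing exactly one of the \<open>d\<close>
  points. In this form the term \<open>N choose \<kappa>\<close> cancels in the comparison with
  \<open>size_H\<close>.\<close>

definition size_A :: "nat \<Rightarrow> nat \<Rightarrow> nat \<Rightarrow> nat" where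
  "size_A d \<kappa> N = (N choose \<kappa>) - ((N - 2) choose \<kappa>) + d * ((N - 2) choose (\<kappa> - 1))"

text \<open>The count by the trace on \<open>Z\<close>: all points but one, or all. In the case
  \<open>\<kappa> = 1\<close> truncated subtraction in \<open>\<kappa> - 2\<close> would count one
  set too many.\<close>

lemma size_A_eq:
  assumes "1 \<le> \<kappa>" "2 \<le> N"
  shows "size_A d \<kappa> N = (d + 2) * ((N - 2) choose (\<kappa> - 1)) + (if \<kappa> = 1 then 0 else (N - 2) choose (\<kappa> - 2))"
proof -
  obtain M where M: "N = M + 2" using assms by (metis add.commute le_Suc_ex)
  obtain q where q: "\<kappa> = Suc q" using assms by (cases \<kappa>) auto
  show ?thesis
  proof (cases q)
    case 0
    then show ?thesis using M q by (simp add: size_A_def)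
  next
    case (Suc q')
    have "(M + 2) choose Suc (Suc q') = (M choose q') + 2 * (M choose Suc q') + (M choose Suc (Suc q'))" by simp
    then show ?thesis using M q Suc by (simp add: size_A_def)
  qed
qed

lemma card_fam_A:
  assumes V: "finite V" and Z: "Z \<subseteq> V" "card Z = d + 2" and k: "k = d + \<kappa>" "1 \<le> \<kappa>"
    and N: "card V = d + N"
  shows "card (fam_A V k d Z) = size_A d \<kappa> N"
proof -
  have fZ: "finite Z" using finite_subset[OF Z(1) V] .
  have N2: "2 \<le> N" using card_mono[OF V Z(1)] Z N by simp
  define B where "B = {A \<in> nsets V k. A \<inter> Z = Z}"
  define Q where "Q z = {A \<in> nsets V k. A \<inter> Z = Z - {z}}" for z
  have "fam_A V k d Z = B \<union> (\<Union>z\<in>Z. Q z)"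
  proof (intro equalityI subsetI)
    fix A assume A: "A \<in> fam_A V k d Z"
    then have n: "A \<in> nsets V k" "d + 1 \<le> card (A \<inter> Z)" by (auto simp: fam_A_def)
    show "A \<in> B \<union> (\<Union>z\<in>Z. Q z)"
    proof (cases "Z \<subseteq> A")
      case False
      then obtain z where z: "z \<in> Z" "z \<notin> A" by blast
      then have "A \<inter> Z \<subseteq> Z - {z}" "card (Z - {z}) = d + 1" using Z fZ by auto
      then have "A \<inter> Z = Z - {z}" using n fZ card_seteq[of "Z - {z}" "A \<inter> Z"] by auto
      then show ?thesis using n z unfolding Q_def by blast
    qed (use n in \<open>auto simp: B_def\<close>)
  next
    fix A assume "A \<in> B \<union> (\<Union>z\<in>Z. Q z)"
    then show "A \<in> fam_A V k d Z" using Z fZ unfolding B_def Q_def fam_A_def by auto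
  qed
  moreover have "B \<inter> (\<Union>z\<in>Z. Q z) = {}" unfolding B_def Q_def by auto
  moreover have "finite B" "\<And>z. finite (Q z)" unfolding B_def Q_def using finite_nsets[OF V] by auto
  ultimately have "card (fam_A V k d Z) = card B + card (\<Union>z\<in>Z. Q z)"
    using fZ by (simp add: card_Un_disjoint)
  moreover have "card (\<Union>z\<in>Z. Q z) = (\<Sum>z\<in>Z. card (Q z))"
    by (rule card_UN_disjoint) (use fZ \<open>\<And>z. finite (Q z)\<close> in \<open>auto simp: Q_def\<close>)
  moreover have "card (Q z) = (N - 2) choose (\<kappa> - 1)" if "z \<in> Z" for z
    unfolding Q_def using card_nsets_trace[OF V Z(1), of "Z - {z}" k] that Z k N fZ by (simp add: Suc_diff_Suc)
  moreover have "card B = (if \<kappa> = 1 then 0 else (N - 2) choose (\<kappa> - 2))"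
  proof (cases "\<kappa> = 1")
    case True
    have "B = {}"
    proof (rule ccontr)
      assume "B \<noteq> {}"
      then obtain A where "A \<subseteq> V" "finite A" "card A = k" "Z \<subseteq> A" by (auto simp: B_def nsets_def)
      then show False using card_mono[of A Z] Z k True by simp
    qed
    then show ?thesis using True by simp
  next
    case False
    then show ?thesis unfolding B_def using card_nsets_trace[OF V Z(1), of Z k] Z k N by simp
  qed
  ultimately show ?thesis using size_A_eq[OF k(2) N2] Z by simp
qed

lemma card_fam_H:
  assumes V: "finite V" and M: "M \<subseteq> V" "card M = k + 1" and X: "X \<subseteq> M" "card X = d"
    and k: "k = d + \<kappa>" "1 \<le> \<kappa>" and N: "card V = d + N"
  shows "card (fam_H V k d X M) = size_H d \<kappa> N"
proof -
  have fin: "finite M" "finite X" using finite_subset[OF M(1) V] finite_subset[OF X(1)] by auto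
  define B where "B = {A \<in> nsets V k. A \<inter> X = X}"
  define C where "C = {A \<in> nsets V k. A \<inter> M = X}"
  define R where "R = (\<lambda>x. M - {x}) ` X"
  have "fam_H V k d X M = (B - C) \<union> R"
  proof (intro equalityI subsetI)
    fix A assume "A \<in> fam_H V k d X M"
    then consider "A \<in> nsets V k" "X \<subseteq> A" "A \<inter> (M - X) \<noteq> {}" | "A \<in> nsets M k"
      using mem_fam_H[OF fin(1) X] by blast
    then show "A \<in> (B - C) \<union> R"
    proof cases
      case 1
      then show ?thesis by (auto simp: B_def C_def)
    next
      case 2
      then have A: "A \<subseteq> M" "card A = k" "A \<in> nsets V k" using M by (auto simp: nsets_def)
      show ?thesis
      proof (cases "X \<subseteq> A")
        case True
        have "A \<noteq> X" using A X k by auto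
        then have "A \<inter> M \<noteq> X" using A by blast
        then show ?thesis using A True by (auto simp: B_def C_def)
      next
        case False
        then obtain x where x: "x \<in> X" "x \<notin> A" by blast
        then have "A \<subseteq> M - {x}" "card (M - {x}) = k" using A M X fin by auto
        then have "A = M - {x}" using card_subset_eq[of "M - {x}" A] fin A by simp
        then show ?thesis using x by (simp add: R_def)
      qed
    qed
  next
    fix A assume "A \<in> (B - C) \<union> R"
    then consider "A \<in> B" "A \<notin> C" | "A \<in> R" by blast
    then show "A \<in> fam_H V k d X M"
    proof cases
      case 1
      then have "A \<in> nsets V k" "X \<subseteq> A" "A \<inter> M \<noteq> X" by (auto simp: B_def C_def)
      then have "A \<inter> (M - X) \<noteq> {}" using X by blast
      then show ?thesis using mem_fam_H[OF fin(1) X] \<open>A \<in> nsets V k\<close> \<open>X \<subseteq> A\<close> by blast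
    next
      case 2
      then obtain x where "x \<in> X" "A = M - {x}" by (auto simp: R_def)
      then have "A \<in> nsets M k" using M X fin by (auto simp: nsets_def)
      then show ?thesis by (simp add: fam_H_def)
    qed
  qed
  moreover have "(B - C) \<inter> R = {}" using X by (auto simp: B_def R_def)
  moreover have fB: "finite B" "finite R" using finite_nsets[OF V] fin by (auto simp: B_def R_def)
  ultimately have "card (fam_H V k d X M) = card (B - C) + card R" by (simp add: card_Un_disjoint)
  moreover have "C \<subseteq> B" using X by (auto simp: B_def C_def)
  moreover have "card R = d"
    unfolding R_def using X by (subst card_image) (auto simp: inj_on_def)
  moreover have "card B = N choose \<kappa>"
    unfolding B_def using card_nsets_trace[OF V _ subset_refl, of X k] X M k N by auto
  moreover have "card C = (N - \<kappa> - 1) choose \<kappa>"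
    unfolding C_def using card_nsets_trace[OF V M(1) X(1), of k] X M k N by simp
  ultimately show ?thesis
    using fB finite_subset[of C B] by (simp add: size_H_def card_Diff_subset)
qed

section \<open>Initial segments as members of shifted families\<close>

lemma exists_initial: "finite W \<Longrightarrow> s \<le> card W \<Longrightarrow> \<exists>C. initial C W \<and> card C = s"
proof (induction s)
  case 0
  then show ?case by (intro exI[of _ "{}"]) (simp add: initial_def)
next
  case (Suc s)
  then obtain C where C: "initial C W" "card C = s" by auto
  then have CW: "C \<subseteq> W" "finite C" using Suc.prems finite_subset by (auto simp: initial_def)
  then have ne: "W - C \<noteq> {}" using Suc.prems C by auto
  define m where "m = Min (W - C)"
  have m: "m \<in> W - C" "\<And>w. w \<in> W - C \<Longrightarrow> m \<le> w"
    using ne Suc.prems by (simp_all add: m_def Min_in del: Diff_iff)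
  have "initial (insert m C) W"
    using C m unfolding initial_def by (auto simp: not_le[symmetric])
  then show ?case using m C CW by (intro exI[of _ "insert m C"]) auto
qed

text \<open>A member other than \<open>C\<close> contains some \<open>t\<close> outside
  \<open>C\<close> and lacks some \<open>c\<close> of \<open>C\<close>; as \<open>C\<close> is
  initial, \<open>c < t\<close>, and swapping them lowers the sum of the member.\<close>

lemma initial_mem_shifted:
  assumes sh: "shifted W \<G>" and sub: "\<And>T. T \<in> \<G> \<Longrightarrow> T \<subseteq> W \<and> finite T" and T: "T \<in> \<G>"
    and C: "initial C W" "card C = card T" "finite C"
  shows "C \<in> \<G>"
  using T C(2)
proof (induction "\<Sum>T" arbitrary: T rule: less_induct)
  case less
  have T: "T \<subseteq> W" "finite T" using sub less.prems by auto
  show ?case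
  proof (cases "T = C")
    case False
    have "\<not> T \<subseteq> C" using False card_subset_eq[OF C(3)] less.prems by metis
    then obtain t where t: "t \<in> T" "t \<notin> C" by blast
    have "\<not> C \<subseteq> T" using False card_subset_eq[OF T(2)] less.prems by metis
    then obtain c where c: "c \<in> C" "c \<notin> T" by blast
    have "c < t" using C(1) c t T unfolding initial_def by (metis linorder_neqE_nat subsetD)
    moreover have "c \<in> W" using C c by (auto simp: initial_def)
    ultimately have "swap_elem c t T \<in> \<G>" using shiftedD[OF sh less.prems(1)] t c T by blast
    moreover have "\<Sum>(swap_elem c t T) < \<Sum>T" using sum_swap_elem_less T \<open>c < t\<close> t c by blast
    moreover have "card C = card (swap_elem c t T)" using card_swap_elem T t c less.prems by simp
    ultimately show ?thesis using less.hyps by blast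
  qed (use less.prems in simp)
qed

section \<open>Compressed families\<close>

text \<open>The part of the structure that shifts can preserve. The last clause stands in for
  nontriviality. The clause on \<open>A \<inter> D\<close> follows from the triple condition while
  \<open>D\<close> is the intersection of two members, but those two members may be moved later, so
  it is recorded by itself.\<close>

definition admissible :: "nat set \<Rightarrow> nat set \<Rightarrow> nat \<Rightarrow> nat set set \<Rightarrow> bool" where
  "admissible V D k \<F> \<longleftrightarrow> \<F> \<subseteq> nsets V k \<and> inter2 (card D) \<F> \<and> inter3 (card D - 1) \<F> \<and>
     (\<forall>A\<in>\<F>. card D - 1 \<le> card (A \<inter> D)) \<and>
     (\<exists>x\<in>D. \<exists>y\<in>D. x \<noteq> y \<and> (\<exists>A\<in>\<F>. x \<notin> A) \<and> (\<exists>A\<in>\<F>. y \<notin> A))"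

text \<open>Containment in an extremal family rather than equality, which the maximal family
  obtained below yields directly; equality returns by counting. The alternative \<open>\<H>\<close>
  carries the condition \<open>d + 2 \<le> \<kappa>\<close> since part (ii) of the theorem must not
  produce it.\<close>

definition bounded_or_special :: "nat set \<Rightarrow> nat \<Rightarrow> nat \<Rightarrow> nat set set \<Rightarrow> bool" where
  "bounded_or_special V d \<kappa> \<F> \<longleftrightarrow>
     card \<F> < max (size_H d \<kappa> (card V - d)) (size_A d \<kappa> (card V - d)) \<or>
     (d + 2 \<le> \<kappa> \<and> (\<exists>X M. M \<subseteq> V \<and> card M = d + \<kappa> + 1 \<and> X \<subseteq> M \<and> card X = d \<and> \<F> \<subseteq> fam_H V (d + \<kappa>) d X M)) \<or>
     (\<exists>Z\<subseteq>V. card Z = d + 2 \<and> \<F> \<subseteq> fam_A V (d + \<kappa>) d Z)"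

text \<open>Condition \<open>D1\<close> excludes shifts that carry a point of \<open>D\<close> out
  of \<open>D\<close>, so traces on \<open>D\<close> do not shrink. That two points of
  \<open>D\<close> stay missed is not automatic and must be supplied.\<close>

lemma admissible_shift:
  assumes V: "finite V" and D: "D \<subseteq> V" and adm: "admissible V D k \<F>" and ij: "i \<noteq> j" "i \<in> V" "j \<in> V"
    and D1: "j \<in> D \<longrightarrow> i \<in> D"
    and missed: "\<exists>x\<in>D. \<exists>y\<in>D. x \<noteq> y \<and> (\<exists>A\<in>shift i j \<F>. x \<notin> A) \<and> (\<exists>A\<in>shift i j \<F>. y \<notin> A)"
  shows "admissible V D k (shift i j \<F>)"
proof -
  have F: "\<F> \<subseteq> nsets V k" "inter2 (card D) \<F>" "inter3 (card D - 1) \<F>"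
    and FD: "\<And>A. A \<in> \<F> \<Longrightarrow> card D - 1 \<le> card (A \<inter> D)" using adm by (auto simp: admissible_def)
  have fin: "finite A" if "A \<in> \<F>" for A using that F nsets_finite_mem by blast
  have fD: "finite D" using finite_subset[OF D V] .
  have "card D - 1 \<le> card (B \<inter> D)" if "B \<in> shift i j \<F>" for B
  proof -
    consider "B \<in> \<F>" | "i \<in> B" "j \<notin> B" "swap_elem j i B \<in> \<F>"
      using \<open>B \<in> shift i j \<F>\<close> mem_shift_iff[OF ij(1)] by blast
    then show ?thesis
    proof cases
      case 2
      have "card (swap_elem j i B \<inter> D) \<le> card (B \<inter> D)"
      proof (cases "j \<in> D")
        case True
        then have "B \<inter> D = swap_elem i j (swap_elem j i B \<inter> D)" using D1 2 ij by (auto simp: swap_elem_def)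
        moreover have "j \<in> swap_elem j i B \<inter> D" "i \<notin> swap_elem j i B \<inter> D" using True ij by (auto simp: swap_elem_def)
        ultimately show ?thesis using card_swap_elem[of "swap_elem j i B \<inter> D" j i] fD by simp
      next
        case False
        then show ?thesis using fD by (intro card_mono) (auto simp: swap_elem_def)
      qed
      then show ?thesis using FD[OF 2(3)] by simp
    qed (use FD in simp)
  qed
  then show ?thesis unfolding admissible_def
    using shift_subset_nsets[OF F(1) ij(2)] inter2_shift[OF ij(1) fin F(2)] inter3_shift[OF ij(1) fin F(3)] missed
    by blast
qed

text \<open>A shift adds no point other than \<open>i\<close>, so every other missed point remains
  missed.\<close>

lemma missed_shift:
  assumes "i \<noteq> j" "A \<in> \<F>" "x \<notin> A" "x \<noteq> i"
  shows "\<exists>B\<in>shift i j \<F>. x \<notin> B"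
proof (cases "j \<in> A \<and> i \<notin> A \<and> swap_elem i j A \<notin> \<F>")
  case True
  then have "swap_elem i j A \<in> shift i j \<F>" using assms(2) unfolding shift_def by (intro image_eqI[of _ _ A]) auto
  then show ?thesis using assms by (intro bexI[of _ "swap_elem i j A"]) (auto simp: swap_elem_def)
next
  case False
  then have "A \<in> shift i j \<F>" using assms(2) unfolding shift_def by (intro image_eqI[of _ _ A]) auto
  then show ?thesis using assms by blast
qed

lemma fixed_by_shift:
  assumes "A \<in> \<F>" "j \<in> A \<Longrightarrow> i \<notin> A \<Longrightarrow> swap_elem i j A \<in> \<F>"
  shows "A \<in> shift i j \<F>"
  unfolding shift_def by (rule image_eqI[OF _ assms(1)], simp, use assms(2) in blast)

text \<open>A maximal counterexample, compressed as far as possible.\<close>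

locale compressed =
  fixes V D :: "nat set" and k \<kappa> d :: nat and \<F> :: "nat set set"
  assumes V: "finite V" and DV: "D \<subseteq> V" and cD: "card D = d" and d2: "2 \<le> d"
    and low: "\<And>x c. x \<in> D \<Longrightarrow> c \<in> V - D \<Longrightarrow> x < c"
    and k: "k = d + \<kappa>" and \<kappa>: "1 \<le> \<kappa>" and n: "d + (d + 1) * \<kappa> + 2 \<le> card V"
    and adm: "admissible V D k \<F>"
    and st: "\<And>i j. i \<in> V \<Longrightarrow> j \<in> V \<Longrightarrow> i < j \<Longrightarrow> admissible V D k (shift i j \<F>) \<Longrightarrow> stable i j \<F>"
    and mx: "\<And>A. A \<in> nsets V k \<Longrightarrow> admissible V D k (insert A \<F>) \<Longrightarrow> A \<in> \<F>"
begin

section \<open>Traces of a compressed family outside \<open>D\<close>\<close>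

definition "W = V - D"
definition "N = card W"
text \<open>These traces determine the family: every member contains \<open>D\<close> or misses
  exactly one point of it. The sizes \<open>\<kappa> + 1\<close> and \<open>\<kappa>\<close> of
  their elements are consequences.\<close>

definition "tr x = {T. T \<subseteq> W \<and> (D - {x}) \<union> T \<in> \<F>}"
definition "tr0 = {S. S \<subseteq> W \<and> D \<union> S \<in> \<F>}"

lemma fD: "finite D" using finite_subset[OF DV V] .
lemma fW: "finite W" using V by (simp add: W_def)
lemma DW: "D \<inter> W = {}" by (auto simp: W_def)
lemma cW: "card V = d + N" using V DV fD cD card_mono[OF V DV] by (simp add: N_def W_def card_Diff_subset)
lemma N_ge: "(d + 1) * \<kappa> + 2 \<le> N" using n cW by simp
lemma N_ge3: "3 * \<kappa> + 2 \<le> N" using N_ge mult_le_mono1[of 3 "d + 1" \<kappa>] d2 by linarith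

lemma lowW: "x \<in> D \<Longrightarrow> c \<in> W \<Longrightarrow> x < c" using low by (simp add: W_def)

lemma F: "\<F> \<subseteq> nsets V k" "inter2 d \<F>" "inter3 (d - 1) \<F>"
  and FD: "A \<in> \<F> \<Longrightarrow> d - 1 \<le> card (A \<inter> D)"
  and px: "\<exists>x\<in>D. \<exists>y\<in>D. x \<noteq> y \<and> (\<exists>A\<in>\<F>. x \<notin> A) \<and> (\<exists>A\<in>\<F>. y \<notin> A)"
  using adm by (auto simp: admissible_def cD)

lemma mem: "A \<in> \<F> \<Longrightarrow> A \<subseteq> V \<and> finite A \<and> card A = k"
  using F(1) by (auto simp: nsets_def)

lemma decompose:
  assumes A: "A \<in> \<F>"
  shows "(D \<subseteq> A \<and> A = D \<union> (A \<inter> W) \<and> A \<inter> W \<in> tr0) \<or>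
    (\<exists>x\<in>D. x \<notin> A \<and> A = (D - {x}) \<union> (A \<inter> W) \<and> A \<inter> W \<in> tr x)"
proof (cases "D \<subseteq> A")
  case True
  then have "A = D \<union> (A \<inter> W)" using mem[OF A] by (auto simp: W_def)
  then show ?thesis using A True by (simp add: tr0_def)
next
  case False
  then obtain x where x: "x \<in> D" "x \<notin> A" by blast
  have "A \<inter> D = D - {x}"
  proof (rule card_seteq)
    show "card (D - {x}) \<le> card (A \<inter> D)" using FD[OF A] x fD cD by simp
  qed (use x fD in auto)
  then have "A = (D - {x}) \<union> (A \<inter> W)" using mem[OF A] by (auto simp: W_def)
  then show ?thesis using A x by (auto simp: tr_def)
qed

lemma trD: assumes "T \<in> tr x" "x \<in> D"
  shows "T \<subseteq> W" "finite T" "card T = \<kappa> + 1" "(D - {x}) \<union> T \<in> \<F>" "x \<notin> (D - {x}) \<union> T"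
proof -
  show t: "T \<subseteq> W" "(D - {x}) \<union> T \<in> \<F>" using assms by (auto simp: tr_def)
  then show f: "finite T" using fW finite_subset by blast
  have "card ((D - {x}) \<union> T) = k" using mem t by blast
  moreover have "card ((D - {x}) \<union> T) = (d - 1) + card T"
    using f fD t DW assms cD by (subst card_Un_disjoint) auto
  ultimately show "card T = \<kappa> + 1" using k d2 by simp
  show "x \<notin> (D - {x}) \<union> T" using assms t DW by auto
qed

lemma tr0D: assumes "S \<in> tr0"
  shows "S \<subseteq> W" "finite S" "card S = \<kappa>" "D \<union> S \<in> \<F>"
proof -
  show t: "S \<subseteq> W" "D \<union> S \<in> \<F>" using assms by (auto simp: tr0_def)
  then show f: "finite S" using fW finite_subset by blast
  have "card (D \<union> S) = k" using mem t by blast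
  moreover have "card (D \<union> S) = d + card S"
    using f fD t DW cD by (subst card_Un_disjoint) auto
  ultimately show "card S = \<kappa>" using k by simp
qed

lemma trI: "T \<subseteq> W \<Longrightarrow> (D - {x}) \<union> T \<in> \<F> \<Longrightarrow> T \<in> tr x" by (simp add: tr_def)

lemma two_nonempty_traces: "\<exists>x\<in>D. \<exists>y\<in>D. x < y \<and> tr x \<noteq> {} \<and> tr y \<noteq> {}"
proof -
  have t: "tr x \<noteq> {}" if xA: "x \<in> D" "A \<in> \<F>" "x \<notin> A" for x A
  proof -
    obtain x' where x': "x' \<in> D" "x' \<notin> A" "A = (D - {x'}) \<union> (A \<inter> W)" "A \<inter> W \<in> tr x'"
      using decompose[OF xA(2)] xA by blast
    then have "x = x'" using xA by blast
    then show ?thesis using x' by blast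
  qed
  obtain x y where "x \<in> D" "y \<in> D" "x \<noteq> y" "tr x \<noteq> {}" "tr y \<noteq> {}" using px t by metis
  then show ?thesis by (metis linorder_neqE_nat)
qed

lemma card_parts:
  assumes "B \<subseteq> D" "P \<subseteq> W" "finite P"
  shows "card (B \<union> P) = card B + card P"
proof -
  have "finite B" "B \<inter> P = {}" using assms fD DW finite_subset by blast+
  then show ?thesis using assms(3) card_Un_disjoint by blast
qed

text \<open>The pattern of this and the following five lemmas: every point of \<open>D\<close>
  missed by one of the sets is lost in the intersection, and what remains of \<open>D\<close> falls
  short of \<open>d\<close> for pairs, or of \<open>d - 1\<close> for triples; the shortfall is made
  up in \<open>W\<close>.\<close>

lemma distinct_traces_meet_twice: assumes "T \<in> tr x" "T' \<in> tr y" "x \<in> D" "y \<in> D" "x \<noteq> y" shows "2 \<le> card (T \<inter> T')"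
proof -
  note a = trD[OF assms(1,3)] and b = trD[OF assms(2,4)]
  have "d \<le> card (((D - {x}) \<union> T) \<inter> ((D - {y}) \<union> T'))" using inter2D[OF F(2) a(4) b(4)] .
  also have "((D - {x}) \<union> T) \<inter> ((D - {y}) \<union> T') = (D - {x, y}) \<union> (T \<inter> T')" using a b DW by auto
  also have "card \<dots> = card (D - {x, y}) + card (T \<inter> T')" using a by (intro card_parts) auto
  also have "card (D - {x, y}) = d - 2" using assms fD cD by (simp add: card_Diff_subset)
  finally show ?thesis using d2 by simp
qed

lemma same_trace_meets: assumes "T \<in> tr x" "T' \<in> tr x" "x \<in> D" shows "1 \<le> card (T \<inter> T')"
proof -
  note a = trD[OF assms(1,3)] and b = trD[OF assms(2,3)]
  have "d \<le> card (((D - {x}) \<union> T) \<inter> ((D - {x}) \<union> T'))" using inter2D[OF F(2) a(4) b(4)] .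
  also have "((D - {x}) \<union> T) \<inter> ((D - {x}) \<union> T') = (D - {x}) \<union> (T \<inter> T')" using a b DW by auto
  also have "card \<dots> = card (D - {x}) + card (T \<inter> T')" using a by (intro card_parts) auto
  also have "card (D - {x}) = d - 1" using assms fD cD by simp
  finally show ?thesis using d2 by simp
qed

lemma tr0_meets_tr: assumes "S \<in> tr0" "T \<in> tr x" "x \<in> D" shows "1 \<le> card (S \<inter> T)"
proof -
  note a = tr0D[OF assms(1)] and b = trD[OF assms(2,3)]
  have "d \<le> card ((D \<union> S) \<inter> ((D - {x}) \<union> T))" using inter2D[OF F(2) a(4) b(4)] .
  also have "(D \<union> S) \<inter> ((D - {x}) \<union> T) = (D - {x}) \<union> (S \<inter> T)" using a b DW by auto
  also have "card \<dots> = card (D - {x}) + card (S \<inter> T)" using a by (intro card_parts) auto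
  also have "card (D - {x}) = d - 1" using assms fD cD by simp
  finally show ?thesis using d2 by simp
qed

lemma tr0_meets_two_traces: assumes "S \<in> tr0" "T \<in> tr x" "T' \<in> tr y" "x \<in> D" "y \<in> D" "x \<noteq> y"
  shows "1 \<le> card (S \<inter> T \<inter> T')"
proof -
  note s = tr0D[OF assms(1)] and a = trD[OF assms(2,4)] and b = trD[OF assms(3,5)]
  have "d - 1 \<le> card ((D \<union> S) \<inter> ((D - {x}) \<union> T) \<inter> ((D - {y}) \<union> T'))" using inter3D[OF F(3) s(4) a(4) b(4)] .
  also have "(D \<union> S) \<inter> ((D - {x}) \<union> T) \<inter> ((D - {y}) \<union> T') = (D - {x, y}) \<union> (S \<inter> T \<inter> T')" using s a b DW by auto
  also have "card \<dots> = card (D - {x, y}) + card (S \<inter> T \<inter> T')" using s by (intro card_parts) auto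
  also have "card (D - {x, y}) = d - 2" using assms fD cD by (simp add: card_Diff_subset)
  finally show ?thesis using d2 by simp
qed

lemma same_traces_meet: assumes "T \<in> tr x" "T1 \<in> tr x" "T' \<in> tr y" "x \<in> D" "y \<in> D" "x \<noteq> y"
  shows "1 \<le> card (T \<inter> T1 \<inter> T')"
proof -
  note s = trD[OF assms(1,4)] and a = trD[OF assms(2,4)] and b = trD[OF assms(3,5)]
  have "d - 1 \<le> card (((D - {x}) \<union> T) \<inter> ((D - {x}) \<union> T1) \<inter> ((D - {y}) \<union> T'))" using inter3D[OF F(3) s(4) a(4) b(4)] .
  also have "((D - {x}) \<union> T) \<inter> ((D - {x}) \<union> T1) \<inter> ((D - {y}) \<union> T') = (D - {x, y}) \<union> (T \<inter> T1 \<inter> T')" using s a b DW by auto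
  also have "card \<dots> = card (D - {x, y}) + card (T \<inter> T1 \<inter> T')" using s by (intro card_parts) auto
  also have "card (D - {x, y}) = d - 2" using assms fD cD by (simp add: card_Diff_subset)
  finally show ?thesis using d2 by simp
qed

lemma three_traces_meet_twice: assumes "T \<in> tr x" "T' \<in> tr y" "T'' \<in> tr z" "x \<in> D" "y \<in> D" "z \<in> D" "x \<noteq> y" "x \<noteq> z" "y \<noteq> z"
  shows "2 \<le> card (T \<inter> T' \<inter> T'')"
proof -
  note s = trD[OF assms(1,4)] and a = trD[OF assms(2,5)] and b = trD[OF assms(3,6)]
  have "d - 1 \<le> card (((D - {x}) \<union> T) \<inter> ((D - {y}) \<union> T') \<inter> ((D - {z}) \<union> T''))" using inter3D[OF F(3) s(4) a(4) b(4)] .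
  also have "((D - {x}) \<union> T) \<inter> ((D - {y}) \<union> T') \<inter> ((D - {z}) \<union> T'') = (D - {x, y, z}) \<union> (T \<inter> T' \<inter> T'')"
    using s a b DW by auto
  also have "card \<dots> = card (D - {x, y, z}) + card (T \<inter> T' \<inter> T'')" using s by (intro card_parts) auto
  also have "card (D - {x, y, z}) = d - 3" using assms fD cD by (simp add: card_Diff_subset)
  finally have "d - 1 \<le> d - 3 + card (T \<inter> T' \<inter> T'')" .
  moreover have "3 \<le> d" using assms card_mono[OF fD, of "{x, y, z}"] cD by simp
  ultimately show ?thesis by linarith
qed

text \<open>Sets containing \<open>D\<close> interact only with pairs of members of distinct traces.\<close>

lemma tr0_maximal:
  assumes S: "S \<subseteq> W" "card S = \<kappa>"
    and one: "\<And>x T. x \<in> D \<Longrightarrow> T \<in> tr x \<Longrightarrow> S \<inter> T \<noteq> {}"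
    and two: "\<And>x y T T'. x \<in> D \<Longrightarrow> y \<in> D \<Longrightarrow> x \<noteq> y \<Longrightarrow> T \<in> tr x \<Longrightarrow> T' \<in> tr y \<Longrightarrow> S \<inter> T \<inter> T' \<noteq> {}"
  shows "S \<in> tr0"
proof -
  let ?B = "D \<union> S"
  have fS: "finite S" using S fW finite_subset by blast
  have cB: "card ?B = k" using card_parts[OF subset_refl S(1) fS] S cD k by simp
  have B: "?B \<in> nsets V k" using cB fD fS S DV by (auto simp: nsets_def W_def)
  have DA: "d - 1 \<le> card (A \<inter> C)" if "A \<in> \<F>" "D \<subseteq> C" "finite C" for A C
  proof -
    have "card (A \<inter> D) \<le> card (A \<inter> C)" using that by (intro card_mono) auto
    then show ?thesis using FD[OF that(1)] by simp
  qed
  have 2: "d \<le> card (A \<inter> ?B)" if A: "A \<in> \<F>" for A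
    using decompose[OF A]
  proof (elim disjE conjE bexE)
    assume "D \<subseteq> A"
    then have "card D \<le> card (A \<inter> ?B)" using fD fS by (intro card_mono) auto
    then show ?thesis using cD by simp
  next
    fix x assume x: "x \<in> D" "A = D - {x} \<union> (A \<inter> W)" "A \<inter> W \<in> tr x"
    have ne: "S \<inter> (A \<inter> W) \<noteq> {}" using one x by blast
    have "(D - {x}) \<union> (S \<inter> (A \<inter> W)) \<subseteq> A \<inter> ?B" using x(2) by blast
    then have "card ((D - {x}) \<union> (S \<inter> (A \<inter> W))) \<le> card (A \<inter> ?B)" using fD fS by (intro card_mono) auto
    moreover have "card ((D - {x}) \<union> (S \<inter> (A \<inter> W))) = card (D - {x}) + card (S \<inter> (A \<inter> W))"
      using S fS by (intro card_parts) auto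
    moreover have "1 \<le> card (S \<inter> (A \<inter> W))" using ne fS by (simp add: Suc_le_eq card_gt_0_iff)
    moreover have "card (D - {x}) = d - 1" using x fD cD by simp
    ultimately show ?thesis using d2 by simp
  qed
  have 3: "d - 1 \<le> card (A \<inter> A' \<inter> ?B)" if A: "A \<in> \<F>" "A' \<in> \<F>" for A A'
  proof (cases "D \<subseteq> A \<or> D \<subseteq> A'")
    case True
    then have "d - 1 \<le> card (A \<inter> D) \<and> A \<inter> D \<subseteq> A \<inter> A' \<inter> ?B \<or> d - 1 \<le> card (A' \<inter> D) \<and> A' \<inter> D \<subseteq> A \<inter> A' \<inter> ?B"
      using FD A by blast
    then show ?thesis using mem[OF A(1)] by (meson card_mono finite_Int le_trans)
  next
    case False
    obtain x where x: "x \<in> D" "x \<notin> A" "A = D - {x} \<union> (A \<inter> W)" "A \<inter> W \<in> tr x"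
      using decompose[OF A(1)] False by blast
    obtain y where y: "y \<in> D" "y \<notin> A'" "A' = D - {y} \<union> (A' \<inter> W)" "A' \<inter> W \<in> tr y"
      using decompose[OF A(2)] False by blast
    show ?thesis
    proof (cases "x = y")
      case True
      then have "D - {x} \<subseteq> A \<inter> A' \<inter> ?B" using x(3) y(3) by blast
      then have "card (D - {x}) \<le> card (A \<inter> A' \<inter> ?B)" using mem[OF A(1)] by (intro card_mono) auto
      then show ?thesis using x fD cD by simp
    next
      case False
      have ne: "S \<inter> (A \<inter> W) \<inter> (A' \<inter> W) \<noteq> {}" using two[OF x(1) y(1) False x(4) y(4)] .
      have "(D - {x, y}) \<union> (S \<inter> (A \<inter> W) \<inter> (A' \<inter> W)) \<subseteq> A \<inter> A' \<inter> ?B" using x(3) y(3) by blast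
      then have "card ((D - {x, y}) \<union> (S \<inter> (A \<inter> W) \<inter> (A' \<inter> W))) \<le> card (A \<inter> A' \<inter> ?B)"
        using mem[OF A(1)] by (intro card_mono) auto
      moreover have "card ((D - {x, y}) \<union> (S \<inter> (A \<inter> W) \<inter> (A' \<inter> W))) = card (D - {x, y}) + card (S \<inter> (A \<inter> W) \<inter> (A' \<inter> W))"
        using S fS by (intro card_parts) auto
      moreover have "1 \<le> card (S \<inter> (A \<inter> W) \<inter> (A' \<inter> W))" using ne fS by (simp add: Suc_le_eq card_gt_0_iff)
      moreover have "card (D - {x, y}) = d - 2" using x y False fD cD by (simp add: card_Diff_subset)
      ultimately show ?thesis using d2 by simp
    qed
  qed
  have kd: "d \<le> card ?B" using cB k by simp
  have i2: "inter2 (card D) (insert ?B \<F>)"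
    unfolding inter2_def cD
  proof (intro ballI)
    fix A A' assume "A \<in> insert ?B \<F>" "A' \<in> insert ?B \<F>"
    then show "d \<le> card (A \<inter> A')" using 2 kd F(2) by (auto simp: inter2_def Int_commute)
  qed
  have with_B: "d - 1 \<le> card (A \<inter> A' \<inter> ?B)" if A: "A \<in> insert ?B \<F>" "A' \<in> insert ?B \<F>" for A A'
  proof (cases "A = ?B \<or> A' = ?B")
    case True
    then have "A \<inter> A' \<inter> ?B = A' \<inter> ?B \<or> A \<inter> A' \<inter> ?B = A \<inter> ?B" by blast
    moreover have "d \<le> card (A \<inter> ?B)" "d \<le> card (A' \<inter> ?B)"
      using inter2D[OF i2 A(1) insertI1] inter2D[OF i2 A(2) insertI1] cD by simp_all
    ultimately show ?thesis by auto
  qed (use 3 A in blast)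
  have i3: "inter3 (card D - 1) (insert ?B \<F>)"
    unfolding inter3_def cD
  proof (intro ballI)
    fix A A' A'' assume a: "A \<in> insert ?B \<F>" "A' \<in> insert ?B \<F>" "A'' \<in> insert ?B \<F>"
    consider "A = ?B" | "A' = ?B" | "A'' = ?B" | "A \<in> \<F>" "A' \<in> \<F>" "A'' \<in> \<F>" using a by blast
    then show "d - 1 \<le> card (A \<inter> A' \<inter> A'')"
    proof cases
      case 1
      then show ?thesis using with_B[OF a(2,3)] by (simp only: Int_ac)
    next
      case 2
      then show ?thesis using with_B[OF a(1,3)] by (simp only: Int_ac)
    next
      case 3
      then show ?thesis using with_B[OF a(1,2)] by simp
    next
      case 4
      then show ?thesis by (rule inter3D[OF F(3)])
    qed
  qed
  have "admissible V D k (insert ?B \<F>)"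
    unfolding admissible_def using F(1) B i2 i3 FD px cD DA[OF _ subset_refl fD] by (auto simp: Int_absorb1)
  then have "?B \<in> \<F>" using mx B by blast
  then show ?thesis using S by (simp add: tr0_def)
qed

section \<open>Shifts under which a compressed family is stable\<close>

lemma stable_outside: assumes "i \<in> W" "j \<in> W" "i < j" shows "stable i j \<F>"
proof -
  have ij: "i \<in> V" "j \<in> V" "i \<notin> D" "j \<notin> D" using assms by (auto simp: W_def)
  obtain y z A B where yz: "y \<in> D" "z \<in> D" "y \<noteq> z" "A \<in> \<F>" "y \<notin> A" "B \<in> \<F>" "z \<notin> B" using px by blast
  have "\<exists>A\<in>shift i j \<F>. y \<notin> A" "\<exists>A\<in>shift i j \<F>. z \<notin> A"
    using missed_shift[of i j A \<F> y] missed_shift[of i j B \<F> z] yz ij assms by blast+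
  then have "admissible V D k (shift i j \<F>)"
    using admissible_shift[OF V DV adm _ ij(1,2)] yz ij assms by blast
  then show ?thesis using st ij assms by blast
qed

lemma tr_shifted: assumes x: "x \<in> D" shows "shifted W (tr x)"
  unfolding shifted_def stable_def
proof (intro ballI impI)
  fix i j T assume h: "i \<in> W" "j \<in> W" "i < j" "T \<in> tr x" "j \<in> T \<and> i \<notin> T"
  have ij: "i \<notin> D" "j \<notin> D" using h by (auto simp: W_def)
  note t = trD[OF h(4) x]
  have "swap_elem i j ((D - {x}) \<union> T) \<in> \<F>"
    using stableD[OF stable_outside[OF h(1-3)] t(4)] h ij by blast
  moreover have "swap_elem i j ((D - {x}) \<union> T) = (D - {x}) \<union> swap_elem i j T" using ij by (auto simp: swap_elem_def)
  moreover have "swap_elem i j T \<subseteq> W" using h t by (auto simp: swap_elem_def)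
  ultimately show "swap_elem i j T \<in> tr x" by (simp add: tr_def)
qed

lemma tr0_shifted: "shifted W tr0"
  unfolding shifted_def stable_def
proof (intro ballI impI)
  fix i j S assume h: "i \<in> W" "j \<in> W" "i < j" "S \<in> tr0" "j \<in> S \<and> i \<notin> S"
  have ij: "i \<notin> D" "j \<notin> D" using h by (auto simp: W_def)
  note t = tr0D[OF h(4)]
  have "swap_elem i j (D \<union> S) \<in> \<F>"
    using stableD[OF stable_outside[OF h(1-3)] t(4)] h ij by blast
  moreover have "swap_elem i j (D \<union> S) = D \<union> swap_elem i j S" using ij by (auto simp: swap_elem_def)
  moreover have "swap_elem i j S \<subseteq> W" using h t by (auto simp: swap_elem_def)
  ultimately show "swap_elem i j S \<in> tr0" by (simp add: tr0_def)
qed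

text \<open>A common witness: every nonempty trace \<open>tr x\<close> is shifted and therefore
  contains this segment.\<close>

definition "I0 = (SOME C. initial C W \<and> card C = \<kappa> + 1)"

lemma I0: "initial I0 W" "card I0 = \<kappa> + 1" "I0 \<subseteq> W" "finite I0"
proof -
  have "\<kappa> + 1 \<le> card W" using N_ge3 by (simp add: N_def)
  then have "initial I0 W \<and> card I0 = \<kappa> + 1"
    unfolding I0_def by (rule someI_ex[OF exists_initial[OF fW]])
  then show "initial I0 W" "card I0 = \<kappa> + 1" by auto
  then show "I0 \<subseteq> W" "finite I0" using fW finite_subset by (auto simp: initial_def)
qed

lemma I0_mem: assumes "x \<in> D" "tr x \<noteq> {}" shows "I0 \<in> tr x"
proof -
  obtain T where T: "T \<in> tr x" using assms by blast
  show ?thesis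
    by (rule initial_mem_shifted[OF tr_shifted[OF assms(1)] _ T I0(1) _ I0(4)])
      (use trD[OF _ assms(1)] T I0 in auto)
qed

text \<open>The danger is that \<open>x\<close> is no longer missed after the shift. If
  \<open>y\<close> is missed too, \<open>I0\<close> is in both traces and
  \<open>(D - {x}) \<union> I0\<close> stays because its swap is present. If \<open>y\<close> is not
  missed, that set moves and now misses \<open>y\<close>, which takes the place of
  \<open>x\<close>.\<close>

lemma stable_inside: assumes "x \<in> D" "y \<in> D" "x < y" shows "stable x y \<F>"
proof (cases "tr x = {}")
  case True
  have "x \<in> A" if A: "A \<in> \<F>" "y \<in> A" for A
  proof (rule ccontr)
    assume "x \<notin> A"
    then obtain x' where "x' \<in> D" "x' \<notin> A" "A = (D - {x'}) \<union> (A \<inter> W)" "A \<inter> W \<in> tr x'"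
      using decompose[OF A(1)] assms by blast
    then show False using True \<open>x \<notin> A\<close> assms by (metis Diff_iff UnI1 empty_iff singletonD)
  qed
  then show ?thesis by (auto simp: stable_def)
next
  case False
  have xy: "x \<in> V" "y \<in> V" using assms DV by auto
  obtain u v where uv: "u \<in> D" "v \<in> D" "u < v" "tr u \<noteq> {}" "tr v \<noteq> {}" using two_nonempty_traces by blast
  have keep: "\<exists>A\<in>shift x y \<F>. z \<notin> A" if z: "z \<in> D" "tr z \<noteq> {}" "z \<noteq> x" for z
  proof -
    note t = trD[OF I0_mem[OF z(1,2)] z(1)]
    show ?thesis by (rule missed_shift[OF _ t(4,5)]) (use assms z in auto)
  qed
  have movedy: "\<exists>A\<in>shift x y \<F>. y \<notin> A" if "tr y = {}"
  proof -
    note t = trD[OF I0_mem[OF assms(1) False] assms(1)]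
    let ?A = "(D - {x}) \<union> I0"
    have sw: "swap_elem x y ?A = (D - {y}) \<union> I0" using assms t DW by (auto simp: swap_elem_def)
    have "swap_elem x y ?A \<notin> \<F>"
    proof
      assume "swap_elem x y ?A \<in> \<F>"
      then have "I0 \<in> tr y" using sw trI I0 by simp
      then show False using that by blast
    qed
    then have "swap_elem x y ?A \<in> shift x y \<F>"
      using t assms unfolding shift_def by (intro image_eqI[of _ _ ?A]) auto
    moreover have "y \<notin> swap_elem x y ?A" using sw assms DW I0 by auto
    ultimately show ?thesis by blast
  qed
  have "\<exists>a\<in>D. \<exists>b\<in>D. a \<noteq> b \<and> (\<exists>A\<in>shift x y \<F>. a \<notin> A) \<and> (\<exists>A\<in>shift x y \<F>. b \<notin> A)"
  proof (cases "tr y = {}")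
    case True
    obtain w where w: "w \<in> D" "tr w \<noteq> {}" "w \<noteq> x" using uv by (metis less_irrefl)
    then have "w \<noteq> y" using True by blast
    then show ?thesis using movedy[OF True] keep[OF w] w assms by blast
  next
    case ne: False
    note t = trD[OF I0_mem[OF assms(1) False] assms(1)]
    have "(D - {x}) \<union> I0 \<in> shift x y \<F>"
    proof (rule fixed_by_shift[OF t(4)])
      have "swap_elem x y ((D - {x}) \<union> I0) = (D - {y}) \<union> I0" using assms t DW by (auto simp: swap_elem_def)
      then show "swap_elem x y ((D - {x}) \<union> I0) \<in> \<F>" using trD(4)[OF I0_mem[OF assms(2) ne] assms(2)] by simp
    qed
    then have "\<exists>A\<in>shift x y \<F>. x \<notin> A" using t(5) by (rule bexI[rotated])
    moreover have "\<exists>A\<in>shift x y \<F>. y \<notin> A" using keep[OF assms(2) ne] assms(3) by simp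
    moreover have "x \<noteq> y" using assms(3) by simp
    ultimately show ?thesis using assms(1,2) by (intro bexI[of _ x] bexI[of _ y] conjI)
  qed
  then have "admissible V D k (shift x y \<F>)"
    by (intro admissible_shift[OF V DV adm _ xy]) (use assms in auto)
  then show ?thesis using st xy assms by blast
qed

lemma tr_mono: assumes "x \<in> D" "y \<in> D" "x < y" shows "tr x \<subseteq> tr y"
proof
  fix T assume T: "T \<in> tr x"
  note t = trD[OF T assms(1)]
  have "swap_elem x y ((D - {x}) \<union> T) \<in> \<F>"
    using stableD[OF stable_inside[OF assms] t(4)] t(5) assms by blast
  moreover have "swap_elem x y ((D - {x}) \<union> T) = (D - {y}) \<union> T" using assms t DW by (auto simp: swap_elem_def)
  ultimately show "T \<in> tr y" using t by (simp add: tr_def)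
qed

text \<open>If the shift from \<open>c\<close> to \<open>x\<close> keeps some set missing \<open>x\<close>, it keeps the family admissible.\<close>

lemma stable_across:
  assumes x: "x \<in> D" and c: "c \<in> W" and T: "T \<in> tr x" "c \<in> T \<Longrightarrow> T - {c} \<in> tr0"
  shows "stable x c \<F>"
proof -
  have xc: "x \<in> V" "c \<in> V" "x < c" "c \<notin> D" using x c DV lowW by (auto simp: W_def)
  obtain y where y: "y \<in> D" "y \<noteq> x" "tr y \<noteq> {}" using two_nonempty_traces by (metis less_irrefl)
  note t = trD[OF T(1) x]
  have "(D - {x}) \<union> T \<in> shift x c \<F>"
  proof (rule fixed_by_shift[OF t(4)])
    assume "c \<in> (D - {x}) \<union> T"
    then have "c \<in> T" using xc by blast
    then have "D \<union> (T - {c}) \<in> \<F>" using T(2) by (simp add: tr0_def)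
    moreover have "swap_elem x c ((D - {x}) \<union> T) = D \<union> (T - {c})" using x xc by (auto simp: swap_elem_def)
    ultimately show "swap_elem x c ((D - {x}) \<union> T) \<in> \<F>" by simp
  qed
  then have "\<exists>A\<in>shift x c \<F>. x \<notin> A" using t(5) by (rule bexI[rotated])
  moreover have "\<exists>A\<in>shift x c \<F>. y \<notin> A"
    using missed_shift[OF _ trD(4,5)[OF I0_mem[OF y(1,3)] y(1)], of x c] y xc by auto
  ultimately have "\<exists>a\<in>D. \<exists>b\<in>D. a \<noteq> b \<and> (\<exists>A\<in>shift x c \<F>. a \<notin> A) \<and> (\<exists>A\<in>shift x c \<F>. b \<notin> A)"
    using x y(1,2) by blast
  then have "admissible V D k (shift x c \<F>)"
    using admissible_shift[OF V DV adm _ xc(1,2)] xc(3,4) by blast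
  then show ?thesis using st xc by blast
qed

lemma stable_acrossD:
  assumes "stable x c \<F>" "x \<in> D" "c \<in> W" "T \<in> tr x" "c \<in> T"
  shows "T - {c} \<in> tr0"
proof -
  note t = trD[OF assms(4,2)]
  have "swap_elem x c ((D - {x}) \<union> T) \<in> \<F>"
    using stableD[OF assms(1) t(4)] t(5) assms by blast
  moreover have "swap_elem x c ((D - {x}) \<union> T) = D \<union> (T - {c})"
    using assms by (auto simp: swap_elem_def W_def)
  ultimately show ?thesis using t by (auto simp: tr0_def)
qed

text \<open>If \<open>e\<close> were absent from a set of \<open>tr x\<close> or
  \<open>tr y\<close>, this set would survive the shift from \<open>e\<close> into \<open>D\<close>,
  which would thus be stable; deleting \<open>e\<close> from \<open>T\<close> or \<open>T'\<close>
  would then give an element of \<open>tr0\<close> that contradicts the triple condition. If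
  \<open>e\<close> were absent from an element of \<open>tr0\<close>, the elements of
  \<open>tr0\<close> avoiding \<open>e\<close> would form a shifted family containing
  \<open>I0 - {e}\<close>, with the same contradiction.\<close>

lemma common_point:
  assumes T: "T \<in> tr x" "T' \<in> tr y" and xy: "x \<in> D" "y \<in> D" "x \<noteq> y" and less: "card (T \<inter> T' \<inter> I0) < 2"
  shows "\<exists>e\<in>I0. (\<forall>A\<in>\<F>. e \<in> A) \<and> (\<forall>z\<in>D. z \<noteq> x \<longrightarrow> z \<noteq> y \<longrightarrow> tr z = {})"
proof -
  have Ix: "I0 \<in> tr x" and Iy: "I0 \<in> tr y" using I0_mem T xy by blast+
  have others: "tr z = {}" if z: "z \<in> D" "z \<noteq> x" "z \<noteq> y" for z
  proof (rule ccontr)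
    assume "tr z \<noteq> {}"
    then have "I0 \<in> tr z" using I0_mem z by blast
    then have "2 \<le> card (T \<inter> T' \<inter> I0)" using three_traces_meet_twice[OF T(1,2) _ xy(1,2) z(1) xy(3)] z by blast
    then show False using less by simp
  qed
  have "1 \<le> card (T \<inter> I0 \<inter> T')" using same_traces_meet[OF T(1) Ix T(2) xy] .
  then have "card (T \<inter> T' \<inter> I0) = 1" using less by (simp add: Int_ac)
  then obtain e where e: "T \<inter> T' \<inter> I0 = {e}" by (auto simp: card_1_singleton_iff)
  have eW: "e \<in> W" "e \<in> I0" "e \<in> T" "e \<in> T'" using e I0 by blast+
  have all: "e \<in> T1" if "T1 \<in> tr u" "u \<in> D" "v \<in> D" "u \<noteq> v" "U \<in> tr u" "U' \<in> tr v" "U \<inter> U' \<inter> I0 = {e}"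
    "I0 \<in> tr u" for T1 u v U U'
  proof (rule ccontr)
    assume "e \<notin> T1"
    then have "stable u e \<F>" using stable_across[OF that(2) eW(1) that(1)] by blast
    then have "U - {e} \<in> tr0" using stable_acrossD that(2,5,7) eW by blast
    then have "1 \<le> card ((U - {e}) \<inter> I0 \<inter> U')" using tr0_meets_two_traces[OF _ that(8,6,2,3,4)] by blast
    moreover have "(U - {e}) \<inter> I0 \<inter> U' = {}" using that(7) by blast
    ultimately show False by simp
  qed
  have allx: "e \<in> T1" if "T1 \<in> tr x" for T1 using all[OF that xy T e Ix] .
  have "T' \<inter> T \<inter> I0 = {e}" using e by blast
  then have ally: "e \<in> T1" if "T1 \<in> tr y" for T1
    using all[OF that xy(2,1) _ T(2,1) _ Iy] xy(3) by blast
  have all0: "e \<in> S" if S: "S \<in> tr0" for S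
  proof (rule ccontr)
    assume "e \<notin> S"
    define G where "G = {S \<in> tr0. e \<notin> S}"
    have "I0 - {e} \<in> G"
    proof (rule initial_mem_shifted[of "W - {e}" G S])
      show "shifted (W - {e}) G" unfolding shifted_def stable_def
      proof (intro ballI impI)
        fix i j A assume h: "i \<in> W - {e}" "j \<in> W - {e}" "i < j" "A \<in> G" "j \<in> A \<and> i \<notin> A"
        then have "swap_elem i j A \<in> tr0" using shiftedD[OF tr0_shifted] by (auto simp: G_def)
        then show "swap_elem i j A \<in> G" using h by (auto simp: G_def swap_elem_def)
      qed
      show "A \<subseteq> W - {e} \<and> finite A" if "A \<in> G" for A using that tr0D by (auto simp: G_def)
      show "S \<in> G" using S \<open>e \<notin> S\<close> by (simp add: G_def)
      show "initial (I0 - {e}) (W - {e})" using I0(1) by (auto simp: initial_def)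
      show "card (I0 - {e}) = card S" using I0 eW tr0D(3)[OF S] by simp
      show "finite (I0 - {e})" using I0 by simp
    qed
    then have "1 \<le> card ((I0 - {e}) \<inter> T \<inter> T')" using tr0_meets_two_traces[OF _ T xy] by (auto simp: G_def)
    moreover have "(I0 - {e}) \<inter> T \<inter> T' = {}" using e by blast
    ultimately show False by simp
  qed
  have "e \<in> A" if A: "A \<in> \<F>" for A
    using decompose[OF A]
  proof (elim disjE conjE bexE)
    assume "A \<inter> W \<in> tr0" then show ?thesis using all0 by blast
  next
    fix z assume z: "z \<in> D" "A \<inter> W \<in> tr z"
    then show ?thesis using allx ally others by blast
  qed
  then show ?thesis using eW others by blast
qed

text \<open>The link of the common points is a nontrivial intersecting family, so this is the
  Hilton-Milner bound.\<close>

lemma common_point_bound: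
  assumes xy: "x \<in> D" "y \<in> D" "x < y" and ne: "tr x \<noteq> {}" "tr y \<noteq> {}"
    and e: "e \<in> I0" "\<And>A. A \<in> \<F> \<Longrightarrow> e \<in> A" and others: "\<And>z. z \<in> D \<Longrightarrow> z \<noteq> x \<Longrightarrow> z \<noteq> y \<Longrightarrow> tr z = {}"
  shows "card \<F> + ((N - \<kappa> - 1) choose \<kappa>) < (N choose \<kappa>) + d"
proof -
  have eW: "e \<in> W" "e \<notin> D" using e(1) I0(3) DW by blast+
  have Ix: "I0 \<in> tr x" and Iy: "I0 \<in> tr y" using I0_mem ne xy by blast+
  have etr: "e \<in> T" if "T \<in> tr z" "z \<in> D" for T z using e(2)[OF trD(4)[OF that]] eW by blast
  \<comment> \<open>\<open>d - 1\<close> points common to all members. What is left of the members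
    is \<open>(\<kappa> + 1)\<close>-uniform on the \<open>N + 1\<close> points of
    \<open>W'\<close>.\<close>
  define Q where "Q = insert e (D - {x, y})"
  define W' where "W' = {x, y} \<union> (W - {e})"
  define L where "L = (\<lambda>A. A - Q) ` \<F>"
  define C where "C = {x, y} \<union> (I0 - {e})"
  have xyW: "x \<notin> W" "y \<notin> W" "x \<noteq> y" using xy DW by auto
  have cQ: "card Q = d - 1" "finite Q" using xy eW fD cD d2 by (simp_all add: Q_def card_Diff_subset)
  have QA: "Q \<subseteq> A" if A: "A \<in> \<F>" for A
  proof -
    have "D - {x, y} \<subseteq> A" using decompose[OF A] others by blast
    then show ?thesis using e(2)[OF A] by (simp add: Q_def)
  qed
  have VW: "V = Q \<union> W'" "Q \<inter> W' = {}" using eW xy xyW DV DW by (auto simp: Q_def W'_def W_def)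
  have cW': "card W' = N + 1" "finite W'"
  proof -
    show fin: "finite W'" using fW by (simp add: W'_def)
    have "card V = card Q + card W'" using VW cQ(2) fin by (simp add: card_Un_disjoint)
    then show "card W' = N + 1" using cW cQ d2 by simp
  qed
  have inj: "inj_on (\<lambda>A. A - Q) \<F>" using QA by (intro inj_onI) blast
  have cL: "card L = card \<F>" unfolding L_def by (rule card_image[OF inj])
  have Ln: "L \<subseteq> nsets W' (\<kappa> + 1)"
  proof
    fix B assume "B \<in> L"
    then obtain A where A: "A \<in> \<F>" "B = A - Q" by (auto simp: L_def)
    have "card B = k - (d - 1)" using mem[OF A(1)] QA[OF A(1)] cQ A by (simp add: card_Diff_subset)
    then show "B \<in> nsets W' (\<kappa> + 1)" using mem[OF A(1)] A VW k d2 by (auto simp: nsets_def)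
  qed
  have Li: "inter2 1 L" unfolding inter2_def
  proof (intro ballI)
    fix B B' assume "B \<in> L" "B' \<in> L"
    then obtain A A' where A: "A \<in> \<F>" "B = A - Q" "A' \<in> \<F>" "B' = A' - Q" by (auto simp: L_def)
    have "d \<le> card (A \<inter> A')" using inter2D[OF F(2)] A by blast
    moreover have "B \<inter> B' = (A \<inter> A') - Q" using A by blast
    moreover have "card ((A \<inter> A') - Q) = card (A \<inter> A') - card Q"
      using QA A cQ by (intro card_Diff_subset) auto
    ultimately show "1 \<le> card (B \<inter> B')" using cQ d2 by simp
  qed
  \<comment> \<open>All traces contain \<open>e\<close>, so deleting another point \<open>c\<close>
    destroys no required intersection and maximality supplies the set. This makes the shifts from
    \<open>W - {e}\<close> to \<open>x\<close> and \<open>y\<close> stable.\<close>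
  have full: "T - {c} \<in> tr0" if T: "T \<in> tr z" "z \<in> D" "c \<in> T" "c \<noteq> e" for T z c
  proof (rule tr0_maximal)
    show "T - {c} \<subseteq> W" "card (T - {c}) = \<kappa>" using trD[OF T(1,2)] T by auto
    have "e \<in> T - {c}" using etr T by blast
    then show "(T - {c}) \<inter> U \<noteq> {}" if "u \<in> D" "U \<in> tr u" for u U using etr[OF that(2,1)] by blast
    show "(T - {c}) \<inter> U \<inter> U' \<noteq> {}" if "u \<in> D" "u' \<in> D" "u \<noteq> u'" "U \<in> tr u" "U' \<in> tr u'" for u u' U U'
      using etr[OF that(4,1)] etr[OF that(5,2)] \<open>e \<in> T - {c}\<close> by blast
  qed
  have Ls: "shifted W' L"
  proof -
    have "stable i j \<F>" if h: "i \<in> W'" "j \<in> W'" "i < j" for i j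
    proof (cases "i \<in> W")
      case True
      then have "j \<in> W" using h lowW xy unfolding W'_def by (metis DiffD1 Un_iff insert_iff less_asym singletonD)
      then show ?thesis using stable_outside True h by blast
    next
      case False
      then have i: "i = x \<or> i = y" using h by (auto simp: W'_def)
      then have iD: "i \<in> D" using xy by blast
      show ?thesis
      proof (cases "j \<in> D")
        case True
        then show ?thesis using stable_inside[OF iD True h(3)] by blast
      next
        case False
        then have j: "j \<in> W" "j \<noteq> e" using h xy by (auto simp: W'_def)
        show ?thesis using stable_across[OF iD j(1), of I0] full[of I0 i j] j i iD Ix Iy by blast
      qed
    qed
    then show ?thesis unfolding shifted_def
    proof (intro ballI impI)
      fix i j assume h: "i \<in> W'" "j \<in> W'" "i < j"
        and s: "\<And>i j. i \<in> W' \<Longrightarrow> j \<in> W' \<Longrightarrow> i < j \<Longrightarrow> stable i j \<F>"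
      show "stable i j L" unfolding stable_def
      proof (intro ballI impI)
        fix B assume B: "B \<in> L" "j \<in> B \<and> i \<notin> B"
        then obtain A where A: "A \<in> \<F>" "B = A - Q" by (auto simp: L_def)
        have ijQ: "i \<notin> Q" "j \<notin> Q" using h VW by auto
        then have "swap_elem i j A \<in> \<F>" using stableD[OF s[OF h] A(1)] B A by blast
        moreover have "swap_elem i j B = swap_elem i j A - Q" using A ijQ by (auto simp: swap_elem_def)
        ultimately show "swap_elem i j B \<in> L" by (simp add: L_def)
      qed
    qed
  qed
  have Ci: "initial C W'"
    unfolding initial_def
  proof (intro conjI ballI impI)
    show "C \<subseteq> W'" using I0 by (auto simp: C_def W'_def)
    fix c w assume h: "c \<in> C" "w \<in> W'" "w < c"
    show "w \<in> C"
    proof (cases "w \<in> W")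
      case True
      then have "c \<in> I0" using h lowW xy unfolding C_def by (metis DiffD1 Un_iff insert_iff less_asym singletonD)
      then have "w \<in> I0" using I0(1) True h by (auto simp: initial_def)
      then show ?thesis using h xyW True by (auto simp: C_def W'_def)
    qed (use h in \<open>auto simp: C_def W'_def\<close>)
  qed
  have "x \<notin> I0" "y \<notin> I0" using I0(3) xyW by auto
  then have cC: "card C = \<kappa> + 2" using I0(2,4) e(1) xyW(3) by (simp add: C_def)
  have LC: "2 \<le> card (B \<inter> C)" if B: "B \<in> L" for B
  proof -
    obtain A where A: "A \<in> \<F>" "B = A - Q" using B by (auto simp: L_def)
    have fB: "finite (B \<inter> C)" using A mem by auto
    have one: "2 \<le> card (B \<inter> C)" if z: "z \<in> D" "A = (D - {z}) \<union> (A \<inter> W)" "A \<inter> W \<in> tr z" "{z, z'} = {x, y}" "I0 \<in> tr z'" "z' \<in> D" "z \<noteq> z'" for z z'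
    proof -
      have "2 \<le> card ((A \<inter> W) \<inter> I0)" using distinct_traces_meet_twice[OF z(3,5,1,6,7)] .
      moreover have "e \<in> (A \<inter> W) \<inter> I0" using e A eW by blast
      ultimately have "1 \<le> card ((A \<inter> W) \<inter> I0 - {e})" using I0(4) by simp
      moreover have "(A \<inter> W) \<inter> I0 - {e} \<subseteq> B \<inter> C - {z'}" using A VW xyW z(4) DW xy by (auto simp: C_def Q_def)
      then have "card ((A \<inter> W) \<inter> I0 - {e}) \<le> card (B \<inter> C - {z'})" using fB by (intro card_mono) auto
      moreover have "z' \<in> A" using z by (metis Diff_iff UnI1 singletonD)
      then have "z' \<in> B \<inter> C" using A z(4) eW z(6) by (auto simp: C_def Q_def doubleton_eq_iff)
      then have "card (B \<inter> C - {z'}) = card (B \<inter> C) - 1" using fB by simp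
      ultimately show ?thesis using \<open>z' \<in> B \<inter> C\<close> by simp
    qed
    show ?thesis using decompose[OF A(1)]
    proof (elim disjE conjE bexE)
      assume "D \<subseteq> A"
      then have "{x, y} \<subseteq> B \<inter> C" using A xy eW by (auto simp: Q_def C_def)
      then have "card {x, y} \<le> card (B \<inter> C)" using fB by (intro card_mono)
      then show ?thesis using xyW by simp
    next
      fix z assume z: "z \<in> D" "A = (D - {z}) \<union> (A \<inter> W)" "A \<inter> W \<in> tr z"
      then have "z = x \<or> z = y" using others by blast
      then show ?thesis using one[OF z, of y] one[OF z, of x] Ix Iy xy by auto
    qed
  qed
  \<comment> \<open>The segment \<open>C\<close> has one point more than the uniformity, so the last
    binomial coefficient is \<open>1\<close>; the bound is strict because
    \<open>1 < d\<close>.\<close>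
  have "card L + ((card W' - (\<kappa> + 2)) choose (\<kappa> + 1 - 1)) \<le>
    ((card W' - 1) choose (\<kappa> + 1 - 1)) + (if \<kappa> + 2 \<le> \<kappa> + 1 + 1 then (card W' - (\<kappa> + 2)) choose (\<kappa> + 1 + 1 - (\<kappa> + 2)) else 0)"
    by (rule card_shifted_two_in_segment[OF cW'(2) _ Ln Ls Li Ci cC LC]) (use cW' N_ge3 in auto)
  then show ?thesis using cL cW' d2 by simp
qed

text \<open>After deletion of one point \<open>I0\<close> still meets every
  \<open>T \<inter> T'\<close>, so \<open>D \<union> (I0 - {c})\<close> is a member by maximality.
  It prevents \<open>(D - {x}) \<union> I0\<close> from moving, hence all shifts into
  \<open>D\<close> are stable. Consequently every set of a trace stays in \<open>tr0\<close> after
  the loss of a point, and a triple intersection with a single point \<open>c\<close> would be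
  destroyed by deleting \<open>c\<close>.\<close>

lemma triple_two:
  assumes dag: "\<forall>x\<in>D. \<forall>y\<in>D. \<forall>T\<in>tr x. \<forall>T'\<in>tr y. x \<noteq> y \<longrightarrow> 2 \<le> card (T \<inter> T' \<inter> I0)"
  shows "\<And>x c. x \<in> D \<Longrightarrow> c \<in> W \<Longrightarrow> stable x c \<F>"
    and "\<And>x T c. x \<in> D \<Longrightarrow> T \<in> tr x \<Longrightarrow> c \<in> T \<Longrightarrow> T - {c} \<in> tr0"
    and "\<And>x y T T1 T'. x \<in> D \<Longrightarrow> y \<in> D \<Longrightarrow> x \<noteq> y \<Longrightarrow> T \<in> tr x \<Longrightarrow> T1 \<in> tr x \<Longrightarrow> T' \<in> tr y \<Longrightarrow>
      2 \<le> card (T \<inter> T1 \<inter> T')"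
proof -
  have ex: "\<exists>y\<in>D. y \<noteq> x \<and> I0 \<in> tr y" for x
    using two_nonempty_traces I0_mem by (metis less_irrefl)
  have I0c: "I0 - {c} \<in> tr0" if c: "c \<in> I0" for c
  proof (rule tr0_maximal)
    show "I0 - {c} \<subseteq> W" "card (I0 - {c}) = \<kappa>" using I0 c by auto
    show "(I0 - {c}) \<inter> T \<noteq> {}" if x: "x \<in> D" "T \<in> tr x" for x T
    proof
      assume emp: "(I0 - {c}) \<inter> T = {}"
      obtain y where "y \<in> D" "y \<noteq> x" "I0 \<in> tr y" using ex by blast
      then have "2 \<le> card (T \<inter> I0)" using distinct_traces_meet_twice[OF x(2) _ x(1)] by blast
      moreover have "T \<inter> I0 \<subseteq> {c}" using emp by blast
      then have "card (T \<inter> I0) \<le> 1" using card_mono[of "{c}"] by simp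
      ultimately show False by simp
    qed
    show "(I0 - {c}) \<inter> T \<inter> T' \<noteq> {}" if x: "x \<in> D" "y \<in> D" "x \<noteq> y" "T \<in> tr x" "T' \<in> tr y" for x y T T'
    proof
      assume emp: "(I0 - {c}) \<inter> T \<inter> T' = {}"
      have "2 \<le> card (T \<inter> T' \<inter> I0)" using dag x by blast
      moreover have "T \<inter> T' \<inter> I0 \<subseteq> {c}" using emp by blast
      then have "card (T \<inter> T' \<inter> I0) \<le> 1" using card_mono[of "{c}"] by simp
      ultimately show False by simp
    qed
  qed
  show stab: "stable x c \<F>" if x: "x \<in> D" "c \<in> W" for x c
  proof (cases "tr x = {}")
    case True
    have "x \<in> A" if A: "A \<in> \<F>" for A
    proof (rule ccontr)
      assume "x \<notin> A"
      then obtain x' where "x' \<in> D" "x' \<notin> A" "A = (D - {x'}) \<union> (A \<inter> W)" "A \<inter> W \<in> tr x'"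
        using decompose[OF A] x by blast
      then show False using True \<open>x \<notin> A\<close> x by (metis Diff_iff UnI1 empty_iff singletonD)
    qed
    then show ?thesis by (auto simp: stable_def)
  next
    case False
    show ?thesis using stable_across[OF x I0_mem[OF x(1) False] I0c] .
  qed
  show acr: "T - {c} \<in> tr0" if "x \<in> D" "T \<in> tr x" "c \<in> T" for x T c
  proof -
    have "c \<in> W" using trD(1)[OF that(2,1)] that by blast
    then show ?thesis using stable_acrossD[OF stab] that by blast
  qed
  show "2 \<le> card (T \<inter> T1 \<inter> T')"
    if x: "x \<in> D" "y \<in> D" "x \<noteq> y" "T \<in> tr x" "T1 \<in> tr x" "T' \<in> tr y" for x y T T1 T'
  proof (rule ccontr)
    assume "\<not> 2 \<le> card (T \<inter> T1 \<inter> T')"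
    moreover have "1 \<le> card (T \<inter> T1 \<inter> T')" using same_traces_meet[OF x(4-6) x(1-3)] .
    ultimately have "card (T \<inter> T1 \<inter> T') = 1" by linarith
    then obtain c where c: "T \<inter> T1 \<inter> T' = {c}" by (auto simp: card_1_singleton_iff)
    then have "T - {c} \<in> tr0" using acr x by blast
    then have "1 \<le> card ((T - {c}) \<inter> T1 \<inter> T')" using tr0_meets_two_traces x by blast
    moreover have "(T - {c}) \<inter> T1 \<inter> T' = {}" using c by blast
    ultimately show False by simp
  qed
qed

text \<open>Among the pairs with the smallest intersection take one of least sum. If
  \<open>w < c\<close> with \<open>c\<close> in the intersection and \<open>w\<close> outside it,
  exchange \<open>c\<close> for \<open>w\<close> in one of the sets: the sum drops if
  \<open>w\<close> lies in the other set, the size drops if \<open>w\<close> lies in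
  neither.\<close>

lemma minimal_segment:
  assumes yz: "y \<in> D" "z \<in> D" "y \<noteq> z" and ne: "tr y \<noteq> {}" "tr z \<noteq> {}"
  shows "\<exists>C T T'. T \<in> tr y \<and> T' \<in> tr z \<and> C = T \<inter> T' \<and> initial C W \<and>
    (\<forall>U\<in>tr y. \<forall>U'\<in>tr z. card C \<le> card (U \<inter> U'))"
proof -
  define j where "j = (LEAST j. \<exists>T\<in>tr y. \<exists>T'\<in>tr z. card (T \<inter> T') = j)"
  define P where "P s \<longleftrightarrow> (\<exists>T\<in>tr y. \<exists>T'\<in>tr z. card (T \<inter> T') = j \<and> \<Sum>(T \<inter> T') = s)" for s
  have "\<exists>j. \<exists>T\<in>tr y. \<exists>T'\<in>tr z. card (T \<inter> T') = j" using ne by blast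
  then have "\<exists>T\<in>tr y. \<exists>T'\<in>tr z. card (T \<inter> T') = j" unfolding j_def by (rule LeastI_ex)
  then have "\<exists>s. P s" unfolding P_def by blast
  then have "P (Least P)" by (rule LeastI_ex)
  then obtain T T' where T: "T \<in> tr y" "T' \<in> tr z" "card (T \<inter> T') = j" "\<Sum>(T \<inter> T') = Least P"
    unfolding P_def by blast
  have min: "j \<le> card (U \<inter> U')" if "U \<in> tr y" "U' \<in> tr z" for U U'
    unfolding j_def by (rule Least_le) (use that in blast)
  have mins: "\<Sum>(T \<inter> T') \<le> \<Sum>(U \<inter> U')" if "U \<in> tr y" "U' \<in> tr z" "card (U \<inter> U') = j" for U U'
    unfolding T(4) by (rule Least_le) (use that in \<open>auto simp: P_def\<close>)
  note t = trD[OF T(1) yz(1)] and t' = trD[OF T(2) yz(2)]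
  have "initial (T \<inter> T') W"
    unfolding initial_def
  proof (intro conjI ballI impI)
    show "T \<inter> T' \<subseteq> W" using t by blast
    fix c w assume h: "c \<in> T \<inter> T'" "w \<in> W" "w < c"
    have cW: "c \<in> W" using h t by blast
    show "w \<in> T \<inter> T'"
    proof (rule ccontr)
      assume w: "w \<notin> T \<inter> T'"
      have smaller: "\<Sum>(swap_elem w c (T \<inter> T')) < \<Sum>(T \<inter> T')" "card (swap_elem w c (T \<inter> T')) = j"
        using sum_swap_elem_less[of "T \<inter> T'" w c] card_swap_elem[of "T \<inter> T'" c w] h w t T(3) by auto
      show False
      proof (cases "w \<in> T'")
        case True
        then have "swap_elem w c T \<in> tr y" using shiftedD[OF tr_shifted[OF yz(1)] T(1) h(2) cW h(3)] h w by blast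
        moreover have "swap_elem w c T \<inter> T' = swap_elem w c (T \<inter> T')" using True h w by (auto simp: swap_elem_def)
        ultimately show False using mins[of "swap_elem w c T" T'] T smaller by simp
      next
        case False
        then have s: "swap_elem w c T' \<in> tr z" using shiftedD[OF tr_shifted[OF yz(2)] T(2) h(2) cW h(3)] h by blast
        show False
        proof (cases "w \<in> T")
          case True
          moreover have "T \<inter> swap_elem w c T' = swap_elem w c (T \<inter> T')" using True h w by (auto simp: swap_elem_def)
          ultimately show False using mins[OF T(1) s] smaller by simp
        next
          case wT: False
          have "T \<inter> swap_elem w c T' = (T \<inter> T') - {c}" using wT by (auto simp: swap_elem_def)
          moreover have "card ((T \<inter> T') - {c}) < j" using h t T(3) card_Diff1_less[of "T \<inter> T'" c] by auto
          ultimately show False using min[OF T(1) s] by simp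
        qed
      qed
    qed
  qed
  then show ?thesis using T min by metis
qed

theorem compressed_bounded: "bounded_or_special V d \<kappa> \<F>"
proof -
  have N': "card V - d = N" using cW by simp
  have le_choose: "(N - \<kappa> - 1) choose \<kappa> \<le> N choose \<kappa>" by (intro binomial_right_mono) simp
  have below_H: ?thesis if "card \<F> + ((N - \<kappa> - 1) choose \<kappa>) < (N choose \<kappa>) + d"
  proof -
    have "card \<F> < size_H d \<kappa> N" using that le_choose by (simp add: size_H_def)
    then show ?thesis unfolding bounded_or_special_def N' by (simp add: less_max_iff_disj)
  qed
  show ?thesis
  proof (cases "\<forall>x\<in>D. \<forall>y\<in>D. \<forall>T\<in>tr x. \<forall>T'\<in>tr y. x \<noteq> y \<longrightarrow> 2 \<le> card (T \<inter> T' \<inter> I0)")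
    case False
    then obtain x y T T' where "x \<in> D" "y \<in> D" "T \<in> tr x" "T' \<in> tr y" "x \<noteq> y" "card (T \<inter> T' \<inter> I0) < 2"
      by (metis not_le)
    then have "\<exists>x y T T'. x \<in> D \<and> y \<in> D \<and> T \<in> tr x \<and> T' \<in> tr y \<and> x < y \<and> card (T \<inter> T' \<inter> I0) < 2"
      by (metis Int_commute linorder_neqE_nat)
    then obtain x y T T' where h: "x \<in> D" "y \<in> D" "T \<in> tr x" "T' \<in> tr y" "x < y" "card (T \<inter> T' \<inter> I0) < 2"
      by blast
    then obtain e where e: "e \<in> I0" "\<forall>A\<in>\<F>. e \<in> A" "\<forall>z\<in>D. z \<noteq> x \<longrightarrow> z \<noteq> y \<longrightarrow> tr z = {}"
      using common_point[OF h(3,4,1,2) _ h(6)] by auto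
    then show ?thesis using common_point_bound[OF h(1,2,5), of e] h(3,4) by (intro below_H) blast
  next
    case True
    note dag = triple_two[OF True]
    \<comment> \<open>Traces increase along \<open>D\<close>, so \<open>tr z\<close> is the largest
      one and \<open>tr y\<close> contains all the others.\<close>
    define z where "z = Max D"
    define y where "y = Max (D - {z})"
    have Dne: "D \<noteq> {}" "D - {z} \<noteq> {}"
    proof -
      show "D \<noteq> {}" using cD d2 by auto
      show "D - {z} \<noteq> {}"
      proof
        assume "D - {z} = {}"
        then have "card D \<le> card {z}" by (intro card_mono) auto
        then show False using cD d2 by simp
      qed
    qed
    have z: "z \<in> D" "\<And>x. x \<in> D \<Longrightarrow> x \<le> z" using Dne fD by (simp_all add: z_def)
    have y: "y \<in> D - {z}" "\<And>x. x \<in> D - {z} \<Longrightarrow> x \<le> y"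
      using Max_in[OF _ Dne(2)] Max_ge[of "D - {z}"] fD unfolding y_def by simp_all
    then have yz: "y \<in> D" "y \<noteq> z" "y < z" using z(2)[of y] by auto
    have suby: "tr x \<subseteq> tr y" if "x \<in> D - {z}" for x
      using tr_mono[of x y] y(2)[OF that] that yz by (cases "x = y") auto
    have subz: "tr y \<subseteq> tr z" using tr_mono yz z by blast
    have "tr y \<noteq> {}"
    proof -
      obtain u v where uv: "u \<in> D" "v \<in> D" "u < v" "tr u \<noteq> {}" using two_nonempty_traces by blast
      then have "u \<noteq> z" using z(2)[of v] by auto
      then show ?thesis using suby uv by blast
    qed
    then have ney: "tr y \<noteq> {}" "tr z \<noteq> {}" using subz by auto
    obtain C T T' where T: "T \<in> tr y" "T' \<in> tr z" "C = T \<inter> T'" and Ci: "initial C W"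
      and Cmin: "\<And>U U'. U \<in> tr y \<Longrightarrow> U' \<in> tr z \<Longrightarrow> card C \<le> card (U \<inter> U')"
      using minimal_segment[OF yz(1) z(1) yz(2) ney] by blast
    define j where "j = card C"
    have CW: "C \<subseteq> W" "finite C" using Ci fW finite_subset by (auto simp: initial_def)
    have j2: "2 \<le> j" using distinct_traces_meet_twice[OF T(1,2) yz(1) z(1) yz(2)] T by (simp add: j_def)
    have jk: "j \<le> \<kappa> + 1"
      using card_mono[of T C] trD(2,3)[OF T(1) yz(1)] T(3) by (simp add: j_def)
    \<comment> \<open>\<open>U \<inter> C\<close> is a triple intersection with two sets from
      \<open>tr z\<close> and one from \<open>tr y\<close>, the configuration covered by the third
      part of \<open>triple_two\<close>.\<close>
    have U2: "2 \<le> card (U \<inter> C)" if "U \<in> tr z" for U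
    proof -
      have "2 \<le> card (U \<inter> T' \<inter> T)" using dag(3)[OF z(1) yz(1) yz(2)[symmetric] that T(2,1)] .
      then show ?thesis using T(3) by (simp add: Int_ac)
    qed
    have S1: "1 \<le> card (S \<inter> C)" if "S \<in> tr0" for S
      using tr0_meets_two_traces[OF that T(1,2) yz(1) z(1) yz(2)] T(3) by (simp add: Int_assoc)
    define B where "B = D - {z}"
    have cB: "card B = d - 1" "finite B" "B \<subseteq> D" using z cD fD by (auto simp: B_def)
    define W' where "W' = insert z W"
    have zW: "z \<notin> W" using z DW by blast
    have cW': "card W' = N + 1" "finite W'" using fW zW by (simp_all add: W'_def N_def)
    txt \<open>The members containing all of \<open>D\<close> but \<open>z\<close> form, outside \<open>B\<close>, an intersecting family whose
      members meet the initial segment \<open>insert z C\<close> twice.\<close>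
    define K where "K = (\<lambda>A. A - B) ` {A \<in> \<F>. B \<subseteq> A}"
    have VB: "V = B \<union> W'" "B \<inter> W' = {}" using z DV DW by (auto simp: B_def W'_def W_def)
    have cK: "card K = card {A \<in> \<F>. B \<subseteq> A}"
      unfolding K_def by (rule card_image) (auto intro!: inj_onI)
    have K_cases: "(\<exists>S\<in>tr0. X = insert z S) \<or> X \<in> tr z" if X: "X \<in> K" for X
    proof -
      obtain A where A: "A \<in> \<F>" "B \<subseteq> A" "X = A - B" using X by (auto simp: K_def)
      show ?thesis using decompose[OF A(1)]
      proof (elim disjE conjE bexE)
        assume h: "D \<subseteq> A" "A = D \<union> (A \<inter> W)" "A \<inter> W \<in> tr0"
        then have "X = insert z (A \<inter> W)" using A(3) z DW unfolding B_def by blast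
        then show ?thesis using h by blast
      next
        fix x assume h: "x \<in> D" "x \<notin> A" "A = D - {x} \<union> (A \<inter> W)" "A \<inter> W \<in> tr x"
        then have "x = z" using A(2) unfolding B_def by blast
        then have "X = A \<inter> W" using h A(3) DW unfolding B_def by blast
        then show ?thesis using h \<open>x = z\<close> by simp
      qed
    qed
    have Kn: "K \<subseteq> nsets W' (\<kappa> + 1)"
    proof
      fix X assume "X \<in> K"
      then consider S where "S \<in> tr0" "X = insert z S" | "X \<in> tr z" using K_cases by blast
      then show "X \<in> nsets W' (\<kappa> + 1)"
      proof cases
        case 1
        then have "z \<notin> S" using tr0D(1) zW by blast
        then show ?thesis using 1(2) tr0D[OF 1(1)] by (auto simp: nsets_def W'_def)
      next
        case 2
        then show ?thesis using trD[OF 2 z(1)] by (auto simp: nsets_def W'_def)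
      qed
    qed
    have Ki: "inter2 1 K"
      unfolding inter2_def
    proof (intro ballI)
      fix X X' assume XX: "X \<in> K" "X' \<in> K"
      have fX: "finite (X \<inter> X')" using XX Kn by (auto simp: nsets_def)
      have ne: "S \<inter> U \<noteq> {}" if "S \<in> tr0" "U \<in> tr z" for S U
        using tr0_meets_tr[OF that z(1)] by (metis card.empty not_one_le_zero)
      have "U \<inter> U' \<noteq> {}" if "U \<in> tr z" "U' \<in> tr z" for U U'
        using same_trace_meets[OF that z(1)] by (metis card.empty not_one_le_zero)
      then have "X \<inter> X' \<noteq> {}" using K_cases[OF XX(1)] K_cases[OF XX(2)] ne by blast
      then show "1 \<le> card (X \<inter> X')" using fX by (simp add: Suc_le_eq card_gt_0_iff)
    qed
    have Ks: "shifted W' K"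
      unfolding shifted_def stable_def
    proof (intro ballI impI)
      fix i m X assume h: "i \<in> W'" "m \<in> W'" "i < m" "X \<in> K" "m \<in> X \<and> i \<notin> X"
      then obtain A where A: "A \<in> \<F>" "B \<subseteq> A" "X = A - B" by (auto simp: K_def)
      have im: "i \<notin> B" "m \<notin> B" using h VB by auto
      have m: "m \<in> W"
      proof (rule ccontr)
        assume "m \<notin> W"
        then have "m = z" using h by (simp add: W'_def)
        then show False using h lowW[OF z(1), of i] by (auto simp: W'_def)
      qed
      have "stable i m \<F>"
      proof (cases "i \<in> W")
        case True
        then show ?thesis using stable_outside m h by blast
      next
        case False
        then have "i = z" using h by (simp add: W'_def)
        then show ?thesis using dag(1) z m by blast
      qed
      then have "swap_elem i m A \<in> \<F>" using stableD A h im by blast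
      moreover have "B \<subseteq> swap_elem i m A" using A im by (auto simp: swap_elem_def)
      moreover have "swap_elem i m X = swap_elem i m A - B" using A im by (auto simp: swap_elem_def)
      ultimately show "swap_elem i m X \<in> K" by (auto simp: K_def)
    qed
    have Ci': "initial (insert z C) W'"
      using Ci lowW[OF z(1)] unfolding initial_def W'_def by (auto dest: less_asym)
    have "z \<notin> C" using CW(1) zW by blast
    then have cC': "card (insert z C) = j + 1" using CW(2) by (simp add: j_def)
    have KC: "2 \<le> card (X \<inter> insert z C)" if X: "X \<in> K" for X
      using K_cases[OF X]
    proof
      assume "\<exists>S\<in>tr0. X = insert z S"
      then obtain S where S: "S \<in> tr0" "X = insert z S" by blast
      then have "X \<inter> insert z C = insert z (S \<inter> C)" "z \<notin> S \<inter> C" "finite (S \<inter> C)" using CW zW by auto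
      then show ?thesis using S1[OF S(1)] by simp
    next
      assume "X \<in> tr z"
      then have "2 \<le> card (X \<inter> C)" using U2 by blast
      also have "\<dots> \<le> card (X \<inter> insert z C)" using CW by (intro card_mono) auto
      finally show ?thesis .
    qed
    have "card K + ((card W' - (j + 1)) choose (\<kappa> + 1 - 1)) \<le>
      ((card W' - 1) choose (\<kappa> + 1 - 1)) + (if j + 1 \<le> \<kappa> + 1 + 1 then (card W' - (j + 1)) choose (\<kappa> + 1 + 1 - (j + 1)) else 0)"
      by (rule card_shifted_two_in_segment[OF cW'(2) _ Kn Ks Ki Ci' cC' KC]) (use cW' N_ge3 in auto)
    then have boundK: "card K + ((N - j) choose \<kappa>) \<le> (N choose \<kappa>) + ((N - j) choose (\<kappa> + 1 - j))"
      using cW' jk by simp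
    \<comment> \<open>\<open>tr y\<close> is contained in \<open>tr z\<close>, so any two of its
      sets compete in the minimum that defines \<open>j\<close>; hence it is
      \<open>j\<close>-intersecting.\<close>
    have "card (tr y) \<le> (card W - 1) choose (\<kappa> + 1 - j)"
    proof (rule card_inter2_le[OF fW])
      show "2 * (\<kappa> + 1) + 1 \<le> card W + j" using N_ge3 j2 by (simp add: N_def)
      show "tr y \<subseteq> nsets W (\<kappa> + 1)" using trD[OF _ yz(1)] by (auto simp: nsets_def)
      show "inter2 j (tr y)" using Cmin subz by (auto simp: inter2_def j_def)
    qed (use j2 jk in auto)
    then have cy: "card (tr y) \<le> (N - 1) choose (\<kappa> + 1 - j)" by (simp add: N_def)
    have fin_tr: "finite (tr x)" for x using fW by (simp add: tr_def)
    have cFx: "card {A \<in> \<F>. x \<notin> A} \<le> card (tr y)" if x: "x \<in> B" for x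
    proof -
      have xD: "x \<in> D" "x \<in> D - {z}" using x by (auto simp: B_def)
      have "{A \<in> \<F>. x \<notin> A} \<subseteq> (\<lambda>T. (D - {x}) \<union> T) ` tr x"
      proof
        fix A assume "A \<in> {A \<in> \<F>. x \<notin> A}"
        then obtain x' where x': "x' \<in> D" "x' \<notin> A" "A = (D - {x'}) \<union> (A \<inter> W)" "A \<inter> W \<in> tr x'" "x \<notin> A"
          using decompose[of A] xD by blast
        then have "x = x'" using xD by blast
        then show "A \<in> (\<lambda>T. (D - {x}) \<union> T) ` tr x" using x' by blast
      qed
      then have "card {A \<in> \<F>. x \<notin> A} \<le> card (tr x)"
        using fin_tr by (meson card_image_le card_mono finite_imageI le_trans)
      also have "\<dots> \<le> card (tr y)" using suby[OF xD(2)] fin_tr by (intro card_mono)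
      finally show ?thesis .
    qed
    have "\<F> = {A \<in> \<F>. B \<subseteq> A} \<union> (\<Union>x\<in>B. {A \<in> \<F>. x \<notin> A})" by blast
    then have "card \<F> = card ({A \<in> \<F>. B \<subseteq> A} \<union> (\<Union>x\<in>B. {A \<in> \<F>. x \<notin> A}))" by (rule arg_cong)
    also have "\<dots> \<le> card {A \<in> \<F>. B \<subseteq> A} + card (\<Union>x\<in>B. {A \<in> \<F>. x \<notin> A})"
      by (rule card_Un_le)
    also have "card (\<Union>x\<in>B. {A \<in> \<F>. x \<notin> A}) \<le> (\<Sum>x\<in>B. card {A \<in> \<F>. x \<notin> A})"
      using cB(2) by (rule card_UN_le)
    also have "\<dots> \<le> (\<Sum>x\<in>B. (N - 1) choose (\<kappa> + 1 - j))"
      using cFx cy by (intro sum_mono) (meson le_trans)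
    finally have total: "card \<F> \<le> card K + (d - 1) * ((N - 1) choose (\<kappa> + 1 - j))" using cK cB by simp
    have A_cases: "(A = D \<union> (A \<inter> W) \<and> A \<inter> W \<in> tr0) \<or> (\<exists>x\<in>D. A = (D - {x}) \<union> (A \<inter> W) \<and> A \<inter> W \<in> tr z)"
      if "A \<in> \<F>" for A
      using decompose[OF that] suby subz by blast
    have AC: "card (A \<inter> (D \<union> C)) = card (A \<inter> D) + card (A \<inter> W \<inter> C)" if "A \<in> \<F>" for A
    proof -
      have "A \<inter> (D \<union> C) = (A \<inter> D) \<union> (A \<inter> W \<inter> C)" using CW by blast
      then show ?thesis using card_parts[of "A \<inter> D" "A \<inter> W \<inter> C"] CW by auto
    qed
    have cDC: "card (D \<union> C) = d + j" "D \<union> C \<subseteq> V"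
      using card_parts[OF subset_refl CW] cD CW DV by (auto simp: j_def W_def)
    have dAD: "card (A \<inter> D) = d" if "A = D \<union> (A \<inter> W)" for A
    proof -
      have "A \<inter> D = D" using that by blast
      then show ?thesis using cD by simp
    qed
    have dAD1: "card (A \<inter> D) = d - 1" if "A = (D - {x}) \<union> (A \<inter> W)" "x \<in> D" for A x
    proof -
      have "A \<inter> D = D - {x}" using that DW by blast
      then show ?thesis using cD fD that by simp
    qed
    consider "j = 2" | "3 \<le> j" "j \<le> \<kappa>" | "3 \<le> j" "j = \<kappa> + 1" using j2 jk by linarith
    then show ?thesis
    proof cases
      case 1
      have "\<F> \<subseteq> fam_A V (d + \<kappa>) d (D \<union> C)"
      proof
        fix A assume A: "A \<in> \<F>"
        have "d + 1 \<le> card (A \<inter> (D \<union> C))" using A_cases[OF A]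
        proof (elim disjE conjE bexE)
          assume h: "A = D \<union> (A \<inter> W)" "A \<inter> W \<in> tr0"
          show ?thesis using AC[OF A] dAD[OF h(1)] S1[OF h(2)] by simp
        next
          fix x assume h: "x \<in> D" "A = (D - {x}) \<union> (A \<inter> W)" "A \<inter> W \<in> tr z"
          show ?thesis using AC[OF A] dAD1[OF h(2,1)] U2[OF h(3)] by simp
        qed
        then show "A \<in> fam_A V (d + \<kappa>) d (D \<union> C)" using A F(1) k by (auto simp: fam_A_def)
      qed
      then show ?thesis using cDC 1 unfolding bounded_or_special_def by auto
    next
      case 2
      \<comment> \<open>In these parameters \<open>3 \<le> j \<le> \<kappa>\<close> becomes
        \<open>1 \<le> w\<close> and \<open>w + 2 \<le> \<kappa>\<close>, and the bound on
        \<open>N\<close> becomes \<open>d * \<kappa> + 1 \<le> m\<close>.\<close>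
      define m where "m = N - \<kappa> - 1"
      define w where "w = \<kappa> + 1 - j"
      have mw: "d * \<kappa> + 1 \<le> m" "1 \<le> w" "w + 2 \<le> \<kappa>" "m + w = N - j" "m + \<kappa> = N - 1"
        using N_ge 2 by (auto simp: m_def w_def)
      have "gap d m w \<kappa>" using gap_intermediate[OF d2 mw(1-3)] .
      then have "(m choose \<kappa>) + ((N - j) choose w) + (d - 1) * ((N - 1) choose w) < ((N - j) choose \<kappa>) + d"
        unfolding gap_def mw(4,5) .
      then show ?thesis using boundK total unfolding m_def w_def by (intro below_H) linarith
    next
      case 3
      \<comment> \<open>\<open>T\<close> has \<open>\<kappa> + 1 = j\<close> points, so
        \<open>T = C\<close>. Every set of \<open>tr z\<close> has \<open>j\<close> points and meets
        \<open>T\<close> in at least \<open>j\<close>, so \<open>tr z\<close> consists of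
        \<open>C\<close> alone.\<close>
      have eqC: "U = C" if U: "U \<in> tr z" for U
      proof -
        have "card T = j" using trD(3)[OF T(1) yz(1)] 3 by simp
        then have TC: "T = C" using card_subset_eq[of T C] trD(2)[OF T(1) yz(1)] T(3) by (simp add: j_def)
        have "card C \<le> card (T \<inter> U)" using Cmin[OF T(1) U] .
        moreover have "finite U" "card U = card C" using trD[OF U z(1)] 3 by (simp_all add: j_def)
        ultimately show ?thesis using TC card_seteq[of U "C \<inter> U"] CW card_subset_eq[of U C]
          by (metis Int_lower1 Int_lower2 card_seteq)
      qed
      have M: "D \<union> C \<subseteq> V" "card (D \<union> C) = d + \<kappa> + 1" "D \<subseteq> D \<union> C" using cDC 3 by auto
      have sub: "\<F> \<subseteq> fam_H V (d + \<kappa>) d D (D \<union> C)"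
      proof
        fix A assume A: "A \<in> \<F>"
        show "A \<in> fam_H V (d + \<kappa>) d D (D \<union> C)" using A_cases[OF A]
        proof (elim disjE conjE bexE)
          assume h: "A = D \<union> (A \<inter> W)" "A \<inter> W \<in> tr0"
          have "d + 1 \<le> card (A \<inter> (D \<union> C))" using AC[OF A] dAD[OF h(1)] S1[OF h(2)] by simp
          moreover have "D \<subseteq> A" using h by blast
          ultimately show ?thesis using A F(1) k by (auto simp: fam_H_def)
        next
          fix x assume h: "x \<in> D" "A = (D - {x}) \<union> (A \<inter> W)" "A \<inter> W \<in> tr z"
          have "A \<subseteq> D \<union> C" using h(2) eqC[OF h(3)] by blast
          then show ?thesis using mem[OF A] k by (auto simp: fam_H_def nsets_def)
        qed
      qed
      show ?thesis
      proof (cases "d + 2 \<le> \<kappa>")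
        case True
        then show ?thesis using M sub cD unfolding bounded_or_special_def by blast
      next
        case False
        have "card \<F> \<le> card (fam_H V (d + \<kappa>) d D (D \<union> C))"
          using sub finite_subset[OF fam_H_subset[OF M(1)] finite_nsets[OF V]] by (intro card_mono) auto
        also have "\<dots> = size_H d \<kappa> N" using card_fam_H[OF V M(1,2,3) cD refl \<kappa> cW] .
        also have "\<dots> < size_A d \<kappa> N"
        proof -
          have "((N - 2) choose \<kappa>) + d < ((N - \<kappa> - 1) choose \<kappa>) + d * ((N - 2) choose (\<kappa> - 1))"
            using choose_small_uniformity[OF d2 _ _ N_ge] 3 False by simp
          moreover have "(N - 2) choose \<kappa> \<le> N choose \<kappa>" by (intro binomial_right_mono) simp
          ultimately show ?thesis using le_choose unfolding size_H_def size_A_def by linarith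
        qed
        finally show ?thesis unfolding bounded_or_special_def N' by (simp add: less_max_iff_disj)
      qed
    qed
  qed
qed

end

section \<open>Reduction to compressed families\<close>

text \<open>Shifts keep the size, so the structure matters only at extremal size; there containment
  is equality, and the rigidity of extremal families under shifts applies.\<close>

lemma bounded_or_special_shift:
  assumes V: "finite V" and F: "\<F> \<subseteq> nsets V k" "inter2 d \<F>" and ij: "i \<noteq> j" "i \<in> V" "j \<in> V"
    and k: "k = d + \<kappa>" "1 \<le> \<kappa>" and d: "2 \<le> d" and n: "d + (d + 1) * \<kappa> + 2 \<le> card V"
    and b: "bounded_or_special V d \<kappa> (shift i j \<F>)"
  shows "bounded_or_special V d \<kappa> \<F>"
proof -
  define N where "N = card V - d"
  have n3: "d + 3 * \<kappa> + 2 \<le> card V" using n mult_le_mono1[of 3 "d + 1" \<kappa>] d by linarith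
  have N: "card V = d + N" using n by (simp add: N_def)
  have c: "card (shift i j \<F>) = card \<F>" by (rule card_shift)
  have size: ?thesis if "card \<F> < size_H d \<kappa> N \<or> card \<F> < size_A d \<kappa> N"
    using that unfolding bounded_or_special_def N_def[symmetric] by (simp add: less_max_iff_disj)
  from b consider "card \<F> < size_H d \<kappa> N \<or> card \<F> < size_A d \<kappa> N"
    | X M where "d + 2 \<le> \<kappa>" "M \<subseteq> V" "card M = d + \<kappa> + 1" "X \<subseteq> M" "card X = d" "shift i j \<F> \<subseteq> fam_H V (d + \<kappa>) d X M"
    | Z where "Z \<subseteq> V" "card Z = d + 2" "shift i j \<F> \<subseteq> fam_A V (d + \<kappa>) d Z"
    unfolding bounded_or_special_def N_def[symmetric] c by (auto simp: less_max_iff_disj)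
  then show ?thesis
  proof cases
    case 1
    then show ?thesis by (rule size)
  next
    case 2
    note M = 2(2,3,4,5)
    have fin: "finite (fam_H V k d X M)"
      using fam_H_subset[OF M(1)] finite_nsets[OF V] by (rule finite_subset)
    have cH: "card (fam_H V k d X M) = size_H d \<kappa> N"
      using card_fam_H[OF V M(1) _ M(3,4) k N] M(2) k by simp
    show ?thesis
    proof (cases "card \<F> < size_H d \<kappa> N")
      case False
      then have "shift i j \<F> = fam_H V k d X M" using card_seteq[OF fin] 2(6) c cH k by simp
      then obtain M' X' where "M' \<subseteq> V" "card M' = k + 1" "X' \<subseteq> M'" "card X' = d" "\<F> = fam_H V k d X' M'"
        using shift_eq_fam_H[OF V F ij k(1) _ d n3 M(1) _ M(3,4)] M(2) 2(1) d k by auto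
      then show ?thesis using 2(1) k unfolding bounded_or_special_def by blast
    qed (use size in blast)
  next
    case 3
    have fin: "finite (fam_A V k d Z)" using fam_A_subset finite_nsets[OF V] by (rule finite_subset)
    have cA: "card (fam_A V k d Z) = size_A d \<kappa> N" using card_fam_A[OF V 3(1,2) k N] .
    show ?thesis
    proof (cases "card \<F> < size_A d \<kappa> N")
      case False
      then have "shift i j \<F> = fam_A V k d Z" using card_seteq[OF fin] 3(3) c cA k by simp
      then obtain Z' where "Z' \<subseteq> V" "card Z' = d + 2" "\<F> = fam_A V k d Z'"
        using shift_eq_fam_A[OF V F ij k d n3 3(1,2)] by auto
      then show ?thesis using k unfolding bounded_or_special_def by blast
    qed (use size in blast)
  qed
qed

text \<open>If the enlarged family fits into an extremal one, the smaller family is strictly below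
  its size.\<close>

lemma bounded_or_special_insert:
  assumes V: "finite V" and F: "finite \<F>" "A \<notin> \<F>" and \<kappa>: "1 \<le> \<kappa>" and n: "d + (d + 1) * \<kappa> + 2 \<le> card V"
    and b: "bounded_or_special V d \<kappa> (insert A \<F>)"
  shows "bounded_or_special V d \<kappa> \<F>"
proof -
  define N where "N = card V - d"
  have N: "card V = d + N" using n by (simp add: N_def)
  have c: "card (insert A \<F>) = Suc (card \<F>)" using F by simp
  have size: ?thesis if "card \<F> < size_H d \<kappa> N \<or> card \<F> < size_A d \<kappa> N"
    using that unfolding bounded_or_special_def N_def[symmetric] by (simp add: less_max_iff_disj)
  from b consider "card (insert A \<F>) < size_H d \<kappa> N \<or> card (insert A \<F>) < size_A d \<kappa> N"
    | X M where "M \<subseteq> V" "card M = d + \<kappa> + 1" "X \<subseteq> M" "card X = d" "insert A \<F> \<subseteq> fam_H V (d + \<kappa>) d X M"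
    | Z where "Z \<subseteq> V" "card Z = d + 2" "insert A \<F> \<subseteq> fam_A V (d + \<kappa>) d Z"
    unfolding bounded_or_special_def N_def[symmetric] by (auto simp: less_max_iff_disj)
  then show ?thesis
  proof cases
    case 1
    then show ?thesis using c by (intro size) auto
  next
    case 2
    have "finite (fam_H V (d + \<kappa>) d X M)"
      using fam_H_subset[OF 2(1)] finite_nsets[OF V] by (rule finite_subset)
    then have "card (insert A \<F>) \<le> card (fam_H V (d + \<kappa>) d X M)" using 2(5) by (rule card_mono)
    then show ?thesis using card_fam_H[OF V 2(1,2,3,4) refl \<kappa> N] c by (intro size) simp
  next
    case 3
    have "finite (fam_A V (d + \<kappa>) d Z)" using fam_A_subset finite_nsets[OF V] by (rule finite_subset)
    then have "card (insert A \<F>) \<le> card (fam_A V (d + \<kappa>) d Z)" using 3(3) by (rule card_mono)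
    then show ?thesis using card_fam_A[OF V 3(1,2) refl \<kappa> N] c by (intro size) simp
  qed
qed

text \<open>The order is lexicographic: an insertion may raise the weight but lowers the first
  component, while a shift keeps the first component and lowers the weight. When neither is possible
  the family is compressed.\<close>

lemma admissible_bounded_low:
  assumes V: "finite V" and D: "D \<subseteq> V" "card D = d" and d: "2 \<le> d"
    and low: "\<And>x c. x \<in> D \<Longrightarrow> c \<in> V - D \<Longrightarrow> x < c"
    and k: "k = d + \<kappa>" and \<kappa>: "1 \<le> \<kappa>" and n: "d + (d + 1) * \<kappa> + 2 \<le> card V"
    and adm: "admissible V D k \<F>"
  shows "bounded_or_special V d \<kappa> \<F>"
  using adm
proof (induction \<F> rule: wf_induct_rule[OF wf_measures[of "[\<lambda>\<F>. card (nsets V k) - card \<F>, weight]"]])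
  case (1 \<F>)
  have F: "\<F> \<subseteq> nsets V k" "inter2 d \<F>" using 1(2) D by (auto simp: admissible_def)
  have fin: "finite \<F>" using F(1) finite_nsets[OF V] by (rule finite_subset)
  have finm: "finite A" if "A \<in> \<F>" for A using that F nsets_finite_mem by blast
  show ?case
  proof (cases "\<exists>i j. i \<in> V \<and> j \<in> V \<and> i < j \<and> admissible V D k (shift i j \<F>) \<and> \<not> stable i j \<F>")
    case True
    then obtain i j where ij: "i \<in> V" "j \<in> V" "i < j" "admissible V D k (shift i j \<F>)" "\<not> stable i j \<F>" by blast
    have "weight (shift i j \<F>) < weight \<F>" using weight_shift_less[OF fin finm ij(3,5)] .
    then have "bounded_or_special V d \<kappa> (shift i j \<F>)"
      using 1(1)[of "shift i j \<F>"] ij(4) card_shift[of i j \<F>] by simp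
    then show ?thesis using bounded_or_special_shift[OF V F _ ij(1,2) k \<kappa> d n] ij(3) by simp
  next
    case st: False
    show ?thesis
    proof (cases "\<exists>A\<in>nsets V k. admissible V D k (insert A \<F>) \<and> A \<notin> \<F>")
      case True
      then obtain A where A: "A \<in> nsets V k" "admissible V D k (insert A \<F>)" "A \<notin> \<F>" by blast
      have "card (insert A \<F>) \<le> card (nsets V k)" using A F by (intro card_mono finite_nsets V) auto
      moreover have "card (insert A \<F>) = Suc (card \<F>)" using A fin by simp
      ultimately have "card (nsets V k) - card (insert A \<F>) < card (nsets V k) - card \<F>" by linarith
      then have "(insert A \<F>, \<F>) \<in> measures [\<lambda>\<F>. card (nsets V k) - card \<F>, weight]"
        by (simp only: measures_less)
      then have "bounded_or_special V d \<kappa> (insert A \<F>)" using A(2) by (rule 1(1))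
      then show ?thesis using bounded_or_special_insert[OF V fin A(3) \<kappa> n] by simp
    next
      case False
      interpret compressed V D k \<kappa> d \<F>
        by unfold_locales (use V D d low k \<kappa> n 1(2) st False in auto)
      show ?thesis by (rule compressed_bounded)
    qed
  qed
qed

section \<open>Relabelling the ground set so that \<open>D\<close> comes first\<close>

lemma admissible_image:
  assumes inj: "inj_on \<pi> V" and D: "D \<subseteq> V" and adm: "admissible V D k \<F>"
  shows "admissible (\<pi> ` V) (\<pi> ` D) k ((`) \<pi> ` \<F>)"
proof -
  have F: "\<F> \<subseteq> nsets V k" "inter2 (card D) \<F>" "inter3 (card D - 1) \<F>" "\<And>A. A \<in> \<F> \<Longrightarrow> card D - 1 \<le> card (A \<inter> D)"
    using adm by (auto simp: admissible_def)
  have sub: "A \<subseteq> V" "finite A" "card A = k" if "A \<in> \<F>" for A using that F by (auto simp: nsets_def)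
  have cD: "card (\<pi> ` D) = card D" using inj D by (meson card_image inj_on_subset)
  have "(`) \<pi> ` \<F> \<subseteq> nsets (\<pi> ` V) k"
  proof (intro image_subsetI)
    fix A assume A: "A \<in> \<F>"
    have "card (\<pi> ` A) = k" using sub[OF A] inj by (metis card_image inj_on_subset)
    then show "\<pi> ` A \<in> nsets (\<pi> ` V) k" using sub[OF A] by (auto simp: nsets_def)
  qed
  moreover have "inter2 (card D) ((`) \<pi> ` \<F>)"
    unfolding inter2_def using card_image_Int[OF inj sub(1) sub(1)] inter2D[OF F(2)] by simp
  moreover have "inter3 (card D - 1) ((`) \<pi> ` \<F>)"
    unfolding inter3_def
  proof (intro ballI)
    fix A' B' C' assume "A' \<in> (`) \<pi> ` \<F>" "B' \<in> (`) \<pi> ` \<F>" "C' \<in> (`) \<pi> ` \<F>"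
    then obtain A B C where A: "A \<in> \<F>" "A' = \<pi> ` A" "B \<in> \<F>" "B' = \<pi> ` B" "C \<in> \<F>" "C' = \<pi> ` C" by blast
    have "A' \<inter> B' = \<pi> ` (A \<inter> B)" using inj_on_image_Int[OF inj sub(1)[OF A(1)] sub(1)[OF A(3)]] A by simp
    then have "card (A' \<inter> B' \<inter> C') = card (A \<inter> B \<inter> C)"
      using card_image_Int[OF inj _ sub(1)[OF A(5)], of "A \<inter> B"] sub(1)[OF A(1)] A(6) by auto
    then show "card D - 1 \<le> card (A' \<inter> B' \<inter> C')" using inter3D[OF F(3) A(1,3,5)] by simp
  qed
  moreover have "card D - 1 \<le> card (\<pi> ` A \<inter> \<pi> ` D)" if "A \<in> \<F>" for A
    using card_image_Int[OF inj sub(1)[OF that] D] F(4)[OF that] by simp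
  moreover have "\<exists>x\<in>\<pi> ` D. \<exists>y\<in>\<pi> ` D. x \<noteq> y \<and> (\<exists>A\<in>(`) \<pi> ` \<F>. x \<notin> A) \<and> (\<exists>A\<in>(`) \<pi> ` \<F>. y \<notin> A)"
  proof -
    obtain x y A B where h: "x \<in> D" "y \<in> D" "x \<noteq> y" "A \<in> \<F>" "x \<notin> A" "B \<in> \<F>" "y \<notin> B"
      using adm unfolding admissible_def by blast
    have "\<pi> x \<notin> \<pi> ` A" "\<pi> y \<notin> \<pi> ` B" "\<pi> x \<noteq> \<pi> y"
      using h D sub(1)[OF h(4)] sub(1)[OF h(6)] inj_on_image_mem_iff[OF inj] inj_onD[OF inj] by blast+
    then show ?thesis using h by blast
  qed
  ultimately show ?thesis unfolding admissible_def cD by blast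
qed

lemma bounded_or_special_image:
  assumes inj: "inj_on \<pi> V" and F: "\<F> \<subseteq> Pow V" and b: "bounded_or_special V d \<kappa> \<F>"
  shows "bounded_or_special (\<pi> ` V) d \<kappa> ((`) \<pi> ` \<F>)"
proof -
  have "card ((`) \<pi> ` \<F>) = card \<F>"
    by (rule card_image) (use inj_on_image_Pow[OF inj] F inj_on_subset in blast)
  moreover have cV: "card (\<pi> ` S) = card S" if "S \<subseteq> V" for S using inj that by (meson card_image inj_on_subset)
  ultimately have size: ?thesis
    if "card \<F> < max (size_H d \<kappa> (card V - d)) (size_A d \<kappa> (card V - d))"
    using that unfolding bounded_or_special_def by simp
  from b consider "card \<F> < max (size_H d \<kappa> (card V - d)) (size_A d \<kappa> (card V - d))"
    | X M where "d + 2 \<le> \<kappa>" "M \<subseteq> V" "card M = d + \<kappa> + 1" "X \<subseteq> M" "card X = d" "\<F> \<subseteq> fam_H V (d + \<kappa>) d X M"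
    | Z where "Z \<subseteq> V" "card Z = d + 2" "\<F> \<subseteq> fam_A V (d + \<kappa>) d Z"
    unfolding bounded_or_special_def by blast
  then show ?thesis
  proof cases
    case 1
    then show ?thesis by (rule size)
  next
    case 2
    have "(`) \<pi> ` \<F> \<subseteq> fam_H (\<pi> ` V) (d + \<kappa>) d (\<pi> ` X) (\<pi> ` M)"
      using image_mono[OF 2(6), of "(`) \<pi>"] image_fam_H[OF inj 2(4,2)] by simp
    moreover have "\<pi> ` M \<subseteq> \<pi> ` V" "\<pi> ` X \<subseteq> \<pi> ` M" using 2 by blast+
    moreover have "card (\<pi> ` M) = d + \<kappa> + 1" "card (\<pi> ` X) = d" using cV[of M] cV[of X] 2 by auto
    ultimately show ?thesis using 2(1) unfolding bounded_or_special_def by blast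
  next
    case 3
    have "(`) \<pi> ` \<F> \<subseteq> fam_A (\<pi> ` V) (d + \<kappa>) d (\<pi> ` Z)"
      using image_mono[OF 3(3), of "(`) \<pi>"] image_fam_A[OF inj 3(1)] by simp
    moreover have "\<pi> ` Z \<subseteq> \<pi> ` V" "card (\<pi> ` Z) = d + 2" using 3 cV[of Z] by auto
    ultimately show ?thesis unfolding bounded_or_special_def by blast
  qed
qed

lemma admissible_bounded:
  assumes V: "finite V" and D: "D \<subseteq> V" "card D = d" and d: "2 \<le> d"
    and k: "k = d + \<kappa>" and \<kappa>: "1 \<le> \<kappa>" and n: "d + (d + 1) * \<kappa> + 2 \<le> card V"
    and adm: "admissible V D k \<F>"
  shows "bounded_or_special V d \<kappa> \<F>"
proof -
  \<comment> \<open>Exceeds every point of \<open>D\<close>, so that adding it to the remaining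
    points puts \<open>D\<close> in front and keeps \<open>\<rho>\<close> injective.\<close>
  define s where "s = Suc (\<Sum>D)"
  define \<rho> where "\<rho> x = (if x \<in> D then x else x + s)" for x
  have fD: "finite D" using D(1) V by (rule finite_subset)
  have xs: "x < s" if "x \<in> D" for x using that fD member_le_sum[of x D id] by (simp add: s_def less_Suc_eq_le)
  have inj: "inj_on \<rho> V"
  proof (rule inj_onI)
    fix x y assume "\<rho> x = \<rho> y"
    then show "x = y" using xs[of x] xs[of y] by (auto simp: \<rho>_def split: if_splits)
  qed
  have F: "\<F> \<subseteq> Pow V" using adm by (auto simp: admissible_def nsets_def)
  have c: "card (\<rho> ` V) = card V" "card (\<rho> ` D) = d" using inj D by (metis card_image inj_on_subset)+
  have "bounded_or_special (\<rho> ` V) d \<kappa> ((`) \<rho> ` \<F>)"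
  proof (rule admissible_bounded_low[OF _ _ c(2) d _ k \<kappa>])
    show "admissible (\<rho> ` V) (\<rho> ` D) k ((`) \<rho> ` \<F>)" using admissible_image[OF inj D(1) adm] .
    show "x < c" if "x \<in> \<rho> ` D" "c \<in> \<rho> ` V - \<rho> ` D" for x c
    proof -
      have "x < s" using that(1) xs by (auto simp: \<rho>_def)
      moreover have "s \<le> c" using that(2) by (auto simp: \<rho>_def split: if_splits)
      ultimately show ?thesis by simp
    qed
  qed (use V D n c in auto)
  then have "bounded_or_special (inv_into V \<rho> ` \<rho> ` V) d \<kappa> ((`) (inv_into V \<rho>) ` (`) \<rho> ` \<F>)"
    by (rule bounded_or_special_image[rotated 2]) (use F in \<open>auto intro: inj_on_inv_into\<close>)
  moreover have inv: "inv_into V \<rho> ` \<rho> ` A = A" if "A \<subseteq> V" for A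
    using inv_into_image_cancel[OF inj that] .
  moreover have "(`) (inv_into V \<rho>) ` (`) \<rho> ` \<F> = \<F>"
  proof -
    have "(`) (inv_into V \<rho>) ` (`) \<rho> ` \<F> = (\<lambda>A. inv_into V \<rho> ` \<rho> ` A) ` \<F>"
      by (simp only: image_image[of "(`) (inv_into V \<rho>)" "(`) \<rho>"])
    also have "\<dots> = (\<lambda>A. A) ` \<F>" by (rule image_cong[OF refl]) (use inv F in auto)
    finally show ?thesis by simp
  qed
  ultimately show ?thesis by simp
qed

text \<open>Each further member of a nontrivial family shrinks the common intersection.\<close>

lemma card_Inter_nontrivial:
  assumes F: "\<F> \<subseteq> nsets {1..n} k" and r: "r_wise_t_intersecting r t \<F>" and nt: "\<not> trivial_family n t \<F>"
    and H: "\<H> \<subseteq> \<F>" "finite \<H>" "\<H> \<noteq> {}" "card \<H> \<le> r"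
  shows "t + (r - card \<H>) \<le> card (\<Inter>\<H>)"
  using H
proof (induction "r - card \<H>" arbitrary: \<H>)
  case (0 \<H>)
  then have "card \<H> = r" by simp
  obtain h where "bij_betw h {1..card \<H>} \<H>" using ex_bij_betw_nat_finite_1[OF 0(3)] by blast
  then have h: "h ` {1..r} = \<H>" using \<open>card \<H> = r\<close> by (simp add: bij_betw_def)
  then have "\<forall>i\<in>{1..r}. h i \<in> \<F>" using 0 by blast
  then have "t \<le> card (\<Inter>i\<in>{1..r}. h i)" using r by (simp add: r_wise_t_intersecting_def)
  then show ?case using h \<open>card \<H> = r\<close> by simp
next
  case (Suc m \<H>)
  have c1: "1 \<le> card \<H>" using Suc.prems by (simp add: Suc_le_eq card_gt_0_iff)
  obtain h where "bij_betw h {1..card \<H>} \<H>" using ex_bij_betw_nat_finite_1[OF Suc.prems(2)] by blast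
  then have h: "h ` {1..card \<H>} = \<H>" by (simp add: bij_betw_def)
  \<comment> \<open>The definition speaks of exactly \<open>r\<close> sets, so the remaining indices
    repeat the first set.\<close>
  define f where "f i = h (if i \<le> card \<H> then i else 1)" for i
  have "f ` {1..r} = \<H>"
  proof
    show "f ` {1..r} \<subseteq> \<H>" using h c1 by (auto simp: f_def)
    show "\<H> \<subseteq> f ` {1..r}"
    proof
      fix A assume "A \<in> \<H>"
      then obtain i where "i \<in> {1..card \<H>}" "A = h i" using h by blast
      then show "A \<in> f ` {1..r}" using Suc.prems(4) by (intro image_eqI[of _ _ i]) (auto simp: f_def)
    qed
  qed
  moreover from this have "\<forall>i\<in>{1..r}. f i \<in> \<F>" using Suc.prems by blast
  then have "t \<le> card (\<Inter>i\<in>{1..r}. f i)" using r by (simp add: r_wise_t_intersecting_def)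
  ultimately have t: "t \<le> card (\<Inter>\<H>)" by simp
  obtain A0 where A0: "A0 \<in> \<H>" using Suc.prems by blast
  have "A0 \<in> nsets {1..n} k" using A0 Suc.prems(1) F by blast
  then have "A0 \<subseteq> {1..n}" by (simp add: nsets_def)
  then have sub: "\<Inter>\<H> \<subseteq> {1..n}" using A0 by blast
  then have fin: "finite (\<Inter>\<H>)" by (rule finite_subset) simp
  \<comment> \<open>Nontriviality concerns \<open>t\<close>-sets only; it is applied to a
    \<open>t\<close>-subset of the current intersection.\<close>
  obtain A where A: "A \<in> \<F>" "\<not> \<Inter>\<H> \<subseteq> A"
  proof -
    obtain T where T: "T \<subseteq> \<Inter>\<H>" "card T = t" using t by (meson obtain_subset_with_card_n)
    have Tn: "T \<subseteq> {1..n}" using T(1) sub by (rule subset_trans)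
    moreover have "finite T" using Tn by (rule finite_subset) simp
    ultimately have "T \<in> nsets {1..n} t" using T(2) by (simp add: nsets_def)
    then obtain A where "A \<in> \<F>" "\<not> T \<subseteq> A" using nt unfolding trivial_family_def by blast
    then show ?thesis using that T(1) by blast
  qed
  then have "A \<notin> \<H>" by blast
  then have c: "card (insert A \<H>) = Suc (card \<H>)" using Suc.prems by simp
  have "t + (r - card (insert A \<H>)) \<le> card (\<Inter>(insert A \<H>))"
    using Suc.hyps(2) c A Suc.prems by (intro Suc.hyps(1)) auto
  moreover have "\<Inter>(insert A \<H>) \<subset> \<Inter>\<H>" using A by auto
  then have "card (\<Inter>(insert A \<H>)) < card (\<Inter>\<H>)" using fin by (rule psubset_card_mono[rotated])
  ultimately show ?case using c Suc.hyps(2) by linarith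
qed

lemma nontrivial_bounded:
  assumes r: "3 \<le> r" and t: "1 \<le> t" and d: "d = t + r - 2" and k: "k = d + \<kappa>" "1 \<le> \<kappa>"
    and n: "d + (d + 1) * \<kappa> + 2 \<le> n"
    and F: "\<F> \<subseteq> nsets {1..n} k" and rw: "r_wise_t_intersecting r t \<F>" and nt: "\<not> trivial_family n t \<F>"
  shows "bounded_or_special {1..n} d \<kappa> \<F>"
proof -
  have d2: "2 \<le> d" using r t d by simp
  have mem: "A \<subseteq> {1..n} \<and> finite A \<and> card A = k" if "A \<in> \<F>" for A using that F by (auto simp: nsets_def)
  note cI = card_Inter_nontrivial[OF F rw nt]
  have i2: "inter2 d \<F>" unfolding inter2_def
  proof (intro ballI)
    fix A B assume "A \<in> \<F>" "B \<in> \<F>"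
    moreover have "card {A, B} \<le> 2" by (simp add: card_insert_if)
    ultimately show "d \<le> card (A \<inter> B)" using cI[of "{A, B}"] r d by simp
  qed
  have i3: "inter3 (d - 1) \<F>" unfolding inter3_def
  proof (intro ballI)
    fix A B C assume "A \<in> \<F>" "B \<in> \<F>" "C \<in> \<F>"
    moreover have "card {A, B, C} \<le> 3" by (simp add: card_insert_if)
    ultimately show "d - 1 \<le> card (A \<inter> B \<inter> C)" using cI[of "{A, B, C}"] r d by (simp add: Int_assoc)
  qed
  show ?thesis
  proof (cases "inter2 (d + 1) \<F>")
    case True
    define N where "N = n - d"
    have N: "card {1..n} - d = N" "2 \<le> N" using n by (auto simp: N_def)
    have nn: "(d + 1) * (\<kappa> + 1) < n" using n by simp
    have "3 * \<kappa> \<le> (d + 1) * \<kappa>" using d2 by (intro mult_le_mono1) simp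
    then have "d + 2 * \<kappa> \<le> n" using n by linarith
    then have "card \<F> \<le> (card {1..n} - 1) choose (k - (d + 1))"
      using k by (intro card_inter2_le[OF _ _ F True]) auto
    also have "\<dots> = (n - 1) choose (\<kappa> - 1)" using k by simp
    also have "\<dots> < (d + 2) * ((n - d - 2) choose (\<kappa> - 1))" by (rule choose_next_level_less[OF d2 k(2) nn])
    also have "\<dots> \<le> size_A d \<kappa> N" using size_A_eq[OF k(2) N(2)] by (simp add: N_def)
    finally show ?thesis unfolding bounded_or_special_def N(1) by (simp add: less_max_iff_disj)
  next
    case False
    then obtain A B where AB: "A \<in> \<F>" "B \<in> \<F>" "card (A \<inter> B) < d + 1" unfolding inter2_def by auto
    define D where "D = A \<inter> B"
    have cD: "card D = d" using AB inter2D[OF i2 AB(1,2)] by (simp add: D_def)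
    have DV: "D \<subseteq> {1..n}" using mem[OF AB(1)] by (auto simp: D_def)
    have fD: "finite D" using DV finite_subset by blast
    \<comment> \<open>After removing \<open>x\<close> from \<open>D\<close> there remain
      \<open>d - 1 \<ge> t\<close> points, by \<open>r \<ge> 3\<close>, so not all members contain
      them.\<close>
    have miss: "\<exists>y\<in>D. y \<noteq> x \<and> (\<exists>A\<in>\<F>. y \<notin> A)" if x: "x \<in> D" for x
    proof -
      have "t \<le> card (D - {x})" using x cD fD d r by simp
      then obtain T where T: "T \<subseteq> D - {x}" "card T = t" by (meson obtain_subset_with_card_n)
      then have "T \<in> nsets {1..n} t" using DV fD by (auto simp: nsets_def intro: finite_subset)
      then obtain A where "A \<in> \<F>" "\<not> T \<subseteq> A" using nt unfolding trivial_family_def by blast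
      then show ?thesis using T by blast
    qed
    have "D \<noteq> {}" using cD d2 by auto
    then obtain y where y: "y \<in> D" "\<exists>A\<in>\<F>. y \<notin> A" using miss by blast
    then obtain z where "z \<in> D" "z \<noteq> y" "\<exists>A\<in>\<F>. z \<notin> A" using miss by blast
    moreover have "d - 1 \<le> card (E \<inter> D)" if "E \<in> \<F>" for E
      using inter3D[OF i3 that AB(1,2)] by (simp add: D_def Int_assoc)
    ultimately have "admissible {1..n} D k \<F>" unfolding admissible_def cD using F i2 i3 y by blast
    then show ?thesis using admissible_bounded[OF _ DV cD d2 k] n by simp
  qed
qed

section \<open>The bounds \<open>h1\<close> and \<open>h2\<close> as sizes of the extremal
  families\<close>

lemma binom_of_nat: "binom (int a) (int b) = int (a choose b)"
  by (simp add: binom_def binomial_eq_0)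

text \<open>For \<open>c = k + 1\<close> Pascal's rule merges the second and the third term into
  \<open>(N - \<kappa> - 1) choose \<kappa>\<close>, and the last term is \<open>d\<close>.\<close>

lemma h1_eq_size_H:
  assumes "k = d + \<kappa>" "1 \<le> \<kappa>" "n = d + N" "2 * \<kappa> + 1 \<le> N"
  shows "h1 (int n) (int d) (int k) (int k + 1) = int (size_H d \<kappa> N)"
proof -
  have e: "int n - int d = int N" "int k - int d = int \<kappa>" "int n - int k = int (N - \<kappa>)"
    "int n - (int k + 1) = int (N - \<kappa> - 1)" "2 * int k - (int k + 1) - int d = int (\<kappa> - 1)"
    using assms by auto
  have "(N - \<kappa>) choose \<kappa> = ((N - \<kappa> - 1) choose (\<kappa> - 1)) + ((N - \<kappa> - 1) choose \<kappa>)"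
    using assms by (intro choose_reduce_nat) auto
  moreover have "(N - \<kappa> - 1) choose \<kappa> \<le> N choose \<kappa>" by (intro binomial_right_mono) simp
  ultimately show ?thesis unfolding h1_def e binom_of_nat size_H_def by (simp add: of_nat_diff)
qed

text \<open>One Pascal step on \<open>(N - 1) choose (\<kappa> - 1)\<close>. For
  \<open>\<kappa> = 1\<close> the second coefficient has a negative lower index and is
  \<open>0\<close> by the convention of \<open>binom\<close>.\<close>

lemma h2_eq_size_A:
  assumes "k = d + \<kappa>" "1 \<le> \<kappa>" "n = d + N" "2 \<le> N"
  shows "h2 (int n) (int k) (int d + 2) = int (size_A d \<kappa> N)"
proof -
  have e: "int n - int d - 1 = int (N - 1)" "int k - int d - 1 = int (\<kappa> - 1)" "int n - int d - 2 = int (N - 2)"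
    using assms by auto
  have N1: "N - 1 = Suc (N - 2)" using assms by simp
  have h: "h2 (int n) (int k) (int d + 2) =
      (int d + 2) * int ((N - 1) choose (\<kappa> - 1)) - (int d + 1) * binom (int (N - 2)) (int k - int d - 2)"
    by (simp only: h2_def Let_def add_diff_cancel_right' e binom_of_nat)
  show ?thesis
  proof (cases "\<kappa> = 1")
    case True
    then show ?thesis unfolding h size_A_eq[OF assms(2,4)] using assms by (simp add: binom_def)
  next
    case False
    then have e2: "int k - int d - 2 = int (\<kappa> - 2)" "\<kappa> - 1 = Suc (\<kappa> - 2)" using assms by auto
    show ?thesis unfolding h size_A_eq[OF assms(2,4)] e2(1) binom_of_nat e2(2) N1
      using False by (simp add: algebra_simps)
  qed
qed

lemma size_H_le_size_A:
  assumes "2 \<le> d" "1 \<le> \<kappa>" "\<kappa> \<le> d + 1" "(d + 1) * \<kappa> + 2 \<le> N"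
  shows "size_H d \<kappa> N \<le> size_A d \<kappa> N"
proof (cases "\<kappa> = 1")
  case True
  then show ?thesis using assms by (simp add: size_H_def size_A_def)
next
  case False
  then have "((N - 2) choose \<kappa>) + d < ((N - \<kappa> - 1) choose \<kappa>) + d * ((N - 2) choose (\<kappa> - 1))"
    using choose_small_uniformity[OF assms(1) _ assms(3,4)] assms(2) by simp
  moreover have "(N - 2) choose \<kappa> \<le> N choose \<kappa>" "(N - \<kappa> - 1) choose \<kappa> \<le> N choose \<kappa>"
    by (intro binomial_right_mono; simp)+
  ultimately show ?thesis unfolding size_H_def size_A_def by linarith
qed

theorem theorem1p1:
  fixes n k t r :: nat and \<F> :: "nat set set"
  assumes "r \<ge> 3"
    and "t \<le> n"
    and "(int t + int r - 1) * (int k - int t - int r + 3) < int n"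
    and "\<F> \<subseteq> nsets {1..n} k"
    and "r_wise_t_intersecting r t \<F>"
    and "\<not> trivial_family n t \<F>"
  shows "(2 * t + 2 * r - 3 < k \<longrightarrow>
      int (card \<F>) \<le> max (h1 n (t + r - 2) k (k + 1)) (h2 n k (t + r)) \<and>
      (int (card \<F>) = max (h1 n (t + r - 2) k (k + 1)) (h2 n k (t + r)) \<longrightarrow>
         (h1 n (t + r - 2) k (k + 1) \<ge> h2 n k (t + r) \<and>
          (\<exists>M \<in> nsets {1..n} (k + 1). \<exists>X \<in> nsets M (t + r - 2). \<F> = family_H n k (t + r - 1) X M)) \<or>
         (h2 n k (t + r) \<ge> h1 n (t + r - 2) k (k + 1) \<and>
          (\<exists>Z \<in> nsets {1..n} (t + r). \<F> = family_A n k (t + r - 1) Z)))) \<and>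
    (2 * t + 2 * r - 3 \<ge> k \<longrightarrow>
      int (card \<F>) \<le> h2 n k (t + r) \<and>
      (int (card \<F>) = h2 n k (t + r) \<longrightarrow>
         (\<exists>Z \<in> nsets {1..n} (t + r). \<F> = family_A n k (t + r - 1) Z)))"
proof -
  \<comment> \<open>For \<open>t = 0\<close> the empty set would be a common
    \<open>t\<close>-subset.\<close>
  have t: "1 \<le> t"
  proof (rule ccontr)
    assume "\<not> 1 \<le> t"
    then have "{} \<in> nsets {1..n} t" by (simp add: nsets_def)
    then show False using assms(6) by (auto simp: trivial_family_def)
  qed
  define d where "d = t + r - 2"
  have d: "2 \<le> d" "t + r = d + 2" "t + r - 1 = d + 1" "t + r - 2 = d" using t assms(1) by (auto simp: d_def)
  have mem: "A \<subseteq> {1..n} \<and> finite A \<and> card A = k" if "A \<in> \<F>" for A using that assms(4) by (auto simp: nsets_def)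
  \<comment> \<open>\<open>t \<le> n\<close> provides some \<open>t\<close>-subset of the ground
    set, which makes the empty family trivial.\<close>
  have "\<F> \<noteq> {}"
  proof
    assume "\<F> = {}"
    moreover have "{1..t} \<in> nsets {1..n} t" using assms(2) by (auto simp: nsets_def)
    ultimately show False using assms(6) by (auto simp: trivial_family_def)
  qed
  then obtain A where A: "A \<in> \<F>" by blast
  \<comment> \<open>A single member already has at least \<open>t + r - 1 = d + 1\<close> points,
    which yields \<open>\<kappa> \<ge> 1\<close>.\<close>
  have "t + (r - 1) \<le> card A" using card_Inter_nontrivial[OF assms(4-6), of "{A}"] A assms(1) by simp
  then have kd: "d + 1 \<le> k" using mem[OF A] d by simp
  define \<kappa> where "\<kappa> = k - d"
  have \<kappa>: "k = d + \<kappa>" "1 \<le> \<kappa>" using kd by (auto simp: \<kappa>_def)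
  have "int ((d + 1) * (\<kappa> + 1)) < int n"
  proof -
    have "int t + int r - 1 = int (d + 1)" "int k - int t - int r + 3 = int (\<kappa> + 1)" using d \<kappa> by auto
    then show ?thesis using assms(3) by (metis of_nat_mult)
  qed
  then have n: "d + (d + 1) * \<kappa> + 2 \<le> n" by (simp only: of_nat_less_iff) simp
  define N where "N = n - d"
  have N: "n = d + N" "(d + 1) * \<kappa> + 2 \<le> N" "card {1..n} - d = N" "card {1..n} = d + N"
    using n by (auto simp: N_def)
  have "2 * \<kappa> \<le> (d + 1) * \<kappa>" using d by (intro mult_le_mono1) simp
  then have N2: "2 * \<kappa> + 1 \<le> N" "2 \<le> N" using N by linarith+
  have h1: "h1 n (t + r - 2) k (k + 1) = int (size_H d \<kappa> N)"
    using h1_eq_size_H[OF \<kappa> N(1) N2(1)] d by (simp add: add.commute)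
  have h2: "h2 n k (t + r) = int (size_A d \<kappa> N)"
    using h2_eq_size_A[OF \<kappa> N(1) N2(2)] d by (simp add: add.commute)
  have b: "bounded_or_special {1..n} d \<kappa> \<F>"
    by (rule nontrivial_bounded[OF assms(1) t d_def \<kappa> n assms(4-6)])
  have H: "card \<F> \<le> size_H d \<kappa> N \<and> (card \<F> = size_H d \<kappa> N \<longrightarrow>
      (\<exists>M \<in> nsets {1..n} (k + 1). \<exists>X \<in> nsets M d. \<F> = family_H n k (d + 1) X M))"
    if h: "M \<subseteq> {1..n}" "card M = d + \<kappa> + 1" "X \<subseteq> M" "card X = d" "\<F> \<subseteq> fam_H {1..n} (d + \<kappa>) d X M" for X M
  proof -
    have fin: "finite (fam_H {1..n} k d X M)" using fam_H_subset[OF h(1)] by (rule finite_subset) (simp add: finite_nsets)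
    have c: "card (fam_H {1..n} k d X M) = size_H d \<kappa> N"
      using card_fam_H[OF _ h(1) _ h(3,4) \<kappa> N(4)] h(2) \<kappa> by simp
    have F: "\<F> \<subseteq> fam_H {1..n} k d X M" using h \<kappa> by simp
    have "finite M" using h(1) finite_subset by blast
    then have "M \<in> nsets {1..n} (k + 1)" "X \<in> nsets M d"
      using h \<kappa> finite_subset[OF h(3)] by (auto simp: nsets_def)
    moreover have "\<F> = family_H n k (d + 1) X M" if "card \<F> = size_H d \<kappa> N"
      using card_subset_eq[OF fin F] c that by (simp add: fam_H_def family_H_def)
    ultimately show ?thesis using card_mono[OF fin F] c by auto
  qed
  have A: "card \<F> \<le> size_A d \<kappa> N \<and> (card \<F> = size_A d \<kappa> N \<longrightarrow>
      (\<exists>Z \<in> nsets {1..n} (d + 2). \<F> = family_A n k (d + 1) Z))"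
    if h: "Z \<subseteq> {1..n}" "card Z = d + 2" "\<F> \<subseteq> fam_A {1..n} (d + \<kappa>) d Z" for Z
  proof -
    have fin: "finite (fam_A {1..n} k d Z)" using fam_A_subset by (rule finite_subset) (simp add: finite_nsets)
    have c: "card (fam_A {1..n} k d Z) = size_A d \<kappa> N" using card_fam_A[OF _ h(1,2) \<kappa> N(4)] by simp
    have F: "\<F> \<subseteq> fam_A {1..n} k d Z" using h \<kappa> by simp
    have "Z \<in> nsets {1..n} (d + 2)" using h finite_subset[OF h(1)] by (auto simp: nsets_def)
    moreover have "\<F> = family_A n k (d + 1) Z" if "card \<F> = size_A d \<kappa> N"
      using card_subset_eq[OF fin F] c that by (simp add: fam_A_def family_A_def)
    ultimately show ?thesis using card_mono[OF fin F] c by auto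
  qed
  define a where "a = size_H d \<kappa> N"
  define b' where "b' = size_A d \<kappa> N"
  define PH where "PH \<longleftrightarrow> (\<exists>M \<in> nsets {1..n} (k + 1). \<exists>X \<in> nsets M d. \<F> = family_H n k (d + 1) X M)"
  define PA where "PA \<longleftrightarrow> (\<exists>Z \<in> nsets {1..n} (d + 2). \<F> = family_A n k (d + 1) Z)"
  have cases: "card \<F> < max a b' \<or> (d + 2 \<le> \<kappa> \<and> card \<F> \<le> a \<and> (card \<F> = a \<longrightarrow> PH)) \<or>
      (card \<F> \<le> b' \<and> (card \<F> = b' \<longrightarrow> PA))"
    using b H A unfolding bounded_or_special_def N(3) a_def b'_def PH_def PA_def by blast
  have small: "a \<le> b'" if "\<kappa> \<le> d + 1"
    using size_H_le_size_A[OF d(1) \<kappa>(2) that N(2)] by (simp add: a_def b'_def)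
  have "2 * t + 2 * r - 3 < k \<longleftrightarrow> d + 2 \<le> \<kappa>" using d(2) \<kappa>(1) d(1) by linarith
  then have k_iff: "2 * t + 2 * r - 3 < k \<longleftrightarrow> d + 2 \<le> \<kappa>" "2 * t + 2 * r - 3 \<ge> k \<longleftrightarrow> \<kappa> \<le> d + 1" by auto
  have "(d + 2 \<le> \<kappa> \<longrightarrow> int (card \<F>) \<le> max (int a) (int b') \<and>
      (int (card \<F>) = max (int a) (int b') \<longrightarrow> (int a \<ge> int b' \<and> PH) \<or> (int b' \<ge> int a \<and> PA))) \<and>
    (\<kappa> \<le> d + 1 \<longrightarrow> int (card \<F>) \<le> int b' \<and> (int (card \<F>) = int b' \<longrightarrow> PA))"
    using cases small by (auto simp: max_def split: if_splits)
  then show ?thesis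
    unfolding h1 h2 unfolding k_iff d(3,4) unfolding d(2) a_def b'_def PH_def PA_def .
qed

end
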